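(* Let $\gamma>3/2$ and $1\le m<n$, and let $\psi$, $\Gamma_\varepsilon$, $\varphi_0$, $K$, $T^\varepsilon_\lambda$ and $T^*_\lambda$ be as in the context. There is a constant $C$, independent of $\lambda$ and of $x_{n+1}$ (it may depend on $n,m,\gamma,\varphi_0,K,\psi$), such that for every $\lambda>0$ and every $x_{n+1}\in\mathbb{R}$ $$\|T_\lambda^*\|\le C\,\lambda^{-\frac{m}{2}\frac{n}{n+2}}.$$
   Context: Let $n\ge1$. Let $\psi\in C^\infty(\mathbb{R}^n)$ be real-valued, bounded, with bounded derivatives of all orders. For $\varepsilon>0$ let $\Gamma_\varepsilon=\{(y,\varepsilon^\gamma\psi(y/\varepsilon)): y\in\mathbb{R}^n\}$, with induced surface measure $d\sigma_\varepsilon$, where $\gamma>0$ is the fixed parameter in the claim. Let $\varphi_0\in C_0^\infty(\mathbb{R}^{n+1}\times\mathbb{R}^n)$ be real-valued. Let $K\in C^\infty(\mathbb{R}^{n+1}\setminus\{0\})$ satisfy, for every $\alpha\in\mathbb{Z}^{n+1}_+$, $|D^\alpha K(z)|\le C_\alpha|z|^{m-n-|\alpha|}$ for all $z\in\mathbb{R}^{n+1}\setminus\{0\}$, where $m$ (not necessarily an integer) is the exponent in the claim. For $f\in L^2(\mathbb{R}^n)$, $\lambda>0$, $\varepsilon>0$ and $(x,x_{n+1})\in\mathbb{R}^n\times\mathbb{R}$ define $$T^\varepsilon_\lambda f(x,x_{n+1})=\int_{\Gamma_\varepsilon}e^{i\lambda x\cdot y}\,\varphi_0((x,x_{n+1}),y)\,K(x-y,x_{n+1}-y_{n+1})\,f(y)\,d\sigma_\varepsilon(y,y_{n+1}),$$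 where $y_{n+1}=\varepsilon^\gamma\psi(y/\varepsilon)$ on $\Gamma_\varepsilon$, and the maximal operator $$T^*_\lambda f(x,x_{n+1})=\sup_{0<\varepsilon\le1}|T^\varepsilon_\lambda f(x,x_{n+1})|.$$ For fixed $x_{n+1}$, $\|T^*_\lambda\|$ denotes the norm of the sublinear operator $f\mapsto T^*_\lambda f(\cdot,x_{n+1})$ from $L^2(\mathbb{R}^n)$ to $L^2(\mathbb{R}^n)$, i.e. the smallest $A$ with $\|T^*_\lambda f(\cdot,x_{n+1})\|_{L^2(\mathbb{R}^n)}\le A\|f\|_{L^2(\mathbb{R}^n)}$ for all $f\in L^2(\mathbb{R}^n)$. *)

theory Defs
  imports "HOL-Analysis.Analysis"
begin

text \<open>
  Higher partial derivatives. A multi-index \<open>\<alpha>\<close> is given by a list of coordinate directions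
  (elements of \<^const>\<open>Basis\<close>) in which one differentiates successively, so that \<open>|\<alpha>|\<close> is the length
  of the list. For smooth functions the order in the list is irrelevant, and every
  multi-index arises from some list.
\<close>

primrec iter_pderiv ::
    "'a::euclidean_space list \<Rightarrow> ('a \<Rightarrow> 'b::real_normed_vector) \<Rightarrow> 'a \<Rightarrow> 'b" where
  "iter_pderiv [] f = f"
| "iter_pderiv (b # bs) f = (\<lambda>x. frechet_derivative (iter_pderiv bs f) (at x) b)"

text \<open>\<open>f \<in> C\<^sup>\<infinity>(S)\<close>, meant for open \<open>S\<close>.\<close>

definition smooth_on ::
    "'a::euclidean_space set \<Rightarrow> ('a \<Rightarrow> 'b::real_normed_vector) \<Rightarrow> bool" where
  "smooth_on S f \<longleftrightarrow> (\<forall>bs \<in> lists Basis. \<forall>x\<in>S. iter_pderiv bs f differentiable (at x))"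

definition bounded_derivs :: "('a::euclidean_space \<Rightarrow> 'b::real_normed_vector) \<Rightarrow> bool" where
  "bounded_derivs f \<longleftrightarrow> (\<forall>bs \<in> lists Basis. bounded (range (iter_pderiv bs f)))"

definition compactly_supported :: "('a::topological_space \<Rightarrow> 'b::zero) \<Rightarrow> bool" where
  "compactly_supported f \<longleftrightarrow> compact (closure {x. f x \<noteq> 0})"

text \<open>Kernel estimates \<open>|D\<^sup>\<alpha> K(z)| \<le> C\<^sub>\<alpha> |z| powr (s - |\<alpha>|)\<close>.\<close>

definition kernel_bounds :: "real \<Rightarrow> ('a::euclidean_space \<Rightarrow> complex) \<Rightarrow> bool" where
  "kernel_bounds s K \<longleftrightarrow>
     (\<forall>bs \<in> lists Basis. \<exists>C. \<forall>z. z \<noteq> 0 \<longrightarrow>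
        norm (iter_pderiv bs K z) \<le> C * norm z powr (s - real (length bs)))"

definition osc_profile ::
    "('a::euclidean_space \<Rightarrow> real) \<Rightarrow> real \<Rightarrow> real \<Rightarrow> 'a \<Rightarrow> real" where
  "osc_profile \<psi> \<gamma> \<epsilon> y = \<epsilon> powr \<gamma> * \<psi> (y /\<^sub>R \<epsilon>)"

text \<open>
  Induced surface measure on the graph \<open>{(y, h y)}\<close> of a smooth function \<open>h\<close>: its space is the
  graph, its measurable sets are the lifts of Lebesgue measurable sets, and in the coordinate \<open>y\<close>
  it is \<open>sqrt (1 + |\<nabla>h(y)|\<^sup>2) dy\<close>.
\<close>

definition graph_surface_measure ::
    "('a::euclidean_space \<Rightarrow> real) \<Rightarrow> ('a \<times> real) measure" where
  "graph_surface_measure h =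
     embed_measure
       (density lebesgue
          (\<lambda>y. ennreal (sqrt (1 + (\<Sum>b\<in>Basis. (frechet_derivative h (at y) b)\<^sup>2)))))
       (\<lambda>y. (y, h y))"

text \<open>
  For \<open>f \<in> L\<^sup>2\<close> the integral converges absolutely for almost all \<open>x\<close>, with an exceptional null set
  that can be chosen independently of \<open>\<epsilon>\<close>; elsewhere the Bochner integral may take the
  default value \<open>0\<close>, which does not affect \<open>L\<^sup>2\<close> norms.
\<close>

definition T_op ::
    "('a::euclidean_space \<Rightarrow> real) \<Rightarrow> real \<Rightarrow> (('a \<times> real) \<times> 'a \<Rightarrow> real) \<Rightarrow> ('a \<times> real \<Rightarrow> complex) \<Rightarrow>
     real \<Rightarrow> real \<Rightarrow> ('a \<Rightarrow> complex) \<Rightarrow> 'a \<times> real \<Rightarrow> complex" where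
  "T_op \<psi> \<gamma> \<phi>\<^sub>0 K lam \<epsilon> f X =
     (\<integral>Y. cis (lam * (fst X \<bullet> fst Y)) * complex_of_real (\<phi>\<^sub>0 (X, fst Y)) * K (X - Y) * f (fst Y)
        \<partial>graph_surface_measure (osc_profile \<psi> \<gamma> \<epsilon>))"

definition T_max ::
    "('a::euclidean_space \<Rightarrow> real) \<Rightarrow> real \<Rightarrow> (('a \<times> real) \<times> 'a \<Rightarrow> real) \<Rightarrow> ('a \<times> real \<Rightarrow> complex) \<Rightarrow>
     real \<Rightarrow> ('a \<Rightarrow> complex) \<Rightarrow> 'a \<times> real \<Rightarrow> ennreal" where
  "T_max \<psi> \<gamma> \<phi>\<^sub>0 K lam f X = (SUP \<epsilon>\<in>{0<..1}. ennreal (norm (T_op \<psi> \<gamma> \<phi>\<^sub>0 K lam \<epsilon> f X)))"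

definition L2_norm :: "('a::euclidean_space \<Rightarrow> ennreal) \<Rightarrow> ennreal" where
  "L2_norm g = (let I = (\<integral>\<^sup>+x. (g x)\<^sup>2 \<partial>lebesgue) in
                if I = \<infinity> then \<infinity> else ennreal (sqrt (enn2real I)))"

definition L2 :: "('a::euclidean_space \<Rightarrow> complex) set" where
  "L2 = {f \<in> borel_measurable lebesgue. L2_norm (\<lambda>x. ennreal (norm (f x))) < \<infinity>}"

text \<open>
  Norm of a sublinear operator from \<open>L\<^sup>2\<close> to \<open>L\<^sup>2\<close> whose values are functions with values in
  \<open>[0,\<infinity>]\<close>. Measurability of the image is required explicitly because \<^const>\<open>nn_integral\<close> is only a
  lower integral for non-measurable functions; the norm is \<open>\<infinity>\<close> if it fails.
\<close>

definition L2_opnorm :: "(('a::euclidean_space \<Rightarrow> complex) \<Rightarrow> 'a \<Rightarrow> ennreal) \<Rightarrow> ennreal" where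
  "L2_opnorm T = Inf {A. \<forall>f\<in>L2. T f \<in> borel_measurable lebesgue \<and>
                         L2_norm (T f) \<le> A * L2_norm (\<lambda>x. ennreal (norm (f x)))}"

end

theory Submission
  imports Defs
begin

text \<open>
  Write \<open>n\<close> for the dimension. In the graph coordinate \<open>y\<close> the operator has the kernel
  \<open>exp (i lam x \<bullet> y) a\<^sub>\<epsilon>(x, y)\<close> with \<open>|a\<^sub>\<epsilon>(x, y)| \<le> C |x - y| powr (m - n)\<close>, and every
  derivative in \<open>x\<close> costs a factor \<open>|x - y| powr -1\<close>. All these bounds are uniform in \<open>\<epsilon>\<close>, because
  the oscillation of the graph affects only the dependence on \<open>y\<close>. Hence integration by parts
  is done in \<open>x\<close> alone.

  For \<open>lam < 1\<close> the Schur test with the locally integrable majorant \<open>|x - y| powr (m - n)\<close>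
  suffices. For \<open>lam \<ge> 1\<close> put \<open>r = lam powr (- n / (2 (n + 2)))\<close>, that is
  \<open>lam powr -n = r powr (2 n + 4)\<close>; the claim is then a bound by \<open>C r powr m\<close>, and the kernel
  is cut smoothly at \<open>|x - y| \<approx> r\<close>.

  \<^item> Near the diagonal the Schur test gives \<open>C r powr m\<close> at once, also for the supremum over
    \<open>\<epsilon>\<close> (\<open>riesz_local_bound\<close>).

  \<^item> Away from the diagonal the supremum over \<open>\<epsilon>\<close> is at most the value at \<open>\<epsilon> = 1\<close> plus the integral
    over \<open>s \<in> (0, 1]\<close> of the absolute value of the \<open>s\<close>-derivative (\<open>far_pointwise\<close>). Differentiating
    in \<open>s\<close> costs at most one more factor \<open>|x - y| powr -1\<close>, from the vertical derivative of the kernel,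
    and a factor \<open>s powr -\<beta>\<close>: the height \<open>s powr \<gamma> \<psi>(y / s)\<close> has \<open>s\<close>-derivative
    \<open>O(s powr (\<gamma> - 2))\<close> and the area element has \<open>s\<close>-derivative \<open>O(s powr (2 \<gamma> - 4))\<close>. Here
    \<open>\<gamma> > 3 / 2\<close> is exactly what makes \<open>s powr -\<beta>\<close> integrable at \<open>0\<close>.

  \<^item> For each \<open>s\<close> there remains a linear operator whose amplitude is \<open>O(|x - y| powr -p)\<close> with
    \<open>p = n + 1 - m\<close> and vanishes for \<open>|x - y| < r\<close>. Composed with its adjoint it has a kernel that is
    the Fourier transform in \<open>x\<close> of a product of two amplitudes, and repeated integration by parts
    shows that this kernel is integrable with norm at most \<open>C r powr (2 m)\<close>
    (\<open>oscillatory_operator_bound\<close>).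

  The last estimate has room to spare. Adding up dyadic annuli would give
  \<open>lam powr (- n / 2) r powr -p = r powr (m + 1)\<close> for the norm, one power of \<open>r\<close> better than needed,
  and this room permits a proof without a dyadic decomposition.
\<close>

section \<open>Integrals of powers of the norm\<close>

lemma nn_integral_powr_near_0:
  fixes \<theta> \<rho> :: real
  assumes "\<theta> < 1" "\<rho> > 0"
  shows "(\<integral>\<^sup>+u. ennreal (\<bar>u\<bar> powr - \<theta>) * indicator {-\<rho>..\<rho>} u \<partial>lborel)
           \<le> ennreal (2 / (1 - \<theta>) * \<rho> powr (1 - \<theta>))"
proof -
  let ?I = "\<integral>\<^sup>+u. ennreal (indicator {0..\<rho>} u * (u powr - \<theta>)) \<partial>lborel"
  have I: "?I = ennreal (\<rho> powr (-\<theta> + 1) / (-\<theta> + 1))"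
    using nn_integral_has_integral_lebesgue[OF _ has_integral_powr_from_0[of "-\<theta>" \<rho>]] assms by simp
  have "(\<integral>\<^sup>+u. ennreal (\<bar>u\<bar> powr - \<theta>) * indicator {-\<rho>..\<rho>} u \<partial>lborel)
     \<le> (\<integral>\<^sup>+u. ennreal (indicator {0..\<rho>} u * (u powr - \<theta>)) +
              ennreal (indicator {0..\<rho>} (0 + (-1) * u) * ((0 + (-1) * u) powr - \<theta>)) \<partial>lborel)"
    by (intro nn_integral_mono) (auto simp: indicator_def)
  also have "\<dots> = ?I + (\<integral>\<^sup>+u. ennreal (indicator {0..\<rho>} (0 + (-1) * u) * ((0 + (-1) * u) powr - \<theta>)) \<partial>lborel)"
    by (intro nn_integral_add) auto
  also have "\<dots> = ?I + ?I"
    using nn_integral_real_affine[of "\<lambda>u. ennreal (indicator {0..\<rho>} u * (u powr - \<theta>))" "-1" 0]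
    by simp
  also have "\<dots> = ennreal (2 / (1 - \<theta>) * \<rho> powr (1 - \<theta>))"
    unfolding I using assms by (subst ennreal_plus[symmetric]) (auto simp: add.commute)
  finally show ?thesis .
qed

lemma nn_integral_powr_tail:
  fixes \<theta> \<rho> :: real
  assumes "\<theta> > 1" "\<rho> > 0"
  shows "(\<integral>\<^sup>+u. ennreal ((max \<rho> \<bar>u\<bar>) powr - \<theta>) \<partial>lborel)
           \<le> ennreal ((2 + 2 / (\<theta> - 1)) * \<rho> powr (1 - \<theta>))"
proof -
  let ?I = "\<integral>\<^sup>+u. ennreal (indicator {\<rho>..} u * (u powr - \<theta>)) \<partial>lborel"
  have I: "?I = ennreal (- (\<rho> powr (-\<theta> + 1)) / (-\<theta> + 1))"
    using nn_integral_has_integral_lebesgue[OF _ has_integral_powr_to_inf[of "-\<theta>" \<rho>]] assms by simp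
  have "(\<integral>\<^sup>+u. ennreal ((max \<rho> \<bar>u\<bar>) powr - \<theta>) \<partial>lborel)
     \<le> (\<integral>\<^sup>+u. ennreal (\<rho> powr - \<theta>) * indicator {-\<rho>..\<rho>} u +
             (ennreal (indicator {\<rho>..} u * (u powr - \<theta>)) +
              ennreal (indicator {\<rho>..} (0 + (-1) * u) * ((0 + (-1) * u) powr - \<theta>))) \<partial>lborel)"
    using assms by (intro nn_integral_mono) (auto simp: indicator_def max_def)
  also have "\<dots> = (\<integral>\<^sup>+u. ennreal (\<rho> powr - \<theta>) * indicator {-\<rho>..\<rho>} u \<partial>lborel) +
       (?I + (\<integral>\<^sup>+u. ennreal (indicator {\<rho>..} (0 + (-1) * u) * ((0 + (-1) * u) powr - \<theta>)) \<partial>lborel))"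
    by (subst nn_integral_add, simp, simp, subst nn_integral_add) auto
  also have "(\<integral>\<^sup>+u. ennreal (indicator {\<rho>..} (0 + (-1) * u) * ((0 + (-1) * u) powr - \<theta>)) \<partial>lborel) = ?I"
    using nn_integral_real_affine[of "\<lambda>u. ennreal (indicator {\<rho>..} u * (u powr - \<theta>))" "-1" 0]
    by simp
  also have "(\<integral>\<^sup>+u. ennreal (\<rho> powr - \<theta>) * indicator {-\<rho>..\<rho>} u \<partial>lborel) = ennreal (2 * \<rho> powr (1 - \<theta>))"
    using assms by (simp add: nn_integral_cmult_indicator ennreal_mult[symmetric] powr_diff powr_minus field_simps
          del: ennreal_plus flip: ennreal_plus)
  also have "ennreal (2 * \<rho> powr (1 - \<theta>)) + (?I + ?I) = ennreal ((2 + 2 / (\<theta> - 1)) * \<rho> powr (1 - \<theta>))"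
  proof -
    have I': "?I = ennreal (\<rho> powr (1 - \<theta>) / (\<theta> - 1))"
      unfolding I by (simp add: minus_divide_left[symmetric] minus_divide_right add.commute)
    have *: "ennreal a + (ennreal c + ennreal c) = ennreal (a + (c + c))" if "0 \<le> a" "0 \<le> c" for a c
      using that by (metis ennreal_plus add_nonneg_nonneg)
    show ?thesis unfolding I' using assms by (subst *) (auto simp: distrib_right)
  qed
  finally show ?thesis .
qed

lemma AE_coordinates_nonzero: "AE z::'a::euclidean_space in lborel. \<forall>b\<in>Basis. z \<bullet> b \<noteq> 0"
proof (rule AE_finite_allI)
  fix b :: 'a assume "b \<in> Basis"
  then have "negligible {z::'a. z \<bullet> b = 0}" by (rule negligible_standard_hyperplane)
  then have "AE z in lebesgue. z \<bullet> b \<noteq> 0"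
    by (auto intro: AE_not_in simp: negligible_iff_null_sets elim!: AE_mp[OF AE_not_in])
  then show "AE z in lborel. z \<bullet> b \<noteq> 0" by (simp add: AE_completion_iff)
qed simp

lemma powr_eq_prod_Basis:
  fixes x :: real and z :: "'a::euclidean_space"
  assumes "x > 0"
  shows "x powr s = (\<Prod>b\<in>(Basis::'a set). x powr (s / DIM('a)))"
  using assms by (simp add: powr_powr powr_realpow[symmetric])

text \<open>Reduction to dimension one: \<open>|z| powr -q\<close> is a product of \<open>n\<close> equal
  factors, and the factor belonging to the coordinate \<open>b\<close> increases if \<open>|z|\<close> is replaced by
  \<open>|z \<bullet> b| \<le> |z|\<close>. This replacement fails only where a coordinate vanishes, because
  \<open>0 powr -\<theta> = 0\<close>, and that is a null set. The tail bound below uses \<open>max \<rho> |z \<bullet> b|\<close> instead.\<close>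

lemma nn_integral_norm_powr_ball:
  fixes q :: real
  assumes "0 \<le> q" "q < DIM('a::euclidean_space)"
  shows "\<exists>C>0. \<forall>\<rho>>0. (\<integral>\<^sup>+(z::'a). ennreal (norm z powr - q) * indicator {z. norm z \<le> \<rho>} z \<partial>lborel)
            \<le> ennreal (C * \<rho> powr (DIM('a) - q))"
proof -
  let ?n = "real DIM('a)"
  define \<theta> where "\<theta> = q / ?n"
  have \<theta>: "0 \<le> \<theta>" "\<theta> < 1" using assms by (auto simp: \<theta>_def field_simps)
  show ?thesis
  proof (intro exI[of _ "(2 / (1 - \<theta>)) ^ DIM('a)"] conjI allI impI)
    show "(2 / (1 - \<theta>)) ^ DIM('a) > 0" using \<theta> by simp
    fix \<rho> :: real assume \<rho>: "\<rho> > 0"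
    have "(\<integral>\<^sup>+(z::'a). ennreal (norm z powr - q) * indicator {z. norm z \<le> \<rho>} z \<partial>lborel)
      \<le> (\<integral>\<^sup>+(z::'a). (\<Prod>b\<in>Basis. ennreal (\<bar>z \<bullet> b\<bar> powr - \<theta>) * indicator {-\<rho>..\<rho>} (z \<bullet> b)) \<partial>lborel)"
    proof (intro nn_integral_mono_AE eventually_mono[OF AE_coordinates_nonzero])
      fix z :: 'a assume elim: "\<forall>b\<in>Basis. z \<bullet> b \<noteq> 0"
      obtain b where "b \<in> (Basis::'a set)" using nonempty_Basis by blast
      then have nz: "norm z > 0" using elim by force
      have le: "\<bar>z \<bullet> b\<bar> \<le> norm z" if "b \<in> Basis" for b using that by (rule Basis_le_norm)
      show "ennreal (norm z powr - q) * indicator {z. norm z \<le> \<rho>} z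
          \<le> (\<Prod>b\<in>Basis. ennreal (\<bar>z \<bullet> b\<bar> powr - \<theta>) * indicator {-\<rho>..\<rho>} (z \<bullet> b))"
      proof (cases "norm z \<le> \<rho>")
        case True
        then have "indicator {-\<rho>..\<rho>} (z \<bullet> b) = (1::ennreal)" if "b \<in> Basis" for b
          using le[OF that] by (auto simp: indicator_def)
        moreover have "norm z powr - q \<le> (\<Prod>b\<in>Basis. \<bar>z \<bullet> b\<bar> powr - \<theta>)"
          unfolding powr_eq_prod_Basis[OF nz, of "-q", where 'a='a] \<theta>_def minus_divide_left
          using \<theta> elim le nz by (intro prod_mono) (auto intro!: powr_mono2' simp: \<theta>_def assms)
        ultimately show ?thesis using True by (simp add: prod_ennreal ennreal_leI)
      qed simp
    qed
    also have "\<dots> = (\<Prod>b\<in>(Basis::'a set). (\<integral>\<^sup>+u. ennreal (\<bar>u\<bar> powr - \<theta>) * indicator {-\<rho>..\<rho>} u \<partial>lborel))"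
      by (rule nn_integral_lborel_prod) auto
    also have "\<dots> \<le> (\<Prod>b\<in>(Basis::'a set). ennreal (2 / (1 - \<theta>) * \<rho> powr (1 - \<theta>)))"
      using nn_integral_powr_near_0[OF \<theta>(2) \<rho>] by (intro prod_mono_ennreal) auto
    also have "\<dots> = ennreal ((2 / (1 - \<theta>)) ^ DIM('a) * \<rho> powr (?n - q))"
    proof -
      have "?n - q = (1 - \<theta>) * ?n" by (simp add: \<theta>_def field_simps)
      then have "\<rho> powr (?n - q) = (\<rho> powr (1 - \<theta>)) ^ DIM('a)"
        using \<rho> by (simp add: powr_powr[symmetric] powr_realpow)
      then show ?thesis using \<theta> by (simp add: ennreal_power power_mult_distrib[symmetric])
    qed
    finally show "(\<integral>\<^sup>+(z::'a). ennreal (norm z powr - q) * indicator {z. norm z \<le> \<rho>} z \<partial>lborel)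
            \<le> ennreal ((2 / (1 - \<theta>)) ^ DIM('a) * \<rho> powr (?n - q))" .
  qed
qed

lemma nn_integral_norm_powr_tail:
  fixes s :: real
  assumes "s > DIM('a::euclidean_space)"
  shows "\<exists>C>0. \<forall>\<rho>>0. (\<integral>\<^sup>+(z::'a). ennreal (norm z powr - s) * indicator {z. \<rho> \<le> norm z} z \<partial>lborel)
            \<le> ennreal (C * \<rho> powr (DIM('a) - s))"
proof -
  let ?n = "real DIM('a)"
  define \<theta> where "\<theta> = s / ?n"
  have \<theta>: "\<theta> > 1" using assms by (auto simp: \<theta>_def field_simps)
  show ?thesis
  proof (intro exI[of _ "(2 + 2 / (\<theta> - 1)) ^ DIM('a)"] conjI allI impI)
    show "(2 + 2 / (\<theta> - 1)) ^ DIM('a) > 0" using \<theta> by (intro zero_less_power) (simp add: field_simps)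
    fix \<rho> :: real assume \<rho>: "\<rho> > 0"
    have "(\<integral>\<^sup>+(z::'a). ennreal (norm z powr - s) * indicator {z. \<rho> \<le> norm z} z \<partial>lborel)
      \<le> (\<integral>\<^sup>+(z::'a). (\<Prod>b\<in>Basis. ennreal ((max \<rho> \<bar>z \<bullet> b\<bar>) powr - \<theta>)) \<partial>lborel)"
    proof (intro nn_integral_mono)
      fix z :: 'a
      have le: "\<bar>z \<bullet> b\<bar> \<le> norm z" if "b \<in> Basis" for b using that by (rule Basis_le_norm)
      show "ennreal (norm z powr - s) * indicator {z. \<rho> \<le> norm z} z \<le> (\<Prod>b\<in>Basis. ennreal ((max \<rho> \<bar>z \<bullet> b\<bar>) powr - \<theta>))"
      proof (cases "\<rho> \<le> norm z")
        case True
        then have nz: "norm z > 0" using \<rho> by linarith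
        have "norm z powr - s \<le> (\<Prod>b\<in>Basis. (max \<rho> \<bar>z \<bullet> b\<bar>) powr - \<theta>)"
          unfolding powr_eq_prod_Basis[OF nz, of "-s", where 'a='a] \<theta>_def minus_divide_left
          using \<theta> le \<rho> True by (intro prod_mono) (auto intro!: powr_mono2' simp: \<theta>_def)
        then show ?thesis using True by (simp add: prod_ennreal ennreal_leI)
      qed simp
    qed
    also have "\<dots> = (\<Prod>b\<in>(Basis::'a set). (\<integral>\<^sup>+u. ennreal ((max \<rho> \<bar>u\<bar>) powr - \<theta>) \<partial>lborel))"
      by (rule nn_integral_lborel_prod) auto
    also have "\<dots> \<le> (\<Prod>b\<in>(Basis::'a set). ennreal ((2 + 2 / (\<theta> - 1)) * \<rho> powr (1 - \<theta>)))"
      using nn_integral_powr_tail[OF \<theta> \<rho>] by (intro prod_mono_ennreal) auto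
    also have "\<dots> = ennreal ((2 + 2 / (\<theta> - 1)) ^ DIM('a) * \<rho> powr (?n - s))"
    proof -
      have "?n - s = (1 - \<theta>) * ?n" by (simp add: \<theta>_def field_simps)
      then have "\<rho> powr (?n - s) = (\<rho> powr (1 - \<theta>)) ^ DIM('a)"
        using \<rho> by (simp add: powr_powr[symmetric] powr_realpow)
      moreover have "2 + 2 / (\<theta> - 1) \<ge> 0" using \<theta> by (simp add: field_simps)
      ultimately show ?thesis by (simp add: ennreal_power power_mult_distrib[symmetric])
    qed
    finally show "(\<integral>\<^sup>+(z::'a). ennreal (norm z powr - s) * indicator {z. \<rho> \<le> norm z} z \<partial>lborel)
            \<le> ennreal ((2 + 2 / (\<theta> - 1)) ^ DIM('a) * \<rho> powr (?n - s))" .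
  qed
qed

section \<open>Derivative bounds along a line\<close>

text \<open>\<open>dsymbol b k v B U g\<close> bounds the derivatives of \<open>g\<close> in the direction \<open>b\<close>, up to order \<open>k\<close> and on
  \<open>U\<close>: the \<open>j\<close>-th one is at most \<open>B v\<^sup>j\<close>. Thus \<open>B\<close> is the size of \<open>g\<close> and \<open>1 / v\<close> is the
  length scale on which it varies. Only one direction is followed because each integration by parts
  below uses a single coordinate. With the recursion over the order the Leibniz rule is an induction in
  which the higher derivatives never have to be named.\<close>

primrec dsymbol ::
    "'a::euclidean_space \<Rightarrow> nat \<Rightarrow> ('a \<Rightarrow> real) \<Rightarrow> ('a \<Rightarrow> real) \<Rightarrow> 'a set \<Rightarrow> ('a \<Rightarrow> complex) \<Rightarrow> bool" where
  "dsymbol b 0 v B U g \<longleftrightarrow> (\<forall>x\<in>U. norm (g x) \<le> B x)"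
| "dsymbol b (Suc k) v B U g \<longleftrightarrow> (\<forall>x\<in>U. norm (g x) \<le> B x) \<and>
     (\<exists>g'. (\<forall>x\<in>U. ((\<lambda>s. g (x + s *\<^sub>R b)) has_vector_derivative g' x) (at 0)) \<and>
           dsymbol b k v (\<lambda>x. B x * v x) U g')"

declare dsymbol.simps(2) [simp del]

text \<open>The case in which the scale of variation is the distance to the point \<open>y\<close>.\<close>

abbreviation offdiag_symbol ::
    "'a::euclidean_space \<Rightarrow> nat \<Rightarrow> 'a \<Rightarrow> ('a \<Rightarrow> real) \<Rightarrow> ('a \<Rightarrow> complex) \<Rightarrow> bool" where
  "offdiag_symbol c k z B g \<equiv> dsymbol c k (\<lambda>x. 1 / norm (x - z)) B (UNIV - {z}) g"

lemma dsymbol_SucI: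
  assumes "\<And>x. x \<in> U \<Longrightarrow> norm (g x) \<le> B x"
    and "\<And>x. x \<in> U \<Longrightarrow> ((\<lambda>s. g (x + s *\<^sub>R b)) has_vector_derivative g' x) (at 0)"
    and "dsymbol b k v (\<lambda>x. B x * v x) U g'"
  shows "dsymbol b (Suc k) v B U g"
  using assms unfolding dsymbol.simps by (intro conjI ballI exI[of _ g'])

lemma dsymbol_SucD:
  "dsymbol b (Suc k) v B U g \<Longrightarrow>
    \<exists>g'. (\<forall>x\<in>U. ((\<lambda>s. g (x + s *\<^sub>R b)) has_vector_derivative g' x) (at 0)) \<and>
         dsymbol b k v (\<lambda>x. B x * v x) U g'"
  unfolding dsymbol.simps by (rule conjunct2)

lemma dsymbol_bound: "dsymbol b k v B U g \<Longrightarrow> x \<in> U \<Longrightarrow> norm (g x) \<le> B x"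
  by (cases k) (auto simp: dsymbol.simps(2))

lemma dsymbol_Suc_D: "dsymbol b (Suc k) v B U g \<Longrightarrow> dsymbol b k v B U g"
proof (induction k arbitrary: B g)
  case (Suc k)
  note bound = dsymbol_bound[OF Suc.prems]
  obtain g' where g': "\<forall>x\<in>U. ((\<lambda>s. g (x + s *\<^sub>R b)) has_vector_derivative g' x) (at 0)"
    and "dsymbol b (Suc k) v (\<lambda>x. B x * v x) U g'" using dsymbol_SucD[OF Suc.prems(1)] by blast
  then have 1: "dsymbol b k v (\<lambda>x. B x * v x) U g'" using Suc.IH by simp
  show ?case by (rule dsymbol_SucI[OF _ _ 1]) (use bound g' in simp)+
qed (simp add: dsymbol_bound)

lemma dsymbol_le: "dsymbol b k v B U g \<Longrightarrow> j \<le> k \<Longrightarrow> dsymbol b j v B U g"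
  by (induction k) (auto simp: le_Suc_eq dest: dsymbol_Suc_D)

lemma dsymbol_mono:
  assumes "dsymbol b k v B U g" "\<And>x. x \<in> U' \<Longrightarrow> B x \<le> B' x" "\<And>x. x \<in> U' \<Longrightarrow> 0 \<le> v x \<and> v x \<le> v' x"
    "U' \<subseteq> U"
  shows "dsymbol b k v' B' U' g"
  using assms
proof (induction k arbitrary: B B' g)
  case 0 then show ?case by force
next
  case (Suc k)
  obtain g' where g': "\<forall>x\<in>U. ((\<lambda>s. g (x + s *\<^sub>R b)) has_vector_derivative g' x) (at 0)"
    "dsymbol b k v (\<lambda>x. B x * v x) U g'" using dsymbol_SucD[OF Suc.prems(1)] by blast
  have le: "norm (g x) \<le> B x" if "x \<in> U" for x using dsymbol_bound[OF Suc.prems(1) that] .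
  have "B x * v x \<le> B' x * v' x" if "x \<in> U'" for x
    using le[of x] Suc.prems(2,3)[OF that] Suc.prems(4) that norm_ge_zero[of "g x"]
    by (intro mult_mono) (auto simp del: norm_ge_zero)
  then have 1: "dsymbol b k v' (\<lambda>x. B' x * v' x) U' g'"
    by (rule Suc.IH[OF g'(2)]) (use Suc.prems(3,4) in simp_all)
  have 2: "norm (g x) \<le> B' x" if "x \<in> U'" for x
    using le[of x] Suc.prems(2)[OF that] Suc.prems(4) that by force
  show ?case by (rule dsymbol_SucI[OF _ _ 1]) (use 2 g'(1) Suc.prems(4) in blast)+
qed

lemma dsymbol_cong_bound:
  "dsymbol b k v B U g \<Longrightarrow> (\<And>x. B x = B' x) \<Longrightarrow> dsymbol b k v B' U g"
  by (metis (no_types, lifting) ext)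

lemma dsymbol_add:
  assumes "dsymbol b k v B1 U g" "dsymbol b k v B2 U h"
  shows "dsymbol b k v (\<lambda>x. B1 x + B2 x) U (\<lambda>x. g x + h x)"
  using assms
proof (induction k arbitrary: B1 B2 g h)
  case 0 then show ?case by (auto intro!: norm_triangle_le add_mono)
next
  case (Suc k)
  obtain g' where dg: "\<forall>x\<in>U. ((\<lambda>s. g (x + s *\<^sub>R b)) has_vector_derivative g' x) (at 0)"
    "dsymbol b k v (\<lambda>x. B1 x * v x) U g'" using dsymbol_SucD[OF Suc.prems(1)] by blast
  obtain h' where dh: "\<forall>x\<in>U. ((\<lambda>s. h (x + s *\<^sub>R b)) has_vector_derivative h' x) (at 0)"
    "dsymbol b k v (\<lambda>x. B2 x * v x) U h'" using dsymbol_SucD[OF Suc.prems(2)] by blast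
  note d = dg dh
  have 1: "dsymbol b k v (\<lambda>x. (B1 x + B2 x) * v x) U (\<lambda>x. g' x + h' x)"
    using Suc.IH[OF d(2,4)] by (simp add: distrib_right)
  have 2: "((\<lambda>s. g (x + s *\<^sub>R b) + h (x + s *\<^sub>R b)) has_vector_derivative g' x + h' x) (at 0)"
    if "x \<in> U" for x
    using d that by (intro has_vector_derivative_add) auto
  have 3: "norm (g x + h x) \<le> B1 x + B2 x" if "x \<in> U" for x
    using dsymbol_bound[OF Suc.prems(1) that] dsymbol_bound[OF Suc.prems(2) that]
    by (intro norm_triangle_le add_mono)
  show ?case by (rule dsymbol_SucI[OF _ _ 1]) (use 2 3 in simp)+
qed

lemma dsymbol_mult:
  assumes "dsymbol b k v B1 U g" "dsymbol b k v B2 U h"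
  shows "dsymbol b k v (\<lambda>x. 2 ^ k * (B1 x * B2 x)) U (\<lambda>x. g x * h x)"
  using assms
proof (induction k arbitrary: B1 B2 g h)
  case 0 then show ?case by (auto simp: norm_mult intro!: mult_mono order_trans[OF norm_ge_zero])
next
  case (Suc k)
  obtain g' where dg: "\<forall>x\<in>U. ((\<lambda>s. g (x + s *\<^sub>R b)) has_vector_derivative g' x) (at 0)"
    "dsymbol b k v (\<lambda>x. B1 x * v x) U g'" using dsymbol_SucD[OF Suc.prems(1)] by blast
  obtain h' where dh: "\<forall>x\<in>U. ((\<lambda>s. h (x + s *\<^sub>R b)) has_vector_derivative h' x) (at 0)"
    "dsymbol b k v (\<lambda>x. B2 x * v x) U h'" using dsymbol_SucD[OF Suc.prems(2)] by blast
  note d = dg dh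
  have g: "dsymbol b k v B1 U g" and h: "dsymbol b k v B2 U h"
    using Suc.prems by (auto dest: dsymbol_Suc_D)
  have "dsymbol b k v (\<lambda>x. 2 ^ k * (B1 x * (B2 x * v x)) + 2 ^ k * (B1 x * v x * B2 x)) U
          (\<lambda>x. g x * h' x + g' x * h x)"
    by (intro dsymbol_add Suc.IH g h d)
  then have 1: "dsymbol b k v (\<lambda>x. (2 ^ Suc k * (B1 x * B2 x)) * v x) U (\<lambda>x. g x * h' x + g' x * h x)"
    by (rule dsymbol_cong_bound) (simp add: algebra_simps)
  have 2: "((\<lambda>s. g (x + s *\<^sub>R b) * h (x + s *\<^sub>R b)) has_vector_derivative g x * h' x + g' x * h x) (at 0)"
    if "x \<in> U" for x
    using has_vector_derivative_mult[of "\<lambda>s. g (x + s *\<^sub>R b)" "g' x" 0 UNIV "\<lambda>s. h (x + s *\<^sub>R b)" "h' x"] d that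
    by auto
  have 3: "norm (g x * h x) \<le> 2 ^ Suc k * (B1 x * B2 x)" if "x \<in> U" for x
  proof -
    have "norm (g x * h x) \<le> 1 * (B1 x * B2 x)"
      unfolding norm_mult mult_1 using dsymbol_bound[OF g that] dsymbol_bound[OF h that]
      by (intro mult_mono) (auto intro: order_trans[OF norm_ge_zero])
    also have "\<dots> \<le> 2 ^ Suc k * (B1 x * B2 x)"
      using dsymbol_bound[OF g that] dsymbol_bound[OF h that]
      by (intro mult_right_mono mult_nonneg_nonneg one_le_power order_trans[OF norm_ge_zero]) auto
    finally show ?thesis .
  qed
  show ?case by (rule dsymbol_SucI[OF _ _ 1]) (use 2 3 in simp)+
qed

lemma dsymbol_cnj:
  "dsymbol b k v B U g \<Longrightarrow> dsymbol b k v B U (\<lambda>x. cnj (g x))"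
proof (induction k arbitrary: B g)
  case (Suc k)
  obtain g' where g': "\<forall>x\<in>U. ((\<lambda>s. g (x + s *\<^sub>R b)) has_vector_derivative g' x) (at 0)"
    "dsymbol b k v (\<lambda>x. B x * v x) U g'" using dsymbol_SucD[OF Suc.prems(1)] by blast
  have 1: "dsymbol b k v (\<lambda>x. B x * v x) U (\<lambda>x. cnj (g' x))"
    by (rule Suc.IH[OF g'(2)])
  have 2: "((\<lambda>s. cnj (g (x + s *\<^sub>R b))) has_vector_derivative cnj (g' x)) (at 0)" if "x \<in> U" for x
    by (rule has_vector_derivative_cnj[OF g'(1)[rule_format, OF that]])
  have 3: "norm (cnj (g x)) \<le> B x" if "x \<in> U" for x
    using dsymbol_bound[OF Suc.prems that] by simp
  show ?case by (rule dsymbol_SucI[OF _ _ 1]) (use 2 3 in simp)+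
qed simp

lemma dsymbol_const_mult:
  "dsymbol b k v B U g \<Longrightarrow> dsymbol b k v (\<lambda>x. norm c * B x) U (\<lambda>x. c * g x)"
proof (induction k arbitrary: B g)
  case 0 then show ?case by (auto simp: norm_mult intro!: mult_left_mono)
next
  case (Suc k)
  obtain g' where g': "\<forall>x\<in>U. ((\<lambda>s. g (x + s *\<^sub>R b)) has_vector_derivative g' x) (at 0)"
    "dsymbol b k v (\<lambda>x. B x * v x) U g'" using dsymbol_SucD[OF Suc.prems(1)] by blast
  have 1: "dsymbol b k v (\<lambda>x. norm c * B x * v x) U (\<lambda>x. c * g' x)"
    using Suc.IH[OF g'(2)] by (simp add: mult.assoc)
  have 2: "((\<lambda>s. c * g (x + s *\<^sub>R b)) has_vector_derivative c * g' x) (at 0)" if "x \<in> U" for x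
    by (rule has_vector_derivative_mult_right[OF g'(1)[rule_format, OF that]])
  have 3: "norm (c * g x) \<le> norm c * B x" if "x \<in> U" for x
    using dsymbol_bound[OF Suc.prems that] by (simp add: norm_mult mult_left_mono)
  show ?case by (rule dsymbol_SucI[OF _ _ 1]) (use 2 3 in simp)+
qed

lemma dsymbol_seqI:
  assumes "\<And>k x. k < N \<Longrightarrow> x \<in> U \<Longrightarrow> ((\<lambda>s. G k (x + s *\<^sub>R b)) has_vector_derivative G (Suc k) x) (at 0)"
    and "\<And>k x. k \<le> N \<Longrightarrow> x \<in> U \<Longrightarrow> norm (G k x) \<le> B x * v x ^ k"
  shows "dsymbol b N v B U (G 0)"
proof -
  have "i + k \<le> N \<Longrightarrow> dsymbol b k v (\<lambda>x. B x * v x ^ i) U (G i)" for i k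
  proof (induction k arbitrary: i)
    case (Suc k)
    then have 1: "dsymbol b k v (\<lambda>x. B x * v x ^ i * v x) U (G (Suc i))"
      using Suc.IH[of "Suc i"] by (simp add: mult_ac)
    have 2: "\<forall>x\<in>U. norm (G i x) \<le> B x * v x ^ i" using Suc.prems assms(2) by simp
    have 3: "\<forall>x\<in>U. ((\<lambda>s. G i (x + s *\<^sub>R b)) has_vector_derivative G (Suc i) x) (at 0)"
      using Suc.prems assms(1) by simp
    show ?case by (rule dsymbol_SucI[OF _ _ 1]) (use 2 3 in simp)+
  qed (use assms in auto)
  from this[of 0 N] show ?thesis by simp
qed

lemma continuous_on_line: "continuous_on UNIV (\<lambda>s. x + s *\<^sub>R (b :: 'a::real_normed_vector))"
  by (intro continuous_intros)

lemma has_vector_derivative_line_cong: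
  fixes x b :: "'a::real_normed_vector"
  assumes "open U" "x \<in> U" "\<And>y. y \<in> U \<Longrightarrow> f y = g y"
    and "((\<lambda>s. f (x + s *\<^sub>R b)) has_vector_derivative D) (at (0::real))"
  shows "((\<lambda>s. g (x + s *\<^sub>R b)) has_vector_derivative D) (at 0)"
  using assms(4)
proof (rule has_vector_derivative_transform_within_open[where S = "{s. x + s *\<^sub>R b \<in> U}"])
  show "open {s. x + s *\<^sub>R b \<in> U}"
    using open_vimage[OF assms(1) continuous_on_line] by (simp add: vimage_def)
qed (use assms in auto)

text \<open>If \<open>g\<close> vanishes on the overlap of two open sets that cover the space, then extending it by zero
  creates no new derivatives. In this way amplitudes that are smooth off the diagonal and vanish near
  it become functions on the whole space.\<close>

lemma dsymbol_extend_zero: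
  assumes "dsymbol b k v B U g" "open U" "open V" "U \<union> V = UNIV" "\<And>x. x \<in> U \<inter> V \<Longrightarrow> g x = 0"
  shows "dsymbol b k v (\<lambda>x. if x \<in> V then 0 else B x) UNIV (\<lambda>x. if x \<in> V then 0 else g x)"
  using assms
proof (induction k arbitrary: B g)
  case 0 then show ?case by auto
next
  case (Suc k)
  obtain g' where g': "\<forall>x\<in>U. ((\<lambda>s. g (x + s *\<^sub>R b)) has_vector_derivative g' x) (at 0)"
    "dsymbol b k v (\<lambda>x. B x * v x) U g'" using dsymbol_SucD[OF Suc.prems(1)] by blast
  have z: "g' x = 0" if "x \<in> U \<inter> V" for x
  proof -
    have "((\<lambda>s. (\<lambda>_. 0::complex) (x + s *\<^sub>R b)) has_vector_derivative g' x) (at 0)"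
      by (rule has_vector_derivative_line_cong[of "U \<inter> V" x g]) (use that Suc.prems g' in auto)
    then show ?thesis
      by (rule vector_derivative_unique_at) (rule has_vector_derivative_const)
  qed
  have "dsymbol b k v (\<lambda>x. if x \<in> V then 0 else B x * v x) UNIV (\<lambda>x. if x \<in> V then 0 else g' x)"
    using Suc.IH[OF g'(2)] Suc.prems z by auto
  then have 1: "dsymbol b k v (\<lambda>x. (if x \<in> V then 0 else B x) * v x) UNIV (\<lambda>x. if x \<in> V then 0 else g' x)"
    by (rule dsymbol_cong_bound) auto
  have 2: "((\<lambda>s. if x + s *\<^sub>R b \<in> V then 0 else g (x + s *\<^sub>R b)) has_vector_derivative
            (if x \<in> V then 0 else g' x)) (at 0)" for x
  proof (cases "x \<in> V")
    case True
    then show ?thesis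
      using has_vector_derivative_line_cong[of V x "\<lambda>_. 0" "\<lambda>y. if y \<in> V then 0 else g y" b 0] Suc.prems by auto
  next
    case False
    then have "x \<in> U" using Suc.prems by auto
    then show ?thesis
      using has_vector_derivative_line_cong[of U x g "\<lambda>y. if y \<in> V then 0 else g y" b "g' x"] Suc.prems g' False
      by auto
  qed
  have 3: "norm (if x \<in> V then 0 else g x) \<le> (if x \<in> V then 0 else B x)" for x
    using dsymbol_bound[OF Suc.prems(1), of x] Suc.prems(4) by auto
  show ?case by (rule dsymbol_SucI[OF _ _ 1]) (rule 3, rule 2)
qed

section \<open>Integration by parts in one direction\<close>

lemma integrable_bounded_support:
  fixes f :: "'a::euclidean_space \<Rightarrow> 'b::{banach, second_countable_topology}"
  assumes "f \<in> borel_measurable borel" "\<And>x. norm (f x) \<le> M" "\<And>x. R < norm x \<Longrightarrow> f x = 0"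
  shows "integrable lborel f"
proof (rule Bochner_Integration.integrable_bound)
  have "emeasure lborel (cball (0::'a) R) < \<infinity>"
    by (rule emeasure_bounded_finite) simp
  then show "integrable lborel (\<lambda>x::'a. M * indicator (cball 0 R) x)" by (simp add: integrable_real_indicator)
  show "AE x in lborel. norm (f x) \<le> norm (M * indicator (cball 0 R) x)"
    using assms by (auto simp: indicator_def intro: order_trans[OF _ abs_ge_self] split: if_splits)
qed (use assms in simp)

lemma has_vector_derivative_line_shift:
  fixes x b :: "'a::real_normed_vector"
  assumes "((\<lambda>s. g (x + r *\<^sub>R b + s *\<^sub>R b)) has_vector_derivative D) (at (0::real))"
  shows "((\<lambda>s. g (x + s *\<^sub>R b)) has_vector_derivative D) (at r)"
proof -
  have "((\<lambda>s. s - r) has_vector_derivative 1) (at r)"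
    by (auto intro!: derivative_eq_intros)
  then have "(((\<lambda>s. g (x + r *\<^sub>R b + s *\<^sub>R b)) \<circ> (\<lambda>s. s - r)) has_vector_derivative 1 *\<^sub>R D) (at r)"
    by (rule vector_diff_chain_at) (use assms in simp)
  then show ?thesis by (simp add: o_def scaleR_diff_left)
qed

lemma directional_derivative_quotient_limit:
  fixes g :: "'a::euclidean_space \<Rightarrow> complex"
  assumes "((\<lambda>s. g (x + s *\<^sub>R b)) has_vector_derivative D) (at (0::real))"
  shows "(\<lambda>j. (g (x + (1 / real (Suc j)) *\<^sub>R b) - g x) /\<^sub>R (1 / real (Suc j))) \<longlonglongrightarrow> D"
proof -
  have "((\<lambda>s. (g (x + s *\<^sub>R b) - g x) /\<^sub>R s) \<longlongrightarrow> D) (at 0)"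
  proof (rule LIM_zero_cancel, rule tendsto_norm_zero_cancel)
    have "((\<lambda>s. norm (g (x + s *\<^sub>R b) - g x - s *\<^sub>R D) / norm s) \<longlongrightarrow> 0) (at 0)"
      using assms unfolding has_vector_derivative_def has_derivative_at by simp
    moreover have "norm (g (x + s *\<^sub>R b) - g x - s *\<^sub>R D) / norm s = norm ((g (x + s *\<^sub>R b) - g x) /\<^sub>R s - D)"
      if "s \<noteq> 0" for s
    proof -
      have "(g (x + s *\<^sub>R b) - g x) /\<^sub>R s - D = (g (x + s *\<^sub>R b) - g x - s *\<^sub>R D) /\<^sub>R s"
        using that by (simp add: scaleR_diff_right)
      then show ?thesis by (simp only: norm_scaleR) (simp add: divide_inverse mult.commute)
    qed
    then have "\<forall>\<^sub>F s in at 0. norm (g (x + s *\<^sub>R b) - g x - s *\<^sub>R D) / norm s = norm ((g (x + s *\<^sub>R b) - g x) /\<^sub>R s - D)"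
      by (auto simp: eventually_at_filter)
    ultimately show "((\<lambda>s. norm ((g (x + s *\<^sub>R b) - g x) /\<^sub>R s - D)) \<longlongrightarrow> 0) (at 0)"
      by (rule Lim_transform_eventually)
  qed
  moreover have "filterlim (\<lambda>j. 1 / real (Suc j)) (at 0) sequentially"
    unfolding filterlim_at using LIMSEQ_inverse_real_of_nat by (auto simp: inverse_eq_divide)
  ultimately show ?thesis by (rule filterlim_compose)
qed

lemma directional_derivative_measurable:
  fixes g :: "'a::euclidean_space \<Rightarrow> complex"
  assumes [measurable]: "g \<in> borel_measurable borel"
    and "\<And>x. ((\<lambda>s. g (x + s *\<^sub>R b)) has_vector_derivative g' x) (at (0::real))"
  shows "g' \<in> borel_measurable borel"
  by (rule borel_measurable_LIMSEQ_metric[OF _ directional_derivative_quotient_limit[OF assms(2)]]) measurable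

text \<open>By translation invariance the integral of each difference quotient is \<open>0\<close>; the mean value
  inequality and the bounded support permit dominated convergence.\<close>

lemma integral_directional_derivative_eq_0:
  fixes g :: "'a::euclidean_space \<Rightarrow> complex"
  assumes [measurable]: "g \<in> borel_measurable borel"
    and der: "\<And>x. ((\<lambda>s. g (x + s *\<^sub>R b)) has_vector_derivative g' x) (at (0::real))"
    and bd: "\<And>x. norm (g x) \<le> M" "\<And>x. norm (g' x) \<le> M"
    and supp: "\<And>x. R < norm x \<Longrightarrow> g x = 0"
    and b: "norm b = 1"
  shows "integral\<^sup>L lborel g' = 0"
proof -
  define s where "s j = 1 / real (Suc j)" for j
  define q where "q j x = (g (x + s j *\<^sub>R b) - g x) /\<^sub>R s j" for j x
  have s: "0 < s j" "s j \<le> 1" for j by (auto simp: s_def)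
  have M: "0 \<le> M" using bd(1) norm_ge_zero order_trans by blast
  note [measurable] = directional_derivative_measurable[OF assms(1) der]
  have q_meas [measurable]: "q j \<in> borel_measurable borel" for j unfolding q_def by measurable
  have "(\<lambda>j. integral\<^sup>L lborel (q j)) \<longlonglongrightarrow> integral\<^sup>L lborel g'"
  proof (rule integral_dominated_convergence)
    show "integrable lborel (\<lambda>x::'a. M * indicator (cball 0 (R + 1)) x)"
      using emeasure_bounded_finite[OF bounded_cball, of "0::'a" "R + 1"] by (simp add: integrable_real_indicator)
    show "AE x in lborel. (\<lambda>j. q j x) \<longlonglongrightarrow> g' x"
      using directional_derivative_quotient_limit[OF der] by (simp add: q_def s_def)
    fix j
    have "norm (q j x) \<le> M * indicator (cball 0 (R + 1)) x" for x
    proof (cases "norm x \<le> R + 1")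
      case True
      have "norm (g (x + s j *\<^sub>R b) - g (x + 0 *\<^sub>R b)) \<le> M * norm (s j - 0)"
      proof (rule differentiable_bound)
        show "((\<lambda>s. g (x + s *\<^sub>R b)) has_derivative (\<lambda>h. h *\<^sub>R g' (x + r *\<^sub>R b))) (at r within UNIV)" for r
          using has_vector_derivative_line_shift[OF der] by (simp add: has_vector_derivative_def)
        show "onorm (\<lambda>h. h *\<^sub>R g' (x + r *\<^sub>R b)) \<le> M" for r
        proof (rule onorm_bound)
          show "norm (h *\<^sub>R g' (x + r *\<^sub>R b)) \<le> M * norm h" for h
            using mult_right_mono[OF bd(2)[of "x + r *\<^sub>R b"] norm_ge_zero[of h]] by (simp add: mult.commute)
        qed (rule M)
      qed simp_all
      then have "norm (g (x + s j *\<^sub>R b) - g x) \<le> s j * M" using s[of j] by (simp add: mult.commute)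
      moreover have "norm (q j x) = norm (g (x + s j *\<^sub>R b) - g x) / s j"
        unfolding q_def norm_scaleR using s[of j] by (simp add: divide_inverse mult.commute)
      ultimately show ?thesis using True s[of j] by (simp add: pos_divide_le_eq mult.commute)
    next
      case False
      have "norm x \<le> norm (x + s j *\<^sub>R b) + norm (s j *\<^sub>R b)"
        by (metis add_diff_cancel_right' norm_triangle_ineq4)
      then have "R < norm (x + s j *\<^sub>R b)" using False s[of j] b by simp
      then show ?thesis using False supp by (simp add: q_def)
    qed
    then show "AE x in lborel. norm (q j x) \<le> M * indicator (cball 0 (R + 1)) x" by simp
  qed auto
  moreover have "integral\<^sup>L lborel (q j) = 0" for j
  proof -
    have g: "integrable lborel g" by (rule integrable_bounded_support[OF _ bd(1) supp]) auto
    have "integral\<^sup>L lborel (\<lambda>x. g (s j *\<^sub>R b + x)) = integral\<^sup>L (distr lborel borel ((+) (s j *\<^sub>R b))) g"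
      by (rule integral_distr[symmetric]) auto
    then have "integral\<^sup>L lborel (\<lambda>x. g (x + s j *\<^sub>R b)) = integral\<^sup>L lborel g"
      by (simp add: lborel_distr_plus add.commute)
    moreover have "integrable (distr lborel borel ((+) (s j *\<^sub>R b))) g" using g by (simp add: lborel_distr_plus)
    then have "integrable lborel (\<lambda>x. g (x + s j *\<^sub>R b))"
      by (subst (asm) integrable_distr_eq) (auto simp: add.commute)
    ultimately show ?thesis using g unfolding q_def by simp
  qed
  ultimately show ?thesis by (simp add: LIMSEQ_const_iff)
qed

text \<open>Integration by parts \<open>k\<close> times against \<open>exp (i \<xi> \<bullet> x)\<close>. The uniform bound \<open>M\<close> and the radius \<open>R\<close>
  guarantee integrability.\<close>

lemma oscillatory_integral_bound:
  fixes g :: "'a::euclidean_space \<Rightarrow> complex"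
  assumes "dsymbol b k v B UNIV g" and "g \<in> borel_measurable borel"
    and "\<And>x. 0 \<le> v x" and "\<And>x j. j \<le> k \<Longrightarrow> B x * v x ^ j \<le> M"
    and "\<And>x. R < norm x \<Longrightarrow> B x = 0" and "norm b = 1"
  shows "ennreal (\<bar>\<xi> \<bullet> b\<bar> ^ k * norm (\<integral>x. cis (\<xi> \<bullet> x) * g x \<partial>lborel))
           \<le> (\<integral>\<^sup>+x. ennreal (B x * v x ^ k) \<partial>lborel)"
  using assms
proof (induction k arbitrary: B g)
  case 0
  have "ennreal (norm (\<integral>x. cis (\<xi> \<bullet> x) * g x \<partial>lborel)) \<le> (\<integral>\<^sup>+x. norm (cis (\<xi> \<bullet> x) * g x) \<partial>lborel)"
  proof (cases "integrable lborel (\<lambda>x. cis (\<xi> \<bullet> x) * g x)")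
    case True then show ?thesis by (rule integral_norm_bound_ennreal)
  next
    case False then show ?thesis by (simp add: not_integrable_integral_eq)
  qed
  also have "\<dots> \<le> (\<integral>\<^sup>+x. ennreal (B x * v x ^ 0) \<partial>lborel)"
    using dsymbol_bound[OF 0(1)] by (intro nn_integral_mono ennreal_leI) (simp add: norm_mult)
  finally show ?case by simp
next
  case (Suc k)
  obtain g' where der: "\<forall>x\<in>UNIV. ((\<lambda>s. g (x + s *\<^sub>R b)) has_vector_derivative g' x) (at 0)"
    and g': "dsymbol b k v (\<lambda>x. B x * v x) UNIV g'" using dsymbol_SucD[OF Suc.prems(1)] by blast
  note [measurable] = Suc.prems(2)
  have der': "((\<lambda>s. g (x + s *\<^sub>R b)) has_vector_derivative g' x) (at 0)" for x using der by simp
  have [measurable]: "g' \<in> borel_measurable borel"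
    by (rule directional_derivative_measurable[OF Suc.prems(2) der'])
  define e where "e x = cis (\<xi> \<bullet> x)" for x
  have e_cont: "continuous_on UNIV e" unfolding e_def by (intro continuous_intros)
  then have [measurable]: "e \<in> borel_measurable borel" by (rule borel_measurable_continuous_onI)
  have norm_e [simp]: "norm (e x) = 1" for x by (simp add: e_def)
  have gB: "norm (g x) \<le> B x" and gM: "norm (g x) \<le> M" and g'B: "norm (g' x) \<le> B x * v x"
    and g'M: "norm (g' x) \<le> M" for x
    using dsymbol_bound[OF Suc.prems(1), of x] dsymbol_bound[OF g', of x]
      Suc.prems(4)[of 0 x] Suc.prems(4)[of 1 x] by simp_all
  have supp: "g x = 0" "g' x = 0" if "R < norm x" for x
    using gB[of x] g'B[of x] Suc.prems(5)[OF that] by auto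
  have e_der: "((\<lambda>s. e (x + s *\<^sub>R b)) has_vector_derivative \<i> * complex_of_real (\<xi> \<bullet> b) * e x) (at 0)" for x
  proof -
    have eq: "e (x + s *\<^sub>R b) = e x * cis (s * (\<xi> \<bullet> b))" for s
      by (simp add: e_def inner_add_right cis_mult)
    have "((\<lambda>s. cis (s * (\<xi> \<bullet> b))) has_vector_derivative (\<xi> \<bullet> b) *\<^sub>R (\<i> * cis (0 * (\<xi> \<bullet> b)))) (at 0)"
    proof -
      have "((\<lambda>z. exp (\<i> * (z * complex_of_real (\<xi> \<bullet> b)))) has_field_derivative \<i> * complex_of_real (\<xi> \<bullet> b))
              (at (complex_of_real 0))"
        by (auto intro!: derivative_eq_intros)
      from has_vector_derivative_real_field[OF this] show ?thesis
        by (simp add: cis_conv_exp scaleR_conv_of_real mult_ac)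
    qed
    from has_vector_derivative_mult_right[OF this, of "e x"] show ?thesis
      unfolding eq by (simp add: scaleR_conv_of_real mult_ac)
  qed
  have int: "integrable lborel (\<lambda>x. e x * g x)" "integrable lborel (\<lambda>x. e x * g' x)"
    by (rule integrable_bounded_support[of _ M R]; simp add: norm_mult supp gM g'M)+
  have *: "(\<integral>x. e x * g' x + \<i> * complex_of_real (\<xi> \<bullet> b) * e x * g x \<partial>lborel) = 0"
  proof (rule integral_directional_derivative_eq_0[where g="\<lambda>x. e x * g x" and R=R])
    show "((\<lambda>s. e (x + s *\<^sub>R b) * g (x + s *\<^sub>R b)) has_vector_derivative
        e x * g' x + \<i> * complex_of_real (\<xi> \<bullet> b) * e x * g x) (at 0)" for x
      using has_vector_derivative_mult[OF e_der[of x] der'[of x]] by simp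
    show "norm (e x * g x) \<le> (1 + \<bar>\<xi> \<bullet> b\<bar>) * M" for x
    proof -
      have "0 \<le> \<bar>\<xi> \<bullet> b\<bar> * M" using order_trans[OF norm_ge_zero gM[of x]] by simp
      with gM[of x] have "norm (g x) \<le> M + \<bar>\<xi> \<bullet> b\<bar> * M" by linarith
      then show ?thesis by (simp add: norm_mult distrib_right)
    qed
    show "norm (e x * g' x + \<i> * complex_of_real (\<xi> \<bullet> b) * e x * g x) \<le> (1 + \<bar>\<xi> \<bullet> b\<bar>) * M" for x
    proof -
      have "norm (e x * g' x + \<i> * complex_of_real (\<xi> \<bullet> b) * e x * g x)
          \<le> norm (e x * g' x) + norm (\<i> * complex_of_real (\<xi> \<bullet> b) * e x * g x)"
        by (rule norm_triangle_ineq)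
      also have "\<dots> = norm (g' x) + \<bar>\<xi> \<bullet> b\<bar> * norm (g x)" by (simp add: norm_mult)
      also have "\<dots> \<le> M + \<bar>\<xi> \<bullet> b\<bar> * M"
        by (intro add_mono mult_left_mono gM g'M) simp
      finally show ?thesis by (simp add: distrib_right)
    qed
  qed (use Suc.prems(6) in \<open>simp_all add: supp\<close>)
  have "(\<i> * complex_of_real (\<xi> \<bullet> b)) * (\<integral>x. e x * g x \<partial>lborel) = - (\<integral>x. e x * g' x \<partial>lborel)"
  proof -
    have "(\<integral>x. e x * g' x + \<i> * complex_of_real (\<xi> \<bullet> b) * e x * g x \<partial>lborel)
       = (\<integral>x. e x * g' x \<partial>lborel) + (\<integral>x. (\<i> * complex_of_real (\<xi> \<bullet> b)) * (e x * g x) \<partial>lborel)"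
      unfolding mult.assoc using int by (intro Bochner_Integration.integral_add) auto
    also have "(\<integral>x. (\<i> * complex_of_real (\<xi> \<bullet> b)) * (e x * g x) \<partial>lborel)
        = (\<i> * complex_of_real (\<xi> \<bullet> b)) * (\<integral>x. e x * g x \<partial>lborel)"
      by (rule integral_mult_right_zero)
    finally show ?thesis using * by (metis add_eq_0_iff)
  qed
  from arg_cong[OF this, of norm] have "\<bar>\<xi> \<bullet> b\<bar> * norm (\<integral>x. e x * g x \<partial>lborel) = norm (\<integral>x. e x * g' x \<partial>lborel)"
    by (simp add: norm_mult)
  then have "\<bar>\<xi> \<bullet> b\<bar> ^ Suc k * norm (\<integral>x. e x * g x \<partial>lborel) = \<bar>\<xi> \<bullet> b\<bar> ^ k * norm (\<integral>x. e x * g' x \<partial>lborel)"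
    by (simp add: mult.assoc mult.left_commute)
  also have "ennreal \<dots> \<le> (\<integral>\<^sup>+x. ennreal (B x * v x * v x ^ k) \<partial>lborel)"
    unfolding e_def
  proof (rule Suc.IH[OF g'])
    show "B x * v x * v x ^ j \<le> M" if "j \<le> k" for x j
      using Suc.prems(4)[of "Suc j" x] that by (simp add: mult.assoc)
  qed (use Suc.prems(3,5,6) in simp_all)
  finally show ?case by (simp add: e_def mult.assoc)
qed

section \<open>Schur tests and the composition of an operator with its adjoint\<close>

lemma nn_integral_lborel_shift_reflect:
  fixes \<kappa> :: "'a::euclidean_space \<Rightarrow> ennreal"
  assumes [measurable]: "\<kappa> \<in> borel_measurable borel"
  shows "(\<integral>\<^sup>+y. \<kappa> (x - y) \<partial>lborel) = (\<integral>\<^sup>+y. \<kappa> y \<partial>lborel)"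
    and "(\<integral>\<^sup>+y. \<kappa> (y - x) \<partial>lborel) = (\<integral>\<^sup>+y. \<kappa> y \<partial>lborel)"
proof -
  have "lborel = density (distr lborel borel (\<lambda>z::'a. x - z)) (\<lambda>_. 1)"
    using lborel_affine[of "-1" x] by simp
  then have "(\<integral>\<^sup>+y. \<kappa> y \<partial>lborel) = (\<integral>\<^sup>+y. \<kappa> y \<partial>density (distr lborel borel (\<lambda>z::'a. x - z)) (\<lambda>_. 1))"
    by (rule arg_cong)
  also have "\<dots> = (\<integral>\<^sup>+y. \<kappa> (x - y) \<partial>lborel)"
    by (simp add: nn_integral_density nn_integral_distr)
  finally show "(\<integral>\<^sup>+y. \<kappa> (x - y) \<partial>lborel) = (\<integral>\<^sup>+y. \<kappa> y \<partial>lborel)" ..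
  have "(\<integral>\<^sup>+y. \<kappa> y \<partial>lborel) = (\<integral>\<^sup>+y. \<kappa> y \<partial>distr lborel borel ((+) (- x)))"
    by (simp add: lborel_distr_plus)
  also have "\<dots> = (\<integral>\<^sup>+y. \<kappa> (y - x) \<partial>lborel)"
    by (simp add: nn_integral_distr)
  finally show "(\<integral>\<^sup>+y. \<kappa> (y - x) \<partial>lborel) = (\<integral>\<^sup>+y. \<kappa> y \<partial>lborel)" ..
qed

text \<open>Schur's test for convolution kernels, by the Cauchy--Schwarz inequality for the measure with
  density \<open>\<kappa> (x - y)\<close>.\<close>

lemma schur_convolution:
  fixes \<kappa> g :: "'a::euclidean_space \<Rightarrow> ennreal"
  assumes [measurable]: "\<kappa> \<in> borel_measurable borel" "g \<in> borel_measurable borel"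
  shows "(\<integral>\<^sup>+x. (\<integral>\<^sup>+y. \<kappa> (x - y) * g y \<partial>lborel)\<^sup>2 \<partial>lborel)
           \<le> (\<integral>\<^sup>+z. \<kappa> z \<partial>lborel)\<^sup>2 * (\<integral>\<^sup>+y. (g y)\<^sup>2 \<partial>lborel)"
proof -
  let ?I = "\<integral>\<^sup>+z. \<kappa> z \<partial>lborel"
  have "(\<integral>\<^sup>+y. \<kappa> (x - y) * g y \<partial>lborel)\<^sup>2 \<le> ?I * (\<integral>\<^sup>+y. \<kappa> (x - y) * (g y)\<^sup>2 \<partial>lborel)" for x
    using Cauchy_Schwarz_nn_integral[of "\<lambda>_. 1" "density lborel (\<lambda>y. \<kappa> (x - y))" g]
    by (simp add: nn_integral_density emeasure_density nn_integral_lborel_shift_reflect)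
  then have "(\<integral>\<^sup>+x. (\<integral>\<^sup>+y. \<kappa> (x - y) * g y \<partial>lborel)\<^sup>2 \<partial>lborel)
     \<le> (\<integral>\<^sup>+x. ?I * (\<integral>\<^sup>+y. \<kappa> (x - y) * (g y)\<^sup>2 \<partial>lborel) \<partial>lborel)"
    by (intro nn_integral_mono)
  also have "\<dots> = ?I * (\<integral>\<^sup>+x. \<integral>\<^sup>+y. \<kappa> (x - y) * (g y)\<^sup>2 \<partial>lborel \<partial>lborel)"
    by (rule nn_integral_cmult) measurable
  also have "(\<integral>\<^sup>+x. \<integral>\<^sup>+y. \<kappa> (x - y) * (g y)\<^sup>2 \<partial>lborel \<partial>lborel)
      = (\<integral>\<^sup>+y. \<integral>\<^sup>+x. \<kappa> (x - y) * (g y)\<^sup>2 \<partial>lborel \<partial>lborel)"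
    by (rule lborel_pair.Fubini'[symmetric]) measurable
  also have "\<dots> = (\<integral>\<^sup>+y. ?I * (g y)\<^sup>2 \<partial>lborel)"
    by (simp add: nn_integral_multc nn_integral_lborel_shift_reflect)
  also have "\<dots> = ?I * (\<integral>\<^sup>+y. (g y)\<^sup>2 \<partial>lborel)"
    by (simp add: nn_integral_cmult)
  finally show ?thesis by (simp add: power2_eq_square mult.assoc)
qed

text \<open>The form of Schur's test suited to a composition with the adjoint, from
  \<open>2 g(y) g(y') \<le> g(y)\<^sup>2 + g(y')\<^sup>2\<close>.\<close>

lemma schur_bilinear:
  fixes \<kappa> g :: "'a::euclidean_space \<Rightarrow> ennreal"
  assumes [measurable]: "\<kappa> \<in> borel_measurable borel" "g \<in> borel_measurable borel"
  shows "(\<integral>\<^sup>+y. \<integral>\<^sup>+y'. g y * g y' * \<kappa> (y - y') \<partial>lborel \<partial>lborel)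
           \<le> (\<integral>\<^sup>+z. \<kappa> z \<partial>lborel) * (\<integral>\<^sup>+y. (g y)\<^sup>2 \<partial>lborel)"
proof -
  let ?I = "\<integral>\<^sup>+z. \<kappa> z \<partial>lborel" and ?G = "\<integral>\<^sup>+y. (g y)\<^sup>2 \<partial>lborel"
  let ?X = "\<integral>\<^sup>+y. \<integral>\<^sup>+y'. g y * g y' * \<kappa> (y - y') \<partial>lborel \<partial>lborel"
  have A: "(\<integral>\<^sup>+y. \<integral>\<^sup>+y'. (g y)\<^sup>2 * \<kappa> (y - y') \<partial>lborel \<partial>lborel) = ?I * ?G"
    by (simp add: nn_integral_cmult nn_integral_multc nn_integral_lborel_shift_reflect mult.commute)
  have "(\<integral>\<^sup>+y. \<integral>\<^sup>+y'. (g y')\<^sup>2 * \<kappa> (y - y') \<partial>lborel \<partial>lborel)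
      = (\<integral>\<^sup>+y'. \<integral>\<^sup>+y. (g y')\<^sup>2 * \<kappa> (y - y') \<partial>lborel \<partial>lborel)"
    by (rule lborel_pair.Fubini'[symmetric]) measurable
  then have B: "(\<integral>\<^sup>+y. \<integral>\<^sup>+y'. (g y')\<^sup>2 * \<kappa> (y - y') \<partial>lborel \<partial>lborel) = ?I * ?G"
    by (simp add: nn_integral_cmult nn_integral_multc nn_integral_lborel_shift_reflect mult.commute)
  have "2 * ?X = (\<integral>\<^sup>+y. \<integral>\<^sup>+y'. (2 * g y * g y') * \<kappa> (y - y') \<partial>lborel \<partial>lborel)"
    by (simp add: nn_integral_cmult[symmetric] mult.assoc)
  also have "\<dots> \<le> (\<integral>\<^sup>+y. \<integral>\<^sup>+y'. (g y)\<^sup>2 * \<kappa> (y - y') + (g y')\<^sup>2 * \<kappa> (y - y') \<partial>lborel \<partial>lborel)"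
    unfolding distrib_right[symmetric]
    by (intro nn_integral_mono mult_right_mono sum_of_squares_ge_ennreal) auto
  also have "\<dots> = ?I * ?G + ?I * ?G"
    by (simp add: nn_integral_add A B)
  also have "\<dots> = 2 * (?I * ?G)" by (simp add: mult_2)
  finally show ?thesis by (simp add: ennreal_mult_le_mult_iff)
qed

text \<open>The square of the norm in \<open>L\<^sup>2\<close>, with values in \<open>[0, \<infinity>]\<close>.\<close>

abbreviation energy :: "('a::euclidean_space \<Rightarrow> complex) \<Rightarrow> ennreal" where
  "energy g \<equiv> (\<integral>\<^sup>+z. (ennreal (norm (g z)))\<^sup>2 \<partial>lborel)"

text \<open>Square integrable functions are integrable on bounded sets. This makes all integrals below
  absolutely convergent.\<close>

lemma integrable_L2_bounded_support:
  fixes f :: "'a::euclidean_space \<Rightarrow> complex"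
  assumes [measurable]: "f \<in> borel_measurable borel" and fin: "energy f < \<infinity>"
  shows "integrable lborel (\<lambda>y. norm (f y) * indicator {y. norm y \<le> R} y)"
proof (rule integrableI_bounded)
  have "(\<integral>\<^sup>+y. norm (norm (f y) * indicator {y. norm y \<le> R} y) \<partial>lborel)
      \<le> (\<integral>\<^sup>+y. indicator (cball 0 R) y + (ennreal (norm (f y)))\<^sup>2 \<partial>lborel)"
  proof (intro nn_integral_mono)
    fix y
    have "ennreal (norm (f y)) \<le> ennreal (1 + (norm (f y))\<^sup>2)"
      using zero_le_power2[of "norm (f y) - 1"] norm_ge_zero[of "f y"]
      by (intro ennreal_leI) (simp add: power2_eq_square algebra_simps del: norm_ge_zero)
    then show "ennreal (norm (norm (f y) * indicator {y. norm y \<le> R} y)) \<le> indicator (cball 0 R) y + (ennreal (norm (f y)))\<^sup>2"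
      by (auto simp: indicator_def ennreal_power)
  qed
  also have "\<dots> = emeasure lborel (cball (0::'a) R) + energy f"
    by (subst nn_integral_add) (auto intro: borel_measurable_indicator)
  also have "\<dots> < \<infinity>" using fin emeasure_bounded_finite[OF bounded_cball, of "0::'a" R] by simp
  finally show "(\<integral>\<^sup>+y. norm (norm (f y) * indicator {y. norm y \<le> R} y) \<partial>lborel) < \<infinity>" .
qed measurable

text \<open>Expand \<open>|T f|\<^sup>2\<close> as a double integral in \<open>(y, y')\<close> and integrate in \<open>x\<close> first. The inner integral is
  the kernel of the composition of \<open>T\<close> with its adjoint, and Schur's test applies to its majorant.\<close>

lemma TT_star_bound:
  fixes A :: "'a::euclidean_space \<times> 'a \<Rightarrow> complex" and f :: "'a \<Rightarrow> complex"
  assumes [measurable]: "A \<in> borel_measurable borel" "f \<in> borel_measurable borel" "\<kappa> \<in> borel_measurable borel"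
    and bd: "\<And>x y. norm (A (x, y)) \<le> M"
    and supp: "\<And>x y. R < norm x \<or> R < norm y \<Longrightarrow> A (x, y) = 0"
    and fin: "energy f < \<infinity>"
    and kern: "\<And>y y'. ennreal (norm (\<integral>x. cis ((lam *\<^sub>R (y - y')) \<bullet> x) * (A (x, y) * cnj (A (x, y'))) \<partial>lborel)) \<le> \<kappa> (y - y')"
  shows "energy (\<lambda>x. \<integral>y. cis (lam * (x \<bullet> y)) * A (x, y) * f y \<partial>lborel)
           \<le> (\<integral>\<^sup>+z. \<kappa> z \<partial>lborel) * energy f"
proof -
  define F where "F x y = cis (lam * (x \<bullet> y)) * A (x, y) * f y" for x y
  define S where "S x = (\<integral>y. F x y \<partial>lborel)" for x
  define u where "u y = norm (f y) * indicator {y. norm y \<le> R} y" for y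
  have M: "0 \<le> M" using bd[of 0 0] norm_ge_zero order_trans by blast
  have cis_cont: "continuous_on UNIV cis" by (intro continuous_intros)
  have cis_meas [measurable]: "cis \<in> borel_measurable borel" by (rule borel_measurable_continuous_onI[OF cis_cont])
  have cnj_meas [measurable]: "cnj \<in> borel_measurable borel"
    by (intro borel_measurable_continuous_onI continuous_intros)
  have u_int: "integrable lborel u" unfolding u_def by (rule integrable_L2_bounded_support[OF assms(2) fin])
  have u_meas [measurable]: "u \<in> borel_measurable borel" unfolding u_def by measurable
  have u0: "0 \<le> u y" for y by (simp add: u_def)
  have F_meas [measurable]: "case_prod F \<in> borel_measurable (lborel \<Otimes>\<^sub>M lborel)"
    unfolding F_def case_prod_beta by measurable
  have Fu: "norm (F x y) \<le> M * indicator (cball 0 R) x * u y" for x y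
  proof (cases "norm x \<le> R \<and> norm y \<le> R")
    case True
    then show ?thesis using mult_right_mono[OF bd[of x y], of "norm (f y)"] by (simp add: F_def u_def norm_mult)
  next
    case False
    then have "A (x, y) = 0" using supp by auto
    then show ?thesis using M u0 by (simp add: F_def)
  qed
  have F_int: "integrable lborel (F x)" for x
    by (rule Bochner_Integration.integrable_bound[OF integrable_mult_right[OF u_int, of "M * indicator (cball 0 R) x"]])
       (use Fu[of x] M u0 in \<open>auto simp: abs_mult\<close>)
  define H where "H x p = F x (fst p) * cnj (F x (snd p))" for x p
  have H_meas [measurable]: "case_prod H \<in> borel_measurable (lborel \<Otimes>\<^sub>M lborel)"
  proof -
    have F': "(\<lambda>q. F (fst q) (snd q)) \<in> borel_measurable borel"
      using F_meas by (simp add: case_prod_beta' lborel_prod)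
    have "continuous_on UNIV (\<lambda>q::'a \<times> 'a \<times> 'a. (fst q, fst (snd q)))"
      "continuous_on UNIV (\<lambda>q::'a \<times> 'a \<times> 'a. (fst q, snd (snd q)))"
      by (intro continuous_intros)+
    then have [measurable]: "(\<lambda>q::'a \<times> 'a \<times> 'a. (fst q, fst (snd q))) \<in> borel_measurable borel"
      "(\<lambda>q::'a \<times> 'a \<times> 'a. (fst q, snd (snd q))) \<in> borel_measurable borel"
      by (simp_all add: borel_measurable_continuous_onI)
    have [measurable]: "(\<lambda>q::'a \<times> 'a \<times> 'a. F (fst q) (fst (snd q))) \<in> borel_measurable borel"
      "(\<lambda>q::'a \<times> 'a \<times> 'a. F (fst q) (snd (snd q))) \<in> borel_measurable borel"
      using measurable_compose[OF _ F', of "\<lambda>q::'a \<times> 'a \<times> 'a. (fst q, fst (snd q))" borel]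
        measurable_compose[OF _ F', of "\<lambda>q::'a \<times> 'a \<times> 'a. (fst q, snd (snd q))" borel] by simp_all
    have "(\<lambda>q. F (fst q) (fst (snd q)) * cnj (F (fst q) (snd (snd q)))) \<in> borel_measurable borel"
      by (intro borel_measurable_times measurable_compose[OF _ cnj_meas]) fact+
    then show ?thesis by (simp add: H_def case_prod_beta' lborel_prod)
  qed
  have Hu: "norm (H x p) \<le> (M\<^sup>2 * indicator (cball 0 R) x) * (u (fst p) * u (snd p))" for x p
  proof -
    have "norm (H x p) \<le> (M * indicator (cball 0 R) x * u (fst p)) * (M * indicator (cball 0 R) x * u (snd p))"
      unfolding H_def norm_mult complex_mod_cnj using M u0 by (intro mult_mono Fu) auto
    then show ?thesis by (cases "norm x \<le> R") (simp_all add: power2_eq_square mult_ac)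
  qed
  have uu_int: "integrable (lborel \<Otimes>\<^sub>M lborel) (\<lambda>p. u (fst p) * u (snd p))"
    by (rule lborel_pair.Fubini_integrable) (use u_int u0 in \<open>auto simp: abs_mult\<close>)
  have H_int: "integrable (lborel \<Otimes>\<^sub>M lborel) (case_prod H)"
  proof (rule Bochner_Integration.integrable_bound)
    have "integrable lborel (\<lambda>x::'a. M\<^sup>2 * indicator (cball 0 R) x :: real)"
      using emeasure_bounded_finite[OF bounded_cball, of "0::'a" R] by (simp add: integrable_real_indicator)
    moreover have "integrable lborel (\<lambda>p. u (fst p) * u (snd p))" using uu_int by (simp add: lborel_prod)
    ultimately show "integrable (lborel \<Otimes>\<^sub>M lborel) (\<lambda>q. (M\<^sup>2 * indicator (cball (0::'a) R) (fst q)) * (u (fst (snd q)) * u (snd (snd q))))"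
      by (intro lborel_pair.Fubini_integrable) (auto simp: abs_mult)
    show "AE q in lborel \<Otimes>\<^sub>M lborel. norm (case_prod H q) \<le> norm ((M\<^sup>2 * indicator (cball 0 R) (fst q)) * (u (fst (snd q)) * u (snd (snd q))))"
      using Hu u0 by (auto simp: case_prod_beta abs_mult)
  qed measurable
  have HS: "(\<integral>p. H x p \<partial>lborel) = S x * cnj (S x)" for x
  proof -
    have Hx: "integrable (lborel \<Otimes>\<^sub>M lborel) (H x)"
    proof (rule Bochner_Integration.integrable_bound[OF integrable_mult_right[OF uu_int, of "M\<^sup>2 * indicator (cball 0 R) x"]])
      show "H x \<in> borel_measurable (lborel \<Otimes>\<^sub>M lborel)" unfolding H_def F_def by measurable
    qed (use Hu[of x] M u0 in \<open>auto simp: abs_mult\<close>)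
    have "(\<integral>p. H x p \<partial>lborel) = (\<integral>y. (\<integral>y'. H x (y, y') \<partial>lborel) \<partial>lborel)"
      using lborel_pair.integral_fst'[OF Hx] by (simp add: lborel_prod)
    also have "\<dots> = (\<integral>y. F x y * cnj (S x) \<partial>lborel)"
      unfolding H_def S_def by simp
    also have "\<dots> = S x * cnj (S x)" unfolding S_def by simp
    finally show ?thesis .
  qed
  have Hy: "norm (\<integral>x. H x (y, y') \<partial>lborel) \<le> norm (f y) * norm (f y') * norm (\<integral>x. cis ((lam *\<^sub>R (y - y')) \<bullet> x) * (A (x, y) * cnj (A (x, y'))) \<partial>lborel)" for y y'
  proof -
    have "H x (y, y') = (f y * cnj (f y')) * (cis ((lam *\<^sub>R (y - y')) \<bullet> x) * (A (x, y) * cnj (A (x, y'))))" for x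
    proof -
      have "cis (lam * (x \<bullet> y)) * cnj (cis (lam * (x \<bullet> y'))) = cis ((lam *\<^sub>R (y - y')) \<bullet> x)"
        by (simp add: cis_cnj cis_mult inner_diff_left right_diff_distrib inner_commute[of x])
      then show ?thesis by (simp add: H_def F_def mult_ac)
    qed
    then show ?thesis by (simp add: norm_mult)
  qed
  have "energy S = (\<integral>\<^sup>+x. ennreal (norm (S x * cnj (S x))) \<partial>lborel)"
    by (simp add: norm_mult power2_eq_square ennreal_mult)
  also have "\<dots> = ennreal (\<integral>x. norm (S x * cnj (S x)) \<partial>lborel)"
    using lborel_pair.integrable_fst'[OF H_int] by (intro nn_integral_eq_integral) (auto simp: HS)
  also have "(\<integral>x. norm (S x * cnj (S x)) \<partial>lborel) = norm (\<integral>x. S x * cnj (S x) \<partial>lborel)"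
  proof -
    have eq: "S x * cnj (S x) = complex_of_real (norm (S x * cnj (S x)))" for x
    proof -
      have "norm (S x * cnj (S x)) = (norm (S x))\<^sup>2" by (simp add: norm_mult power2_eq_square)
      then show ?thesis by (simp only: complex_norm_square)
    qed
    have "(\<integral>x. S x * cnj (S x) \<partial>lborel) = (\<integral>x. complex_of_real (norm (S x * cnj (S x))) \<partial>lborel)"
      by (rule Bochner_Integration.integral_cong[OF refl]) (rule eq)
    also have "\<dots> = complex_of_real (\<integral>x. norm (S x * cnj (S x)) \<partial>lborel)"
      by (rule integral_complex_of_real)
    finally have "norm (\<integral>x. S x * cnj (S x) \<partial>lborel) = \<bar>\<integral>x. norm (S x * cnj (S x)) \<partial>lborel\<bar>"
      by (simp only: norm_of_real)
    moreover have "0 \<le> (\<integral>x. norm (S x * cnj (S x)) \<partial>lborel)"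
      by (rule Bochner_Integration.integral_nonneg) simp
    ultimately show ?thesis by linarith
  qed
  also have "(\<integral>x. S x * cnj (S x) \<partial>lborel) = (\<integral>p. (\<integral>x. H x p \<partial>lborel) \<partial>lborel)"
    using lborel_pair.Fubini_integral[OF H_int] by (simp add: HS)
  also have "ennreal (norm \<dots>) \<le> (\<integral>\<^sup>+p. norm (\<integral>x. H x p \<partial>lborel) \<partial>lborel)"
    by (cases "integrable lborel (\<lambda>p. \<integral>x. H x p \<partial>lborel)")
       (simp_all add: integral_norm_bound_ennreal not_integrable_integral_eq)
  also have "\<dots> = (\<integral>\<^sup>+y. \<integral>\<^sup>+y'. norm (\<integral>x. H x (y, y') \<partial>lborel) \<partial>lborel \<partial>lborel)"
  proof -
    have "(\<lambda>p. ennreal (norm (\<integral>x. H x p \<partial>lborel))) \<in> borel_measurable (lborel \<Otimes>\<^sub>M lborel)"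
    proof -
      have "(\<lambda>p. \<integral>x. H x p \<partial>lborel) \<in> borel_measurable lborel"
        using measurable_pair_swap[OF H_meas] by (intro lborel.borel_measurable_lebesgue_integral) (simp add: case_prod_beta')
      then show ?thesis by (simp add: lborel_prod)
    qed
    from lborel.nn_integral_fst[OF this] show ?thesis by (simp add: lborel_prod)
  qed
  also have "\<dots> \<le> (\<integral>\<^sup>+y. \<integral>\<^sup>+y'. ennreal (norm (f y)) * ennreal (norm (f y')) * \<kappa> (y - y') \<partial>lborel \<partial>lborel)"
  proof (intro nn_integral_mono)
    fix y y'
    show "ennreal (norm (\<integral>x. H x (y, y') \<partial>lborel)) \<le> ennreal (norm (f y)) * ennreal (norm (f y')) * \<kappa> (y - y')"
      using order_trans[OF ennreal_leI[OF Hy[of y y']]] mult_left_mono[OF kern[of y y'], of "ennreal (norm (f y)) * ennreal (norm (f y'))"]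
      by (simp add: ennreal_mult)
  qed
  also have "\<dots> \<le> (\<integral>\<^sup>+z. \<kappa> z \<partial>lborel) * energy f"
    by (rule schur_bilinear) measurable
  finally show ?thesis unfolding S_def F_def .
qed

section \<open>Decay of the composed kernel\<close>

text \<open>The kernel of the composition, estimated by \<open>N'\<close> integrations by parts in the direction \<open>b\<close>. The
  product of the two amplitudes varies on the scale \<open>w = min |x - y| |x - y'|\<close>, so that the result is
  the integral of \<open>w powr (-2 p - N')\<close> over \<open>\<rho> \<le> w \<le> 2 R\<close>. Since \<open>w\<close> is bounded there, the
  exponent may be lowered to any \<open>-s\<close>, and \<open>s > n\<close> makes the integral a power of \<open>\<rho>\<close>.\<close>

lemma product_kernel_bound:
  fixes s p R :: real and N N' :: nat
  assumes s: "s > DIM('a::euclidean_space)" "s \<ge> 2 * p + N'" and p: "p \<ge> 0" and N': "N' \<le> N" and R: "R > 0"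
  shows "\<exists>C\<ge>0. \<forall>\<rho>>0. \<forall>M\<ge>0. \<forall>A::'a \<times> 'a \<Rightarrow> complex. \<forall>b\<in>Basis. \<forall>\<xi> y y'.
     A \<in> borel_measurable borel \<longrightarrow>
     (\<forall>x y. R < norm x \<or> R < norm y \<or> norm (x - y) < \<rho> \<longrightarrow> A (x, y) = 0) \<longrightarrow>
     (\<forall>y. offdiag_symbol b N y (\<lambda>x. M * norm (x - y) powr - p) (\<lambda>x. A (x, y))) \<longrightarrow>
     \<bar>\<xi> \<bullet> b\<bar> ^ N' * norm (\<integral>x. cis (\<xi> \<bullet> x) * (A (x, y) * cnj (A (x, y'))) \<partial>lborel)
       \<le> C * M\<^sup>2 * \<rho> powr (DIM('a) - s)"
proof -
  obtain Cs where Cs: "Cs > 0"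
    "\<And>\<rho>. \<rho> > 0 \<Longrightarrow> (\<integral>\<^sup>+(z::'a). ennreal (norm z powr - s) * indicator {z. \<rho> \<le> norm z} z \<partial>lborel)
            \<le> ennreal (Cs * \<rho> powr (DIM('a) - s))"
    using nn_integral_norm_powr_tail[OF s(1)] by blast
  (* The surplus of the exponent s, paid for by the upper bound 2 R for the distance. *)
  define e where "e = s - (2 * p + N')"
  have e: "e \<ge> 0" using s by (simp add: e_def)
  define C where "C = 2 ^ N * (2 * R) powr e * (2 * Cs)"
  have main: "\<bar>\<xi> \<bullet> b\<bar> ^ N' * norm (\<integral>x. cis (\<xi> \<bullet> x) * (A (x, y) * cnj (A (x, y'))) \<partial>lborel)
       \<le> C * M\<^sup>2 * \<rho> powr (DIM('a) - s)"
    if \<rho>: "\<rho> > 0" and M: "M \<ge> 0" and b: "b \<in> Basis" and A_meas: "A \<in> borel_measurable borel"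
      and supp: "\<And>x y. R < norm x \<or> R < norm y \<or> norm (x - y) < \<rho> \<Longrightarrow> A (x, y) = 0"
      and sym: "\<And>y. offdiag_symbol b N y (\<lambda>x. M * norm (x - y) powr - p) (\<lambda>x. A (x, y))"
    for \<rho> M and A :: "'a \<times> 'a \<Rightarrow> complex" and b \<xi> y y'
  proof (cases "norm y \<le> R \<and> norm y' \<le> R")
    case False
    then have "A (x, y) * cnj (A (x, y')) = 0" for x using supp[of x y] supp[of x y'] by auto
    then have "norm (\<integral>x. cis (\<xi> \<bullet> x) * (A (x, y) * cnj (A (x, y'))) \<partial>lborel) = 0"
      by (simp only: mult_zero_right) simp
    then show ?thesis using Cs M by (simp add: C_def)
  next
    case True
    define w where "w x = min (norm (x - y)) (norm (x - y'))" for x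
    define V where "V = {x. norm (x - y) < \<rho>} \<union> {x. norm (x - y') < \<rho>} \<union> {x. R < norm x}"
    define U where "U = UNIV - {y} - {y'}"
    define g where "g x = A (x, y) * cnj (A (x, y'))" for x
    define B where "B x = 2 ^ N * ((M * w x powr - p) * (M * w x powr - p))" for x
    define B' where "B' x = (if x \<in> V then 0 else B x)" for x
    have wpos: "w x > 0" if "x \<in> U" for x using that by (auto simp: w_def U_def)
    have w0: "w x \<ge> 0" for x by (simp add: w_def)
    (* Both amplitudes obey the bounds in terms of the smaller distance w. *)
    have sy: "dsymbol b N (\<lambda>x. 1 / w x) (\<lambda>x. M * w x powr - p) U (\<lambda>x. A (x, y))"
      by (rule dsymbol_mono[OF sym[of y]])
         (use wpos M p in \<open>auto simp: U_def w_def intro!: mult_left_mono powr_mono2' frac_le\<close>)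
    have sy': "dsymbol b N (\<lambda>x. 1 / w x) (\<lambda>x. M * w x powr - p) U (\<lambda>x. A (x, y'))"
      by (rule dsymbol_mono[OF sym[of y']])
         (use wpos M p in \<open>auto simp: U_def w_def intro!: mult_left_mono powr_mono2' frac_le\<close>)
    have "dsymbol b N (\<lambda>x. 1 / w x) B U g"
      unfolding B_def g_def by (rule dsymbol_mult[OF sy dsymbol_cnj[OF sy']])
    then have "dsymbol b N (\<lambda>x. 1 / w x) B' UNIV (\<lambda>x. if x \<in> V then 0 else g x)"
      unfolding B'_def
    proof (rule dsymbol_extend_zero)
      show "open U" by (simp add: U_def open_Diff)
      show "open V" unfolding V_def by (intro open_Un open_Collect_less continuous_intros)
      show "U \<union> V = UNIV" using \<rho> by (auto simp: U_def V_def)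
      show "g x = 0" if "x \<in> U \<inter> V" for x
        using that supp[of x y] supp[of x y'] by (auto simp: V_def g_def)
    qed
    moreover have "(\<lambda>x. if x \<in> V then 0 else g x) = g"
      using supp by (auto simp: V_def g_def fun_eq_iff)
    ultimately have sg: "dsymbol b N' (\<lambda>x. 1 / w x) B' UNIV g" using dsymbol_le[OF _ N'] by simp
    have g_meas: "g \<in> borel_measurable borel"
    proof -
      have "continuous_on UNIV (\<lambda>x. (x, z))" for z :: 'a by (intro continuous_intros)
      then have "(\<lambda>x. (x, z)) \<in> borel_measurable borel" for z :: 'a by (rule borel_measurable_continuous_onI)
      from measurable_compose[OF this A_meas] have 1: "(\<lambda>x. A (x, z)) \<in> borel_measurable borel" for z .
      have "cnj \<in> borel_measurable borel" by (intro borel_measurable_continuous_onI continuous_intros)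
      from measurable_compose[OF 1 this] show ?thesis unfolding g_def by (intro borel_measurable_times 1)
    qed
    have outV: "\<rho> \<le> w x" "w x \<le> 2 * R" if "x \<notin> V" for x
    proof -
      show "\<rho> \<le> w x" using that by (auto simp: V_def w_def)
      have "norm (x - y) \<le> norm x + norm y" by (rule norm_triangle_ineq4)
      then show "w x \<le> 2 * R" using that True by (auto simp: V_def w_def)
    qed
    define L where "L = 2 ^ N * ((M * \<rho> powr - p) * (M * \<rho> powr - p)) * (max 1 (1 / \<rho>)) ^ N'"
    have "ennreal (\<bar>\<xi> \<bullet> b\<bar> ^ N' * norm (\<integral>x. cis (\<xi> \<bullet> x) * g x \<partial>lborel))
           \<le> (\<integral>\<^sup>+x. ennreal (B' x * (1 / w x) ^ N') \<partial>lborel)"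
    proof (rule oscillatory_integral_bound[OF sg g_meas, where M=L and R=R])
      show "0 \<le> 1 / w x" for x using w0 by simp
      show "B' x = 0" if "R < norm x" for x using that by (simp add: B'_def V_def)
      show "norm b = 1" using b by simp
      show "B' x * (1 / w x) ^ j \<le> L" if "j \<le> N'" for x j
      proof (cases "x \<in> V")
        case True then show ?thesis using M by (simp add: B'_def L_def)
      next
        case False
        have "(1 / w x) ^ j \<le> (max 1 (1 / \<rho>)) ^ j"
          using outV[OF False] \<rho> by (intro power_mono) (auto simp: max.coboundedI2 frac_le)
        also have "\<dots> \<le> (max 1 (1 / \<rho>)) ^ N'" by (rule power_increasing[OF that]) simp
        finally have 1: "(1 / w x) ^ j \<le> (max 1 (1 / \<rho>)) ^ N'" .
        have "w x powr - p \<le> \<rho> powr - p" using outV[OF False] \<rho> p by (intro powr_mono2') auto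
        then show ?thesis using False 1 M w0[of x]
          unfolding L_def B'_def B_def by (auto intro!: mult_mono)
      qed
    qed
    also have "\<dots> \<le> (\<integral>\<^sup>+x. ennreal (2 ^ N * M\<^sup>2 * (2 * R) powr e) *
        (ennreal (norm (x - y) powr - s) * indicator {z. \<rho> \<le> norm z} (x - y) +
         ennreal (norm (x - y') powr - s) * indicator {z. \<rho> \<le> norm z} (x - y')) \<partial>lborel)"
    proof (rule nn_integral_mono)
      fix x
      show "ennreal (B' x * (1 / w x) ^ N') \<le> ennreal (2 ^ N * M\<^sup>2 * (2 * R) powr e) *
        (ennreal (norm (x - y) powr - s) * indicator {z. \<rho> \<le> norm z} (x - y) +
         ennreal (norm (x - y') powr - s) * indicator {z. \<rho> \<le> norm z} (x - y'))"
      proof (cases "x \<in> V")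
        case True then show ?thesis by (simp add: B'_def)
      next
        case False
        have wp: "w x > 0" using outV[OF False] \<rho> by linarith
        have "w x powr - p * w x powr - p * (1 / w x) ^ N' = w x powr (- (2 * p + N'))"
          using wp by (simp add: powr_add powr_minus powr_realpow power_divide field_simps flip: powr_add mult_2)
        also have "\<dots> = w x powr e * w x powr - s" by (simp add: e_def flip: powr_add)
        also have "\<dots> \<le> (2 * R) powr e * w x powr - s"
          using outV[OF False] wp e by (intro mult_right_mono powr_mono2) auto
        finally have 0: "w x powr - p * w x powr - p * (1 / w x) ^ N' \<le> (2 * R) powr e * w x powr - s" .
        have 1: "B' x * (1 / w x) ^ N' \<le> (2 ^ N * M\<^sup>2 * (2 * R) powr e) * w x powr - s"
        proof -
          have "0 \<le> 2 ^ N * M\<^sup>2" by simp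
          from mult_left_mono[OF 0 this] show ?thesis
            using False unfolding B'_def B_def by (simp add: power2_eq_square mult_ac)
        qed
        have in1: "x - y \<in> {z. \<rho> \<le> norm z}" "x - y' \<in> {z. \<rho> \<le> norm z}" using False by (auto simp: V_def)
        have "w x powr - s \<le> norm (x - y) powr - s + norm (x - y') powr - s"
          by (auto simp: w_def min_def)
        then have "B' x * (1 / w x) ^ N' \<le> (2 ^ N * M\<^sup>2 * (2 * R) powr e) * (norm (x - y) powr - s + norm (x - y') powr - s)"
          using 1 by (meson mult_left_mono order_trans mult_nonneg_nonneg powr_ge_zero zero_le_power zero_le_power2 zero_le_numeral)
        then show ?thesis using in1 by (simp add: ennreal_leI flip: ennreal_mult ennreal_plus)
      qed
    qed
    also have "\<dots> = ennreal (2 ^ N * M\<^sup>2 * (2 * R) powr e) *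
        ((\<integral>\<^sup>+x. ennreal (norm (x - y) powr - s) * indicator {z. \<rho> \<le> norm z} (x - y) \<partial>lborel) +
         (\<integral>\<^sup>+x. ennreal (norm (x - y') powr - s) * indicator {z. \<rho> \<le> norm z} (x - y') \<partial>lborel))"
      by (subst nn_integral_cmult, measurable) (subst nn_integral_add, auto)
    also have "\<dots> \<le> ennreal (2 ^ N * M\<^sup>2 * (2 * R) powr e) *
        (ennreal (Cs * \<rho> powr (DIM('a) - s)) + ennreal (Cs * \<rho> powr (DIM('a) - s)))"
    proof (intro mult_left_mono add_mono)
      have "(\<integral>\<^sup>+x. ennreal (norm (x - z) powr - s) * indicator {z. \<rho> \<le> norm z} (x - z) \<partial>lborel)
         \<le> ennreal (Cs * \<rho> powr (DIM('a) - s))" for z :: 'a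
      proof -
        have "(\<integral>\<^sup>+x. ennreal (norm (x - z) powr - s) * indicator {z. \<rho> \<le> norm z} (x - z) \<partial>lborel)
          = (\<integral>\<^sup>+x. ennreal (norm x powr - s) * indicator {z. \<rho> \<le> norm z} x \<partial>distr lborel borel ((+) (- z)))"
          by (subst nn_integral_distr) auto
        also have "\<dots> \<le> ennreal (Cs * \<rho> powr (DIM('a) - s))" using Cs(2)[OF \<rho>] by (simp add: lborel_distr_plus)
        finally show ?thesis .
      qed
      then show "(\<integral>\<^sup>+x. ennreal (norm (x - y) powr - s) * indicator {z. \<rho> \<le> norm z} (x - y) \<partial>lborel)
         \<le> ennreal (Cs * \<rho> powr (DIM('a) - s))"
        "(\<integral>\<^sup>+x. ennreal (norm (x - y') powr - s) * indicator {z. \<rho> \<le> norm z} (x - y') \<partial>lborel)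
         \<le> ennreal (Cs * \<rho> powr (DIM('a) - s))" by blast+
    qed simp
    also have "\<dots> = ennreal (C * M\<^sup>2 * \<rho> powr (DIM('a) - s))"
      using Cs(1) by (simp add: C_def mult_ac flip: ennreal_mult ennreal_plus)
    finally show ?thesis
      using Cs(1) by (simp add: g_def C_def ennreal_le_iff)
  qed
  show ?thesis
  proof (intro exI[of _ C] conjI allI ballI impI)
    show "C \<ge> 0" using Cs(1) by (simp add: C_def)
  qed (use main in blast)
qed

section \<open>Oscillatory operators with a kernel singular on the diagonal\<close>

text \<open>The direction in which the phase \<open>x \<bullet> u\<close> oscillates fastest, up to a constant, among the
  coordinate directions.\<close>

lemma max_coordinate:
  fixes u :: "'a::euclidean_space"
  obtains b where "b \<in> Basis" "norm u \<le> sqrt DIM('a) * \<bar>u \<bullet> b\<bar>"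
proof -
  have "\<exists>b\<in>Basis. infnorm u = \<bar>u \<bullet> b\<bar>"
  proof -
    have "finite ((\<lambda>b. \<bar>u \<bullet> b\<bar>) ` Basis)" "(\<lambda>b. \<bar>u \<bullet> b\<bar>) ` Basis \<noteq> {}" by auto
    from Max_in[OF this] show ?thesis unfolding infnorm_Max by (simp only: image_iff)
  qed
  then show ?thesis using that norm_le_infnorm[of u] by auto
qed

text \<open>Put \<open>p = n + 1 - m\<close>, \<open>u = y - y'\<close> and \<open>\<delta> = 1 / (lam r)\<close>; at \<open>|u| = \<delta>\<close> the phase begins to
  oscillate on the scale \<open>r\<close> of the cutoff. For \<open>|u| \<ge> \<delta>\<close> the kernel of the composition is integrable
  after \<open>n + 1\<close> integrations by parts. For \<open>|u| \<le> \<delta>\<close> fewer are made, namely the smallest number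
  \<open>N\<^sub>1 \<ge> n - 2 p\<close>: about so many are necessary to let the region \<open>|x - y| \<approx> r\<close> dominate the
  \<open>x\<close>-integral, and \<open>N\<^sub>1 < n\<close> keeps \<open>|u| powr -N\<^sub>1\<close> integrable at \<open>0\<close>. Both contributions are at most
  a constant times \<open>M\<^sup>2 r powr (2 m + 1)\<close>.\<close>

lemma oscillatory_operator_bound:
  fixes m R c :: real
  assumes m: "0 < m" "m < DIM('a::euclidean_space)" and R: "R > 0" and c: "c > 0"
  shows "\<exists>C\<ge>0. \<forall>lam\<ge>1. \<forall>M\<ge>0. \<forall>(A::'a \<times> 'a \<Rightarrow> complex) (f::'a \<Rightarrow> complex) r.
     r = lam powr (- (real DIM('a) / (2 * (real DIM('a) + 2)))) \<longrightarrow>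
     A \<in> borel_measurable borel \<longrightarrow> f \<in> borel_measurable borel \<longrightarrow>
     energy f < \<infinity> \<longrightarrow>
     (\<forall>x y. R < norm x \<or> R < norm y \<or> norm (x - y) < c * r \<longrightarrow> A (x, y) = 0) \<longrightarrow>
     (\<forall>b\<in>Basis. \<forall>y. offdiag_symbol b (DIM('a) + 1) y (\<lambda>x. M * norm (x - y) powr (m - DIM('a) - 1)) (\<lambda>x. A (x, y))) \<longrightarrow>
     energy (\<lambda>x. \<integral>y. cis (lam * (x \<bullet> y)) * A (x, y) * f y \<partial>lborel)
       \<le> ennreal (C * M\<^sup>2 * r powr (2 * m)) * energy f"
proof -
  let ?n = "DIM('a)"
  define p where "p = ?n + 1 - m"
  have p: "p > 1" using m by (simp add: p_def)
  define N1 where "N1 = nat \<lceil>?n - 2 * p\<rceil>"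
  define s1 where "s1 = max (2 * p + N1) (?n + 1)"
  define s2 where "s2 = 2 * p + real (?n + 1)"
  have N1: "real N1 \<ge> ?n - 2 * p" "N1 < ?n" "N1 \<le> ?n + 1"
  proof -
    show "real N1 \<ge> ?n - 2 * p" unfolding N1_def by (rule real_nat_ceiling_ge)
    have "real N1 < ?n"
      using p DIM_positive[where 'a='a] by (cases "?n - 2 * p \<ge> 0") (simp_all add: N1_def, linarith)
    then show "N1 < ?n" "N1 \<le> ?n + 1" by simp_all
  qed
  have s1: "s1 > ?n" "s1 \<ge> 2 * p + N1" and s2: "s2 > ?n" "s2 \<ge> 2 * p + real (?n + 1)" and p0: "p \<ge> 0"
    using p by (auto simp: s1_def s2_def)
  obtain C1 where C1: "C1 \<ge> 0" and K1: "\<forall>\<rho>>0. \<forall>M\<ge>0. \<forall>A::'a \<times> 'a \<Rightarrow> complex. \<forall>b\<in>Basis. \<forall>\<xi> y y'.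
     A \<in> borel_measurable borel \<longrightarrow>
     (\<forall>x y. R < norm x \<or> R < norm y \<or> norm (x - y) < \<rho> \<longrightarrow> A (x, y) = 0) \<longrightarrow>
     (\<forall>y. offdiag_symbol b (?n + 1) y (\<lambda>x. M * norm (x - y) powr - p) (\<lambda>x. A (x, y))) \<longrightarrow>
     \<bar>\<xi> \<bullet> b\<bar> ^ N1 * norm (\<integral>x. cis (\<xi> \<bullet> x) * (A (x, y) * cnj (A (x, y'))) \<partial>lborel)
       \<le> C1 * M\<^sup>2 * \<rho> powr (?n - s1)"
    using product_kernel_bound[OF s1 p0 N1(3) R] by blast
  obtain C2 where C2: "C2 \<ge> 0" and K2: "\<forall>\<rho>>0. \<forall>M\<ge>0. \<forall>A::'a \<times> 'a \<Rightarrow> complex. \<forall>b\<in>Basis. \<forall>\<xi> y y'.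
     A \<in> borel_measurable borel \<longrightarrow>
     (\<forall>x y. R < norm x \<or> R < norm y \<or> norm (x - y) < \<rho> \<longrightarrow> A (x, y) = 0) \<longrightarrow>
     (\<forall>y. offdiag_symbol b (?n + 1) y (\<lambda>x. M * norm (x - y) powr - p) (\<lambda>x. A (x, y))) \<longrightarrow>
     \<bar>\<xi> \<bullet> b\<bar> ^ (?n + 1) * norm (\<integral>x. cis (\<xi> \<bullet> x) * (A (x, y) * cnj (A (x, y'))) \<partial>lborel)
       \<le> C2 * M\<^sup>2 * \<rho> powr (?n - s2)"
    using product_kernel_bound[OF s2 p0 order_refl R] by blast
  obtain Cb where Cb: "Cb > 0" "\<And>\<rho>. \<rho> > 0 \<Longrightarrow>
      (\<integral>\<^sup>+(z::'a). ennreal (norm z powr - real N1) * indicator {z. norm z \<le> \<rho>} z \<partial>lborel)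
            \<le> ennreal (Cb * \<rho> powr (?n - real N1))"
    using nn_integral_norm_powr_ball[where 'a='a, of "real N1"] N1 by auto
  obtain Ct where Ct: "Ct > 0" "\<And>\<rho>. \<rho> > 0 \<Longrightarrow>
      (\<integral>\<^sup>+(z::'a). ennreal (norm z powr - real (?n + 1)) * indicator {z. \<rho> \<le> norm z} z \<partial>lborel)
            \<le> ennreal (Ct * \<rho> powr (?n - real (?n + 1)))"
    using nn_integral_norm_powr_tail[where 'a='a, of "real (?n + 1)"] by auto
  define E1 where "E1 = C1 * c powr (?n - s1) * sqrt ?n ^ N1"
  define E2 where "E2 = C2 * c powr (?n - s2) * sqrt ?n ^ (?n + 1)"
  define C where "C = E1 * Cb + E2 * Ct"
  have E: "E1 \<ge> 0" "E2 \<ge> 0" using C1 C2 by (simp_all add: E1_def E2_def)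
  have main: "energy (\<lambda>x. \<integral>y. cis (lam * (x \<bullet> y)) * A (x, y) * f y \<partial>lborel)
       \<le> ennreal (C * M\<^sup>2 * r powr (2 * m)) * energy f"
    if lam: "lam \<ge> 1" and M: "M \<ge> 0" and r_def: "r = lam powr (- (real ?n / (2 * (real ?n + 2))))"
      and A_meas: "A \<in> borel_measurable borel" and f_meas: "f \<in> borel_measurable borel"
      and fin: "energy f < \<infinity>"
      and supp: "\<forall>x y. R < norm x \<or> R < norm y \<or> norm (x - y) < c * r \<longrightarrow> A (x, y) = 0"
      and sym: "\<forall>b\<in>Basis. \<forall>y. offdiag_symbol b (?n + 1) y (\<lambda>x. M * norm (x - y) powr (m - ?n - 1)) (\<lambda>x. A (x, y))"
    for lam M r and A :: "'a \<times> 'a \<Rightarrow> complex" and f :: "'a \<Rightarrow> complex"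
  proof -
    have r: "0 < r" "r \<le> 1" using lam powr_mono[of "- (real ?n / (2 * (real ?n + 2)))" 0 lam] by (auto simp: r_def)
    have lam_r: "lam powr - real ?n = r powr (2 * real ?n + 4)"
    proof -
      have "real ?n / (2 * (real ?n + 2)) * (2 * (real ?n + 2)) = real ?n"
      proof -
        have "2 * (real ?n + 2) > 0" by (intro mult_pos_pos add_nonneg_pos) auto
        then have "2 * (real ?n + 2) \<noteq> 0" by (rule less_imp_neq[symmetric])
        then show ?thesis unfolding times_divide_eq_left by (rule nonzero_mult_div_cancel_right)
      qed
      then have "- (real ?n / (2 * (real ?n + 2))) * (2 * real ?n + 4) = - real ?n"
        by (simp only: distrib_left minus_mult_left[symmetric])
      then show ?thesis unfolding r_def powr_powr by (simp only:)
    qed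
    have mp: "m - ?n - 1 = - p" by (simp add: p_def)
    define \<delta> where "\<delta> = 1 / (lam * r)"
    have \<delta>: "\<delta> > 0" using lam r by (simp add: \<delta>_def)
    define k where "k y y' = norm (\<integral>x. cis ((lam *\<^sub>R (y - y')) \<bullet> x) * (A (x, y) * cnj (A (x, y'))) \<partial>lborel)" for y y'
    define D1 where "D1 = E1 * M\<^sup>2 * r powr (?n - s1) * lam powr - real N1"
    define D2 where "D2 = E2 * M\<^sup>2 * r powr (?n - s2) * lam powr - real (?n + 1)"
    have D: "D1 \<ge> 0" "D2 \<ge> 0" using E M by (simp_all add: D1_def D2_def)
    (* With b the largest coordinate of u, the factor |lam (u \<bullet> b)| ^ N may be replaced by (lam |u|) ^ N. *)
    have scale: "t \<le> C' * (c * r) powr (?n - s) * (sqrt ?n) ^ N / (lam * norm u) ^ N"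
      if "u \<noteq> 0" and b: "b \<in> Basis" "norm u \<le> sqrt ?n * \<bar>u \<bullet> b\<bar>" "0 \<le> t"
        and "\<bar>(lam *\<^sub>R u) \<bullet> b\<bar> ^ N * t \<le> C' * (c * r) powr (?n - s)" for u b :: 'a and N t C' and s :: real
    proof -
      have "(lam * norm u) ^ N * t \<le> (sqrt ?n * \<bar>(lam *\<^sub>R u) \<bullet> b\<bar>) ^ N * t"
        using b lam by (intro mult_right_mono power_mono) (auto simp: abs_mult mult_left_mono mult.left_commute)
      also have "\<dots> = (sqrt ?n) ^ N * (\<bar>(lam *\<^sub>R u) \<bullet> b\<bar> ^ N * t)" by (simp add: power_mult_distrib)
      also have "\<dots> \<le> (sqrt ?n) ^ N * (C' * (c * r) powr (?n - s))"
        by (intro mult_left_mono that) simp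
      finally show ?thesis using lam \<open>u \<noteq> 0\<close> by (simp add: pos_le_divide_eq mult_ac)
    qed
    have conv: "C' * M\<^sup>2 * (c * r) powr a * q ^ N / (lam * t) ^ N
        = C' * c powr a * q ^ N * M\<^sup>2 * r powr a * lam powr - real N * t powr - real N"
      if "t > 0" for C' a q t :: real and N
      using that lam c r by (simp add: powr_mult powr_minus powr_realpow power_mult_distrib field_simps)
    have k1: "k y y' \<le> D1 * norm (y - y') powr - real N1" if "y \<noteq> y'" for y y'
    proof -
      obtain b where b: "b \<in> Basis" "norm (y - y') \<le> sqrt ?n * \<bar>(y - y') \<bullet> b\<bar>" by (rule max_coordinate)
      have "\<bar>(lam *\<^sub>R (y - y')) \<bullet> b\<bar> ^ N1 * k y y' \<le> C1 * M\<^sup>2 * (c * r) powr (?n - s1)"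
        unfolding k_def by (rule K1[rule_format]) (use c r M A_meas supp sym b in \<open>auto simp: mp\<close>)
      from scale[OF _ b _ this] that have "k y y' \<le> C1 * M\<^sup>2 * (c * r) powr (?n - s1) * (sqrt ?n) ^ N1 / (lam * norm (y - y')) ^ N1"
        by (simp add: k_def)
      also have "\<dots> = D1 * norm (y - y') powr - real N1"
        using that by (subst conv) (simp_all only: D1_def E1_def zero_less_norm_iff right_minus_eq not_False_eq_True)
      finally show ?thesis .
    qed
    have k2: "k y y' \<le> D2 * norm (y - y') powr - real (?n + 1)" if "y \<noteq> y'" for y y'
    proof -
      obtain b where b: "b \<in> Basis" "norm (y - y') \<le> sqrt ?n * \<bar>(y - y') \<bullet> b\<bar>" by (rule max_coordinate)
      have "\<bar>(lam *\<^sub>R (y - y')) \<bullet> b\<bar> ^ (?n + 1) * k y y' \<le> C2 * M\<^sup>2 * (c * r) powr (?n - s2)"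
        unfolding k_def by (rule K2[rule_format]) (use c r M A_meas supp sym b in \<open>auto simp: mp\<close>)
      from scale[OF _ b _ this] that have "k y y' \<le> C2 * M\<^sup>2 * (c * r) powr (?n - s2) * (sqrt ?n) ^ (?n + 1) / (lam * norm (y - y')) ^ (?n + 1)"
        by (simp add: k_def)
      also have "\<dots> = D2 * norm (y - y') powr - real (?n + 1)"
        using that by (subst conv) (simp_all only: D2_def E2_def zero_less_norm_iff right_minus_eq not_False_eq_True)
      finally show ?thesis by simp
    qed
    (* The value at u = 0 is set to infinity because 0 powr - N1 = 0 is no majorant there; a point has measure zero. *)
    define \<kappa> where "\<kappa> u = (if u = 0 then \<infinity> else
        ennreal D1 * (ennreal (norm u powr - real N1) * indicator {z. norm z \<le> \<delta>} u) +
        ennreal D2 * (ennreal (norm u powr - real (?n + 1)) * indicator {z. \<delta> \<le> norm z} u))" for u :: 'a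
    have \<kappa>_meas: "\<kappa> \<in> borel_measurable borel" unfolding \<kappa>_def by measurable
    have kern: "ennreal (k y y') \<le> \<kappa> (y - y')" for y y'
    proof (cases "y = y'")
      case True then show ?thesis by (simp add: \<kappa>_def)
    next
      case False
      show ?thesis
      proof (cases "norm (y - y') \<le> \<delta>")
        case True
        have "ennreal (k y y') \<le> ennreal D1 * ennreal (norm (y - y') powr - real N1)"
          using k1[OF False] D by (simp add: ennreal_leI flip: ennreal_mult)
        then show ?thesis using True False by (simp add: \<kappa>_def add_increasing2)
      next
        case gt: False
        have "ennreal (k y y') \<le> ennreal D2 * ennreal (norm (y - y') powr - real (?n + 1))"
          using k2[OF False] D by (simp add: ennreal_leI flip: ennreal_mult)
        then show ?thesis using gt False by (simp add: \<kappa>_def)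
      qed
    qed
    have "(\<integral>\<^sup>+u. \<kappa> u \<partial>lborel) = (\<integral>\<^sup>+(u::'a). ennreal D1 * (ennreal (norm u powr - real N1) * indicator {z. norm z \<le> \<delta>} u) +
        ennreal D2 * (ennreal (norm u powr - real (?n + 1)) * indicator {z. \<delta> \<le> norm z} u) \<partial>lborel)"
      by (rule nn_integral_cong_AE) (use AE_lborel_singleton[of "0::'a"] in \<open>auto simp: \<kappa>_def elim: eventually_mono\<close>)
    also have "\<dots> = ennreal D1 * (\<integral>\<^sup>+(u::'a). ennreal (norm u powr - real N1) * indicator {z. norm z \<le> \<delta>} u \<partial>lborel)
        + ennreal D2 * (\<integral>\<^sup>+(u::'a). ennreal (norm u powr - real (?n + 1)) * indicator {z. \<delta> \<le> norm z} u \<partial>lborel)"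
      by (subst nn_integral_add, measurable, subst (1 2) nn_integral_cmult) auto
    also have "\<dots> \<le> ennreal D1 * ennreal (Cb * \<delta> powr (?n - real N1)) + ennreal D2 * ennreal (Ct * \<delta> powr (?n - real (?n + 1)))"
      by (intro add_mono mult_left_mono Cb(2) Ct(2) \<delta>) auto
    also have "\<dots> = ennreal (D1 * (Cb * \<delta> powr (?n - real N1)) + D2 * (Ct * \<delta> powr (?n - real (?n + 1))))"
      using D Cb(1) Ct(1) by (simp flip: ennreal_mult ennreal_plus)
    also have "\<dots> \<le> ennreal (C * M\<^sup>2 * r powr (2 * m))"
    proof (rule ennreal_leI)
      (* The choice of r enters here, through lam powr - n = r powr (2 n + 4). *)
      have pw: "r powr a * lam powr - b * \<delta> powr (?n - b) = r powr (a + b + ?n + 4)" for a b :: real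
      proof -
        have "\<delta> powr (?n - b) = lam powr (b - ?n) * r powr (b - ?n)"
          using lam r by (simp add: \<delta>_def powr_divide powr_mult powr_minus_divide[symmetric] flip: powr_minus_divide powr_minus)
             (simp add: powr_diff field_simps)
        then have "r powr a * lam powr - b * \<delta> powr (?n - b) = r powr a * r powr (b - ?n) * (lam powr - b * lam powr (b - ?n))"
          by (simp add: mult_ac)
        also have "\<dots> = r powr (a + (b - ?n)) * lam powr - real ?n" using lam r by (simp flip: powr_add)
        also have "\<dots> = r powr (a + b + ?n + 4)" unfolding lam_r by (simp add: algebra_simps flip: powr_add)
        finally show ?thesis .
      qed
      have nn1: "0 \<le> E1 * Cb * M\<^sup>2" and nn2: "0 \<le> E2 * Ct * M\<^sup>2" using E Cb(1) Ct(1) by simp_all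
      have h1: "r powr (?n - s1) * lam powr - real N1 * \<delta> powr (?n - real N1) \<le> r powr (2 * m)"
        unfolding pw using r N1 by (intro powr_mono') (auto simp: s1_def p_def)
      have 1: "D1 * (Cb * \<delta> powr (?n - real N1)) \<le> E1 * Cb * M\<^sup>2 * r powr (2 * m)"
        using mult_left_mono[OF h1 nn1] unfolding D1_def by (simp only: mult_ac)
      have h2: "r powr (?n - s2) * lam powr - real (?n + 1) * \<delta> powr (?n - real (?n + 1)) \<le> r powr (2 * m)"
        unfolding pw using r by (intro powr_mono') (auto simp: s2_def p_def)
      have 2: "D2 * (Ct * \<delta> powr (?n - real (?n + 1))) \<le> E2 * Ct * M\<^sup>2 * r powr (2 * m)"
        using mult_left_mono[OF h2 nn2] unfolding D2_def by (simp only: mult_ac)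
      show "D1 * (Cb * \<delta> powr (?n - real N1)) + D2 * (Ct * \<delta> powr (?n - real (?n + 1))) \<le> C * M\<^sup>2 * r powr (2 * m)"
        using 1 2 by (simp add: C_def algebra_simps)
    qed
    finally have int: "(\<integral>\<^sup>+u. \<kappa> u \<partial>lborel) \<le> ennreal (C * M\<^sup>2 * r powr (2 * m))" .
    have bd: "norm (A (x, y)) \<le> M * (c * r) powr - p" for x y
    proof (cases "norm (x - y) < c * r")
      case True then show ?thesis using supp M by simp
    next
      case False
      then have "x \<noteq> y" using c r by auto
      obtain b where "b \<in> (Basis :: 'a set)" using nonempty_Basis by blast
      then have "norm (A (x, y)) \<le> M * norm (x - y) powr - p"
        using dsymbol_bound[of b _ _ _ "UNIV - {y}" "\<lambda>x. A (x, y)" x] sym \<open>x \<noteq> y\<close> unfolding mp by blast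
      also have "\<dots> \<le> M * (c * r) powr - p"
        using False c r p M by (intro mult_left_mono powr_mono2') auto
      finally show ?thesis .
    qed
    have "energy (\<lambda>x. \<integral>y. cis (lam * (x \<bullet> y)) * A (x, y) * f y \<partial>lborel)
       \<le> (\<integral>\<^sup>+u. \<kappa> u \<partial>lborel) * energy f"
      by (rule TT_star_bound[OF A_meas f_meas \<kappa>_meas bd _ fin kern[unfolded k_def]]) (use supp in auto)
    also have "\<dots> \<le> ennreal (C * M\<^sup>2 * r powr (2 * m)) * energy f"
      by (intro mult_right_mono int) auto
    finally show ?thesis .
  qed
  show ?thesis
  proof (intro exI[of _ C] conjI allI impI)
    show "C \<ge> 0" using E Cb Ct by (simp add: C_def)
  qed (rule main)
qed

section \<open>Cutoff functions\<close>

text \<open>Averaging over a window of length one gains one derivative, and the derivative of the average is a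
  difference of two values of the function that is averaged. Hence the \<open>k\<close>-th step is \<open>k\<close> times
  differentiable with explicit bounds, while it still passes from \<open>0\<close> to \<open>1\<close> on a bounded interval.\<close>

primrec smooth_step :: "nat \<Rightarrow> real \<Rightarrow> real" where
  "smooth_step 0 s = min 1 (max 0 s)"
| "smooth_step (Suc k) s = integral {s - 1..s} (smooth_step k)"

lemma smooth_step_continuous_bounds:
  "continuous_on UNIV (smooth_step k) \<and> (\<forall>s. 0 \<le> smooth_step k s \<and> smooth_step k s \<le> 1) \<and>
   (\<forall>s\<le>0. smooth_step k s = 0) \<and> (\<forall>s\<ge>real (Suc k). smooth_step k s = 1)"
proof (induction k)
  case 0
  have "smooth_step 0 = (\<lambda>s. min 1 (max 0 s))" by (simp add: fun_eq_iff)
  then show ?case by (auto intro!: continuous_intros)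
next
  case (Suc k)
  have cont: "continuous_on S (smooth_step k)" for S using Suc continuous_on_subset by blast
  have int: "smooth_step k integrable_on {a..b}" for a b by (rule integrable_continuous_interval[OF cont])
  have eq: "smooth_step (Suc k) s = integral {s - 1..s} (smooth_step k)" for s by simp
  have "continuous (at s) (smooth_step (Suc k))" for s
  proof -
    define a where "a = s - 3"
    have 1: "smooth_step (Suc k) t = integral {a..t} (smooth_step k) - integral {a..t - 1} (smooth_step k)"
      if "t \<in> {s - 1..s + 1}" for t
      using Henstock_Kurzweil_Integration.integral_combine[of a "t - 1" t "smooth_step k"] int that
      by (auto simp: a_def)
    have c: "continuous_on {a..s + 1} (\<lambda>t. integral {a..t} (smooth_step k))"
      by (rule indefinite_integral_continuous_1[OF int])
    have "continuous_on {s - 1..s + 1} (\<lambda>t. integral {a..t} (smooth_step k) - integral {a..t - 1} (smooth_step k))"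
      by (intro continuous_intros continuous_on_subset[OF c] continuous_on_compose2[OF c]) (auto simp: a_def)
    then have "continuous_on {s - 1..s + 1} (smooth_step (Suc k))"
      by (rule continuous_on_cong[THEN iffD1, rotated -1]) (use 1 in auto)
    then show ?thesis by (rule continuous_on_interior) auto
  qed
  then have "continuous_on UNIV (smooth_step (Suc k))"
    using continuous_at_imp_continuous_on[of UNIV "smooth_step (Suc k)"] by blast
  moreover have "0 \<le> smooth_step (Suc k) s" for s
    unfolding eq using Suc by (intro Henstock_Kurzweil_Integration.integral_nonneg int) auto
  moreover have "smooth_step (Suc k) s \<le> 1" for s
    unfolding eq using Suc integral_le[OF int[of "s - 1" s] integrable_const_ivl[of 1 "s - 1" s]] by auto
  moreover have "smooth_step (Suc k) s = 0" if "s \<le> 0" for s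
    unfolding eq using Suc that by (intro integral_eq_0_iff[THEN iffD2] cont) auto
  moreover have "smooth_step (Suc k) s = 1" if "s \<ge> real (Suc (Suc k))" for s
  proof -
    have "integral {s - 1..s} (smooth_step k) = integral {s - 1..s} (\<lambda>_. 1)"
      using Suc that by (intro Henstock_Kurzweil_Integration.integral_cong) auto
    then show ?thesis by simp
  qed
  ultimately show ?case by blast
qed

lemma smooth_step_has_derivative:
  "(smooth_step (Suc k) has_real_derivative smooth_step k s - smooth_step k (s - 1)) (at s)"
proof -
  have cont: "continuous_on S (smooth_step k)" for S using smooth_step_continuous_bounds continuous_on_subset by blast
  have int: "smooth_step k integrable_on {a..b}" for a b by (rule integrable_continuous_interval[OF cont])
  define a where "a = s - 3"
  have D: "((\<lambda>t. integral {a..t} (smooth_step k)) has_real_derivative smooth_step k t) (at t)"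
    if "t \<in> {a<..<s + 1}" for t
    using integral_has_real_derivative[OF cont, of t a "s + 1"] that
    by (simp add: at_within_interior[of t "{a..s+1}"] interior_atLeastAtMost_real)
  have D2: "((\<lambda>t. integral {a..t - 1} (smooth_step k)) has_real_derivative smooth_step k (s - 1)) (at s)"
    using DERIV_shift[of "\<lambda>t. integral {a..t} (smooth_step k)" "smooth_step k (s - 1)" s "-1"] D[of "s - 1"]
    by (simp add: a_def)
  have "((\<lambda>t. integral {a..t} (smooth_step k) - integral {a..t - 1} (smooth_step k))
      has_real_derivative smooth_step k s - smooth_step k (s - 1)) (at s)"
    by (rule DERIV_diff[OF D D2]) (simp add: a_def)
  then show ?thesis
  proof (rule has_field_derivative_transform_within_open[where S = "{s - 1<..<s + 1}"])
    show "integral {a..t} (smooth_step k) - integral {a..t - 1} (smooth_step k) = smooth_step (Suc k) t"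
      if "t \<in> {s - 1<..<s + 1}" for t
      using Henstock_Kurzweil_Integration.integral_combine[of a "t - 1" t "smooth_step k"] int that
      by (auto simp: a_def)
  qed auto
qed

text \<open>Here the scales \<open>v\<close> and \<open>v'\<close> need not be comparable where the bound \<open>B\<close> vanishes. This is used for
  cutoffs, whose derivatives live in one annulus only.\<close>

lemma dsymbol_mono_strong:
  assumes "dsymbol b k v B U g" "\<And>x j. x \<in> U' \<Longrightarrow> j \<le> k \<Longrightarrow> B x * v x ^ j \<le> B' x * v' x ^ j" "U' \<subseteq> U"
  shows "dsymbol b k v' B' U' g"
  using assms
proof (induction k arbitrary: B B' g)
  case 0 then show ?case by force
next
  case (Suc k)
  obtain g' where g': "\<forall>x\<in>U. ((\<lambda>s. g (x + s *\<^sub>R b)) has_vector_derivative g' x) (at 0)"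
    "dsymbol b k v (\<lambda>x. B x * v x) U g'" using dsymbol_SucD[OF Suc.prems(1)] by blast
  have 1: "dsymbol b k v' (\<lambda>x. B' x * v' x) U' g'"
  proof (rule Suc.IH[OF g'(2) _ Suc.prems(3)])
    show "B x * v x * v x ^ j \<le> B' x * v' x * v' x ^ j" if "x \<in> U'" "j \<le> k" for x j
      using Suc.prems(2)[OF that(1), of "Suc j"] that(2) by (simp add: mult.assoc)
  qed
  have 2: "norm (g x) \<le> B' x" if "x \<in> U'" for x
    using dsymbol_bound[OF Suc.prems(1), of x] Suc.prems(2)[OF that, of 0] Suc.prems(3) that by force
  show ?case by (rule dsymbol_SucI[OF _ _ 1]) (use 2 g'(1) Suc.prems(3) in blast)+
qed

lemma dsymbol_line_invariant:
  assumes "\<And>x s. h (x + s *\<^sub>R b) = h x" "\<And>x. x \<in> U \<Longrightarrow> norm (h x) \<le> B x" "\<And>x. x \<in> U \<Longrightarrow> 0 \<le> v x"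
  shows "dsymbol b k v B U h"
proof -
  have "dsymbol b k v B U ((\<lambda>j. if j = 0 then h else (\<lambda>_. 0)) (0::nat))"
  proof (rule dsymbol_seqI[where G = "\<lambda>j. if j = 0 then h else (\<lambda>_. 0)"])
    show "norm ((if j = 0 then h else (\<lambda>_. 0)) x) \<le> B x * v x ^ j" if "x \<in> U" for j x
      using assms(2,3)[OF that] order_trans[OF norm_ge_zero assms(2)[OF that]] by auto
  qed (simp add: assms(1))
  then show ?thesis by simp
qed

lemma dsymbol_smooth_step:
  fixes b x0 :: "'a::euclidean_space"
  assumes b: "b \<bullet> b = 1"
  shows "dsymbol b k (\<lambda>_. 2 * \<bar>\<mu>\<bar>) (\<lambda>_. 1) UNIV (\<lambda>x. complex_of_real (smooth_step k (\<mu> * ((x - x0) \<bullet> b) + \<nu>)))"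
proof (induction k arbitrary: \<nu>)
  case 0
  show ?case using smooth_step_continuous_bounds[of 0] by simp
next
  case (Suc k)
  let ?g = "\<lambda>\<nu> x. complex_of_real (smooth_step k (\<mu> * ((x - x0) \<bullet> b) + \<nu>))"
  have "dsymbol b k (\<lambda>_. 2 * \<bar>\<mu>\<bar>) (\<lambda>_. norm (complex_of_real \<mu>) * (1 + norm (-1::complex) * 1)) UNIV
      (\<lambda>x. complex_of_real \<mu> * (?g \<nu> x + (-1) * ?g (\<nu> - 1) x))"
    by (intro dsymbol_const_mult dsymbol_add Suc.IH)
  then have 1: "dsymbol b k (\<lambda>_. 2 * \<bar>\<mu>\<bar>) (\<lambda>_. 1 * (2 * \<bar>\<mu>\<bar>)) UNIV
      (\<lambda>x. complex_of_real \<mu> * (?g \<nu> x + (-1) * ?g (\<nu> - 1) x))"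
    by (simp add: mult.commute)
  have 2: "((\<lambda>s. complex_of_real (smooth_step (Suc k) (\<mu> * ((x + s *\<^sub>R b - x0) \<bullet> b) + \<nu>))) has_vector_derivative
      complex_of_real \<mu> * (?g \<nu> x + (-1) * ?g (\<nu> - 1) x)) (at 0)" for x
  proof -
    have d: "((\<lambda>s. \<mu> * ((x + s *\<^sub>R b - x0) \<bullet> b) + \<nu>) has_real_derivative \<mu>) (at 0)"
      using b by (auto intro!: derivative_eq_intros simp: inner_simps)
    have "((\<lambda>s. smooth_step (Suc k) (\<mu> * ((x + s *\<^sub>R b - x0) \<bullet> b) + \<nu>)) has_real_derivative
        (smooth_step k (\<mu> * ((x + 0 *\<^sub>R b - x0) \<bullet> b) + \<nu>) - smooth_step k (\<mu> * ((x + 0 *\<^sub>R b - x0) \<bullet> b) + \<nu> - 1)) * \<mu>) (at 0)"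
      by (rule DERIV_chain2[OF smooth_step_has_derivative d])
    from has_vector_derivative_of_real[OF this]
    show ?thesis by (simp add: mult.commute add_diff_eq)
  qed
  have 3: "norm (complex_of_real (smooth_step (Suc k) (\<mu> * ((x - x0) \<bullet> b) + \<nu>))) \<le> 1" for x
    using smooth_step_continuous_bounds[of "Suc k"] by (simp del: smooth_step.simps)
  show ?case
    by (rule dsymbol_SucI[OF _ _ 1]) (use 2 3 in blast)+
qed

text \<open>The cutoff is a product over the coordinates of a fixed bump at scale \<open>r\<close>, so a derivative in the
  direction \<open>b\<close> sees one factor only. Each derivative costs \<open>1 / r\<close>, which is at most a constant times
  \<open>1 / |x - y|\<close> on the support; hence the constant does not depend on \<open>r\<close>.\<close>

lemma cutoff_exists:
  "\<exists>C\<ge>1. \<forall>r>0. \<exists>\<eta>::'a::euclidean_space \<Rightarrow> real. \<eta> \<in> borel_measurable borel \<and> (\<forall>z. 0 \<le> \<eta> z \<and> \<eta> z \<le> 1) \<and>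
     (\<forall>z. norm z \<le> r \<longrightarrow> \<eta> z = 1) \<and> (\<forall>z. norm z > C * r \<longrightarrow> \<eta> z = 0) \<and>
     (\<forall>b\<in>Basis. \<forall>y. offdiag_symbol b N y (\<lambda>_. C) (\<lambda>x. complex_of_real (1 - \<eta> (x - y))))"
proof -
  let ?S = "smooth_step N" and ?n = "DIM('a)"
  define L where "L = real (Suc N)"
  (* A derivative of the cutoff costs 2 L / r, which is at most D / norm (x - y) where norm (x - y) \<le> 2 n r. *)
  define D where "D = 1 + 2 * real ?n * (2 * L)"
  define C where "C = 2 * real ?n + 1 + 2 ^ N * (2 ^ N) * D ^ N"
  note S = smooth_step_continuous_bounds[of N]
  have L: "L \<ge> 1" by (simp add: L_def)
  have D: "D \<ge> 1" using L by (simp add: D_def)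
  have "\<exists>\<eta>::'a \<Rightarrow> real. \<eta> \<in> borel_measurable borel \<and> (\<forall>z. 0 \<le> \<eta> z \<and> \<eta> z \<le> 1) \<and>
     (\<forall>z. norm z \<le> r \<longrightarrow> \<eta> z = 1) \<and> (\<forall>z. norm z > C * r \<longrightarrow> \<eta> z = 0) \<and>
     (\<forall>b\<in>Basis. \<forall>y. offdiag_symbol b N y (\<lambda>_. C) (\<lambda>x. complex_of_real (1 - \<eta> (x - y))))"
    if r: "r > 0" for r
  proof -
    define bump where "bump u = ?S ((L / r) * u + 2 * L) * ?S ((- L / r) * u + 2 * L)" for u
    define \<eta> where "\<eta> z = (\<Prod>b\<in>Basis. bump (z \<bullet> b))" for z :: 'a
    have Scont: "continuous_on UNIV (\<lambda>u. ?S (f u))" if "continuous_on UNIV f" for f :: "real \<Rightarrow> real"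
      using continuous_on_compose2[OF conjunct1[OF S] that] by simp
    have bump_cont: "continuous_on UNIV bump" unfolding bump_def by (intro continuous_intros Scont)
    have \<eta>_meas: "\<eta> \<in> borel_measurable borel"
      unfolding \<eta>_def using bump_cont
      by (intro borel_measurable_continuous_onI continuous_on_prod continuous_on_compose2[OF bump_cont] continuous_intros) auto
    have bump01: "0 \<le> bump u \<and> bump u \<le> 1" for u unfolding bump_def using S by (simp add: mult_le_one)
    have bump1: "bump u = 1" if "\<bar>u\<bar> \<le> r" for u
    proof -
      have "\<bar>(L / r) * u\<bar> \<le> L" using that r L by (simp add: abs_mult divide_le_eq mult_left_mono)
      then have "- L \<le> L / r * u" "L / r * u \<le> L" by (simp_all only: abs_le_iff) linarith
      moreover have "- L / r * u = - (L / r * u)" by simp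
      ultimately have "L / r * u + 2 * L \<ge> L" "- L / r * u + 2 * L \<ge> L" by linarith+
      then show ?thesis using S by (simp add: bump_def L_def)
    qed
    have bump0: "bump u = 0" if "\<bar>u\<bar> \<ge> 2 * r" for u
    proof (cases "u \<ge> 0")
      case True
      then have "(- L / r) * u + 2 * L \<le> 0" using that r L by (simp add: divide_simps mult_left_mono mult.commute)
      then show ?thesis using S by (simp add: bump_def)
    next
      case False
      then have "L * (2 * r) \<le> L * (- u)" using that L by (intro mult_left_mono) auto
      then have "(L * u + L * (2 * r)) / r \<le> 0" using r by (intro divide_nonpos_pos) auto
      then have "(L / r) * u + 2 * L \<le> 0" using r by (simp add: add_divide_distrib)
      then show ?thesis using S by (simp add: bump_def)
    qed
    have \<eta>0: "\<eta> z = 0" if "norm z > 2 * real ?n * r" for z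
    proof (rule ccontr)
      assume "\<eta> z \<noteq> 0"
      then have "\<bar>z \<bullet> b\<bar> \<le> 2 * r" if "b \<in> Basis" for b
        using that bump0[of "z \<bullet> b"] by (force simp: \<eta>_def)
      then have "(\<Sum>b\<in>Basis. \<bar>z \<bullet> b\<bar>) \<le> real ?n * (2 * r)"
        by (intro sum_bounded_above) auto
      then show False using norm_le_l1[of z] that by simp
    qed
    have \<eta>01: "0 \<le> \<eta> z \<and> \<eta> z \<le> 1" for z unfolding \<eta>_def using bump01 by (auto intro!: prod_nonneg prod_le_1)
    have sym: "offdiag_symbol b N y (\<lambda>_. C) (\<lambda>x. complex_of_real (1 - \<eta> (x - y)))"
      if b: "b \<in> Basis" for b y :: 'a
    proof -
      have bb: "b \<bullet> b = 1" using b by (simp add: inner_same_Basis)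
      let ?v = "\<lambda>_::'a. 2 * (L / r)"
      have s1: "dsymbol b N ?v (\<lambda>_. 1) UNIV (\<lambda>x. complex_of_real (?S ((L / r) * ((x - y) \<bullet> b) + 2 * L)))"
        using dsymbol_smooth_step[OF bb, of N "L / r" y "2 * L"] L r by simp
      have s2: "dsymbol b N ?v (\<lambda>_. 1) UNIV (\<lambda>x. complex_of_real (?S ((- L / r) * ((x - y) \<bullet> b) + 2 * L)))"
        using dsymbol_smooth_step[OF bb, of N "- L / r" y "2 * L"] L r by simp
      have s3: "dsymbol b N ?v (\<lambda>_. 1) UNIV (\<lambda>x. complex_of_real (\<Prod>i\<in>Basis - {b}. bump ((x - y) \<bullet> i)))"
      proof (rule dsymbol_line_invariant)
        show "complex_of_real (\<Prod>i\<in>Basis - {b}. bump ((x + s *\<^sub>R b - y) \<bullet> i)) = complex_of_real (\<Prod>i\<in>Basis - {b}. bump ((x - y) \<bullet> i))" for x s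
          using b by (intro arg_cong[of _ _ complex_of_real] prod.cong) (auto simp: inner_simps inner_not_same_Basis)
        have "0 \<le> (\<Prod>i\<in>Basis - {b}. bump ((x - y) \<bullet> i)) \<and> (\<Prod>i\<in>Basis - {b}. bump ((x - y) \<bullet> i)) \<le> 1" for x
          using bump01 by (auto intro!: prod_nonneg prod_le_1)
        then show "norm (complex_of_real (\<Prod>i\<in>Basis - {b}. bump ((x - y) \<bullet> i))) \<le> 1" for x
          unfolding norm_of_real by (simp add: abs_of_nonneg)
        show "0 \<le> 2 * (L / r)" using L r by simp
      qed
      have "\<eta> (x - y) = (?S ((L / r) * ((x - y) \<bullet> b) + 2 * L) * ?S ((- L / r) * ((x - y) \<bullet> b) + 2 * L)) * (\<Prod>i\<in>Basis - {b}. bump ((x - y) \<bullet> i))" for x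
        unfolding \<eta>_def using b by (subst prod.remove[of _ b]) (auto simp: bump_def)
      then have "dsymbol b N ?v (\<lambda>_. 2 ^ N * ((2 ^ N * (1 * 1)) * 1)) UNIV (\<lambda>x. complex_of_real (\<eta> (x - y)))"
        using dsymbol_mult[OF dsymbol_mult[OF s1 s2] s3] by simp
      then have s4: "dsymbol b N ?v (\<lambda>x. if x \<in> {x. norm (x - y) > 2 * real ?n * r} then 0 else 2 ^ N * ((2 ^ N * (1 * 1)) * 1)) UNIV
          (\<lambda>x. if x \<in> {x. norm (x - y) > 2 * real ?n * r} then 0 else complex_of_real (\<eta> (x - y)))"
      proof (rule dsymbol_extend_zero)
        show "open {x. norm (x - y) > 2 * real ?n * r}" by (intro open_Collect_less continuous_intros)
      qed (use \<eta>0 in auto)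
      have "offdiag_symbol b N y (\<lambda>_. 2 ^ N * 2 ^ N * D ^ N)
          (\<lambda>x. if x \<in> {x. norm (x - y) > 2 * real ?n * r} then 0 else complex_of_real (\<eta> (x - y)))"
      proof (rule dsymbol_mono_strong[OF s4])
        fix x j assume x: "x \<in> UNIV - {y}" and j: "j \<le> N"
        show "(if x \<in> {x. norm (x - y) > 2 * real ?n * r} then 0 else 2 ^ N * ((2 ^ N * (1 * 1)) * 1)) * (2 * (L / r)) ^ j
            \<le> 2 ^ N * 2 ^ N * D ^ N * (1 / norm (x - y)) ^ j"
        proof (cases "norm (x - y) > 2 * real ?n * r")
          case True then show ?thesis using D by simp
        next
          case False
          have p: "norm (x - y) > 0" using x by simp
          have "2 * (L / r) = (2 * real ?n * (2 * L)) / (2 * real ?n * r)"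
            using r by simp
          also have "\<dots> \<le> D / norm (x - y)"
            using False p r L D by (intro frac_le) (auto simp: D_def)
          finally have "(2 * (L / r)) ^ j \<le> (D / norm (x - y)) ^ j" using L r by (intro power_mono) auto
          also have "\<dots> = D ^ j * (1 / norm (x - y)) ^ j" by (simp add: power_divide)
          also have "\<dots> \<le> D ^ N * (1 / norm (x - y)) ^ j"
            using D j by (intro mult_right_mono power_increasing) auto
          finally show ?thesis using False by (simp add: mult_ac)
        qed
      qed simp
      moreover have "(\<lambda>x. if x \<in> {x. norm (x - y) > 2 * real ?n * r} then 0 else complex_of_real (\<eta> (x - y))) = (\<lambda>x. complex_of_real (\<eta> (x - y)))"
        using \<eta>0 by (auto simp: fun_eq_iff)
      ultimately have s5: "offdiag_symbol b N y (\<lambda>_. 2 ^ N * 2 ^ N * D ^ N) (\<lambda>x. complex_of_real (\<eta> (x - y)))"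
        by simp
      have s6: "offdiag_symbol b N y (\<lambda>_. 1) (\<lambda>_. 1)"
        by (rule dsymbol_line_invariant) auto
      have "offdiag_symbol b N y (\<lambda>_. 1 + norm (-1::complex) * (2 ^ N * 2 ^ N * D ^ N)) (\<lambda>x. 1 + (-1) * complex_of_real (\<eta> (x - y)))"
        by (rule dsymbol_add[OF s6 dsymbol_const_mult[OF s5]])
      then have "offdiag_symbol b N y (\<lambda>_. 1 + 2 ^ N * 2 ^ N * D ^ N) (\<lambda>x. complex_of_real (1 - \<eta> (x - y)))"
        by simp
      then show ?thesis by (rule dsymbol_mono) (auto simp: C_def)
    qed
    show ?thesis
    proof (intro exI[of _ \<eta>] conjI allI impI ballI)
      show "\<eta> z = 1" if "norm z \<le> r" for z
        unfolding \<eta>_def using that by (intro prod.neutral) (auto intro!: bump1 intro: order_trans[OF Basis_le_norm])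
      show "\<eta> z = 0" if "norm z > C * r" for z
      proof (rule \<eta>0)
        have "2 * real ?n * r \<le> C * r" using r D by (intro mult_right_mono) (auto simp: C_def)
        then show "norm z > 2 * real ?n * r" using that by linarith
      qed
    qed (use \<eta>_meas \<eta>01 sym in auto)
  qed
  moreover have "C \<ge> 1" using D by (simp add: C_def add_increasing2)
  ultimately show ?thesis by blast
qed

section \<open>Derivative bounds for the kernel and for the compactly supported factor\<close>

lemma iter_pderiv_line_derivative:
  fixes F :: "'a::euclidean_space \<Rightarrow> 'b::real_normed_vector"
  assumes "iter_pderiv bs F differentiable (at z)"
  shows "((\<lambda>s. iter_pderiv bs F (z + s *\<^sub>R d)) has_vector_derivative iter_pderiv (d # bs) F z) (at 0)"
proof -
  have "(iter_pderiv bs F has_derivative frechet_derivative (iter_pderiv bs F) (at z)) (at (z + 0 *\<^sub>R d))"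
    using assms by (simp add: frechet_derivative_works)
  moreover have "((\<lambda>s. z + s *\<^sub>R d) has_derivative (\<lambda>s. s *\<^sub>R d)) (at 0)"
    by (auto intro!: derivative_eq_intros)
  ultimately have "((iter_pderiv bs F \<circ> (\<lambda>s. z + s *\<^sub>R d)) has_derivative
      frechet_derivative (iter_pderiv bs F) (at z) \<circ> (\<lambda>s. s *\<^sub>R d)) (at 0)"
    by (intro diff_chain_at) auto
  moreover have "frechet_derivative (iter_pderiv bs F) (at z) \<circ> (\<lambda>s. s *\<^sub>R d)
      = (\<lambda>s. s *\<^sub>R frechet_derivative (iter_pderiv bs F) (at z) d)"
    using linear_frechet_derivative[OF assms] by (auto simp: fun_eq_iff linear_cmul)
  ultimately show ?thesis by (simp add: has_vector_derivative_def o_def)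
qed

lemma smooth_on_iter_pderiv_continuous:
  assumes "smooth_on S F" "bs \<in> lists Basis"
  shows "continuous_on S (iter_pderiv bs F)"
  using assms unfolding smooth_on_def
  by (intro continuous_at_imp_continuous_on ballI differentiable_imp_continuous_within) blast

lemma iter_pderiv_eq_0_outside_support:
  assumes "z \<notin> closure {z. F z \<noteq> 0}"
  shows "iter_pderiv bs F z = 0"
  using assms
proof (induction bs arbitrary: z)
  case Nil
  then show ?case using closure_subset[of "{z. F z \<noteq> 0}"] by auto
next
  case (Cons b bs)
  let ?V = "- closure {z. F z \<noteq> 0}"
  have "(iter_pderiv bs F has_derivative (\<lambda>_. 0)) (at z)"
    by (rule has_derivative_transform_within_open[of "\<lambda>_. 0" _ _ _ ?V]) (use Cons in auto)
  then have "(\<lambda>_. 0) = frechet_derivative (iter_pderiv bs F) (at z)" by (rule frechet_derivative_at)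
  then show ?case by (metis iter_pderiv.simps(2))
qed

lemma iter_pderiv_bounded_of_compact_support:
  assumes "smooth_on UNIV F" "compactly_supported F" "bs \<in> lists Basis"
  shows "\<exists>C\<ge>0. \<forall>z. norm (iter_pderiv bs F z) \<le> C"
proof -
  let ?S = "closure {z. F z \<noteq> 0}"
  have "compact (iter_pderiv bs F ` ?S)"
    using assms smooth_on_iter_pderiv_continuous[OF assms(1,3)]
    by (intro compact_continuous_image) (auto simp: compactly_supported_def intro: continuous_on_subset)
  then have "bounded (iter_pderiv bs F ` ?S)" by (rule compact_imp_bounded)
  then obtain C where C: "\<forall>v\<in>iter_pderiv bs F ` ?S. norm v \<le> C" by (auto simp: bounded_iff)
  have "norm (iter_pderiv bs F z) \<le> max 0 C" for z
    using C iter_pderiv_eq_0_outside_support[of z F bs] by (cases "z \<in> ?S") (auto simp: max.coboundedI2)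
  then show ?thesis by (intro exI[of _ "max 0 C"]) auto
qed

text \<open>One constant for all derivatives up to a given order.\<close>

lemma uniform_constant:
  assumes "\<And>k. k \<le> (N::nat) \<Longrightarrow> \<exists>C\<ge>(0::real). P k C" "\<And>k C C'. P k C \<Longrightarrow> C \<le> C' \<Longrightarrow> P k C'"
  shows "\<exists>C\<ge>0. \<forall>k\<le>N. P k C"
proof -
  have "\<forall>k. \<exists>C. k \<le> N \<longrightarrow> 0 \<le> C \<and> P k C" using assms(1) by blast
  then obtain c where "\<forall>k. k \<le> N \<longrightarrow> 0 \<le> c k \<and> P k (c k)" by (rule choice[THEN exE])
  then have c: "\<And>k. k \<le> N \<Longrightarrow> 0 \<le> c k \<and> P k (c k)" by blast
  have "P k (\<Sum>j\<le>N. c j)" if "k \<le> N" for k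
  proof (rule assms(2))
    show "P k (c k)" using c that by blast
    show "c k \<le> (\<Sum>j\<le>N. c j)" by (rule member_le_sum) (use c that in auto)
  qed
  moreover have "(\<Sum>j\<le>N. c j) \<ge> 0" using c by (intro sum_nonneg) auto
  ultimately show ?thesis by blast
qed

text \<open>Horizontal derivatives of the kernel, or of one of its derivatives, at a point \<open>(x - y, \<tau>)\<close>. The
  bound in terms of \<open>|(x - y, \<tau>)|\<close> implies that in terms of \<open>|x - y|\<close>, uniformly in \<open>\<tau>\<close>, because
  the exponent is not positive. Uniformity in \<open>\<tau>\<close> yields uniformity over all graphs.\<close>

lemma kernel_dsymbol:
  fixes K :: "'a::euclidean_space \<times> real \<Rightarrow> complex"
  assumes sm: "smooth_on (UNIV - {0}) K" and kb: "kernel_bounds \<sigma> K" and L: "L \<in> lists Basis"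
    and \<sigma>: "\<sigma> - real (length L) \<le> 0"
  shows "\<exists>C\<ge>0. \<forall>b\<in>Basis. \<forall>y \<tau>. offdiag_symbol b N y (\<lambda>x. C * norm (x - y) powr (\<sigma> - real (length L))) (\<lambda>x. iter_pderiv L K (x - y, \<tau>))"
proof -
  define bs where "bs b k = replicate k (b::'a, 0::real) @ L" for b k
  have bs: "bs b k \<in> lists Basis" if "b \<in> Basis" for b k
    using L that by (auto simp: bs_def Basis_prod_def in_lists_conv_set)
  have "\<exists>C\<ge>0. \<forall>k\<le>N. \<forall>b\<in>Basis. \<forall>z. z \<noteq> 0 \<longrightarrow> norm (iter_pderiv (bs b k) K z) \<le> C * norm z powr (\<sigma> - real (length (bs b k)))"
  proof (rule uniform_constant)
    fix k
    have "\<forall>b\<in>Basis. \<exists>C. \<forall>z. z \<noteq> 0 \<longrightarrow> norm (iter_pderiv (bs b k) K z) \<le> C * norm z powr (\<sigma> - real (length (bs b k)))"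
      using kb bs unfolding kernel_bounds_def by blast
    then obtain c where c: "\<And>b z. b \<in> Basis \<Longrightarrow> z \<noteq> 0 \<Longrightarrow> norm (iter_pderiv (bs b k) K z) \<le> c b * norm z powr (\<sigma> - real (length (bs b k)))"
      by metis
    have "norm (iter_pderiv (bs b k) K z) \<le> (\<Sum>i\<in>Basis. \<bar>c i\<bar>) * norm z powr (\<sigma> - real (length (bs b k)))"
      if "b \<in> Basis" "z \<noteq> 0" for b z
    proof -
      have "c b \<le> \<bar>c b\<bar>" by simp
      also have "\<dots> \<le> (\<Sum>i\<in>Basis. \<bar>c i\<bar>)" using that by (intro member_le_sum) auto
      finally show ?thesis using c[OF that] by (meson mult_right_mono order_trans powr_ge_zero)
    qed
    then show "\<exists>C\<ge>0. \<forall>b\<in>Basis. \<forall>z. z \<noteq> 0 \<longrightarrow> norm (iter_pderiv (bs b k) K z) \<le> C * norm z powr (\<sigma> - real (length (bs b k)))"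
      by (intro exI[of _ "\<Sum>i\<in>Basis. \<bar>c i\<bar>"]) (auto intro: sum_nonneg)
  next
    fix k C C' assume *: "\<forall>b\<in>Basis. \<forall>z. z \<noteq> 0 \<longrightarrow> norm (iter_pderiv (bs b k) K z) \<le> C * norm z powr (\<sigma> - real (length (bs b k)))" "C \<le> C'"
    show "\<forall>b\<in>Basis. \<forall>z. z \<noteq> 0 \<longrightarrow> norm (iter_pderiv (bs b k) K z) \<le> C' * norm z powr (\<sigma> - real (length (bs b k)))"
      using * by (meson mult_right_mono order_trans powr_ge_zero)
  qed
  then obtain C where C: "C \<ge> 0" "\<And>k b z. k \<le> N \<Longrightarrow> b \<in> Basis \<Longrightarrow> z \<noteq> 0 \<Longrightarrow>
      norm (iter_pderiv (bs b k) K z) \<le> C * norm z powr (\<sigma> - real (length (bs b k)))" by blast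
  have "offdiag_symbol b N y (\<lambda>x. C * norm (x - y) powr (\<sigma> - real (length L))) (\<lambda>x. iter_pderiv L K (x - y, \<tau>))" if b: "b \<in> Basis" for b y \<tau>
  proof -
    define G where "G k x = iter_pderiv (bs b k) K (x - y, \<tau>)" for k x
    have "offdiag_symbol b N y (\<lambda>x. C * norm (x - y) powr (\<sigma> - real (length L))) (G 0)"
    proof (rule dsymbol_seqI)
      fix k x assume k: "k < N" and x: "x \<in> UNIV - {y}"
      have "iter_pderiv (bs b k) K differentiable (at (x - y, \<tau>))"
        using sm bs[OF b, of k] x unfolding smooth_on_def by (auto simp: zero_prod_def)
      from iter_pderiv_line_derivative[OF this, of "(b, 0)"]
      show "((\<lambda>s. G k (x + s *\<^sub>R b)) has_vector_derivative G (Suc k) x) (at 0)"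
        by (simp add: G_def bs_def algebra_simps)
    next
      fix k x assume k: "k \<le> N" and x: "x \<in> UNIV - {y}"
      let ?e = "\<sigma> - real (length (bs b k))"
      have p: "norm (x - y) > 0" using x by simp
      have "norm (G k x) \<le> C * norm (x - y, \<tau>) powr ?e"
        unfolding G_def using x by (intro C(2) k b) (auto simp: zero_prod_def)
      also have "norm (x - y, \<tau>) powr ?e \<le> norm (x - y) powr ?e"
        using p \<sigma> norm_fst_le[of "x - y" \<tau>] by (intro powr_mono2') (auto simp: bs_def)
      also have "norm (x - y) powr ?e = norm (x - y) powr (\<sigma> - real (length L)) * (1 / norm (x - y)) ^ k"
        using p by (simp add: bs_def powr_diff powr_realpow powr_add power_divide)
      finally show "norm (G k x) \<le> C * norm (x - y) powr (\<sigma> - real (length L)) * (1 / norm (x - y)) ^ k"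
        using C(1) by (simp add: mult_left_mono mult.assoc)
    qed
    then show ?thesis by (simp add: G_def[abs_def] bs_def)
  qed
  then show ?thesis using C(1) by blast
qed

text \<open>On the support \<open>|x - y| \<le> 2 R\<close>, so bounded derivatives satisfy the scale invariant bounds, even with
  an additional factor \<open>|x - y| powr -e\<close>. With \<open>e = 1\<close> this factor gives terms without a derivative of
  the kernel the same homogeneity as terms with one.\<close>

lemma bump_dsymbol:
  fixes \<phi> :: "('a::euclidean_space \<times> real) \<times> 'a \<Rightarrow> real"
  assumes sm: "smooth_on UNIV \<phi>" and cs: "compactly_supported \<phi>" and R: "R > 0"
    and supp: "\<And>x t y. ((x, t), y) \<in> closure {z. \<phi> z \<noteq> 0} \<Longrightarrow> norm x \<le> R \<and> norm y \<le> R"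
    and e: "e \<ge> 0"
  shows "\<exists>C\<ge>0. \<forall>b\<in>Basis. \<forall>y t. offdiag_symbol b N y (\<lambda>x. C * norm (x - y) powr - e) (\<lambda>x. complex_of_real (\<phi> ((x, t), y)))"
proof -
  define bs where "bs b k = replicate k ((b::'a, 0::real), 0::'a)" for b k
  have bs: "bs b k \<in> lists Basis" if "b \<in> Basis" for b k
    using that by (auto simp: bs_def Basis_prod_def in_lists_conv_set)
  have "\<exists>C\<ge>0. \<forall>k\<le>N. \<forall>b\<in>Basis. \<forall>z. norm (iter_pderiv (bs b k) \<phi> z) \<le> C"
  proof (rule uniform_constant)
    fix k
    have "\<forall>b\<in>Basis. \<exists>C\<ge>0. \<forall>z. norm (iter_pderiv (bs b k) \<phi> z) \<le> C"
      using iter_pderiv_bounded_of_compact_support[OF sm cs] bs by blast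
    then obtain c where c: "\<And>b. b \<in> Basis \<Longrightarrow> c b \<ge> 0 \<and> (\<forall>z. norm (iter_pderiv (bs b k) \<phi> z) \<le> c b)"
      by metis
    have "norm (iter_pderiv (bs b k) \<phi> z) \<le> (\<Sum>i\<in>Basis. c i)" if "b \<in> Basis" for b z
    proof -
      have "norm (iter_pderiv (bs b k) \<phi> z) \<le> c b" using c that by blast
      also have "\<dots> \<le> (\<Sum>i\<in>Basis. c i)" by (rule member_le_sum) (use c that in auto)
      finally show ?thesis .
    qed
    moreover have "(\<Sum>i\<in>Basis. c i) \<ge> 0" using c by (intro sum_nonneg) auto
    ultimately show "\<exists>C\<ge>0. \<forall>b\<in>Basis. \<forall>z. norm (iter_pderiv (bs b k) \<phi> z) \<le> C" by blast
  next
    fix k C C' assume "\<forall>b\<in>Basis. \<forall>z. norm (iter_pderiv (bs b k) \<phi> z) \<le> C" "C \<le> C'"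
    then show "\<forall>b\<in>Basis. \<forall>z. norm (iter_pderiv (bs b k) \<phi> z) \<le> C'" by (meson order_trans)
  qed
  then obtain C where C: "C \<ge> 0" "\<And>k b z. k \<le> N \<Longrightarrow> b \<in> Basis \<Longrightarrow> norm (iter_pderiv (bs b k) \<phi> z) \<le> C" by blast
  define C' where "C' = C * (max 1 (2 * R)) ^ N * (2 * R) powr e"
  have "offdiag_symbol b N y (\<lambda>x. C' * norm (x - y) powr - e) (\<lambda>x. complex_of_real (\<phi> ((x, t), y)))" if b: "b \<in> Basis" for b y t
  proof -
    define G where "G k x = complex_of_real (iter_pderiv (bs b k) \<phi> ((x, t), y))" for k x
    have "offdiag_symbol b N y (\<lambda>x. C' * norm (x - y) powr - e) (G 0)"
    proof (rule dsymbol_seqI)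
      fix k x
      have "iter_pderiv (bs b k) \<phi> differentiable (at ((x, t), y))"
        using sm bs[OF b, of k] unfolding smooth_on_def by auto
      from has_vector_derivative_of_real[OF iter_pderiv_line_derivative[OF this, of "((b, 0), 0)",
          unfolded has_real_derivative_iff_has_vector_derivative[symmetric]]]
      show "((\<lambda>s. G k (x + s *\<^sub>R b)) has_vector_derivative G (Suc k) x) (at 0)"
        by (simp add: G_def bs_def)
    next
      fix k x assume k: "k \<le> N" and x: "x \<in> UNIV - {y}"
      have p: "norm (x - y) > 0" using x by simp
      show "norm (G k x) \<le> C' * norm (x - y) powr - e * (1 / norm (x - y)) ^ k"
      proof (cases "((x, t), y) \<in> closure {z. \<phi> z \<noteq> 0}")
        case False
        then show ?thesis using C(1) by (simp add: G_def iter_pderiv_eq_0_outside_support C'_def)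
      next
        case True
        then have le: "norm (x - y) \<le> 2 * R" using supp[OF True] norm_triangle_ineq4[of x y] by linarith
        have "1 \<le> (2 * R / norm (x - y)) powr e"
          using le p e by (intro ge_one_powr_ge_zero) (auto simp: field_simps)
        then have 1: "1 \<le> (2 * R) powr e * norm (x - y) powr - e"
          using p R by (simp add: powr_divide powr_minus_divide)
        have "1 \<le> (2 * R / norm (x - y)) ^ k" using le p by (intro one_le_power) (auto simp: field_simps)
        also have "\<dots> = (2 * R) ^ k * (1 / norm (x - y)) ^ k" by (simp add: power_divide)
        also have "\<dots> \<le> (max 1 (2 * R)) ^ k * (1 / norm (x - y)) ^ k"
          using R by (intro mult_right_mono power_mono) auto
        also have "\<dots> \<le> (max 1 (2 * R)) ^ N * (1 / norm (x - y)) ^ k"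
          using k by (intro mult_right_mono power_increasing) auto
        finally have 2: "1 \<le> (max 1 (2 * R)) ^ N * (1 / norm (x - y)) ^ k" .
        have "1 * 1 \<le> ((2 * R) powr e * norm (x - y) powr - e) * ((max 1 (2 * R)) ^ N * (1 / norm (x - y)) ^ k)"
          by (rule mult_mono[OF 1 2]) auto
        from mult_left_mono[OF this C(1)]
        have 3: "C \<le> C' * norm (x - y) powr - e * (1 / norm (x - y)) ^ k"
          by (simp add: C'_def mult_ac)
        have "norm (G k x) \<le> C" using C(2)[OF k b] by (simp add: G_def)
        then show ?thesis using 3 by linarith
      qed
    qed
    then show ?thesis by (simp add: G_def[abs_def] bs_def)
  qed
  moreover have "C' \<ge> 0" using C(1) by (simp add: C'_def)
  ultimately show ?thesis by blast
qed

lemma borel_measurable_compose_continuous: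
  fixes f :: "'b::topological_space \<Rightarrow> 'c::topological_space" and g :: "'a::topological_space \<Rightarrow> 'b"
  assumes "f \<in> borel_measurable borel" "continuous_on UNIV g"
  shows "(\<lambda>x. f (g x)) \<in> borel_measurable borel"
  using measurable_compose[OF borel_measurable_continuous_onI[OF assms(2)] assms(1)] .

text \<open>The data that do not depend on \<open>\<epsilon>\<close>. Here \<open>R\<close> is a radius for the support of \<open>\<phi>\<close> in both
  horizontal variables.\<close>

locale kernel_setting =
  fixes \<phi> :: "('a::euclidean_space \<times> real) \<times> 'a \<Rightarrow> real" and K :: "'a \<times> real \<Rightarrow> complex" and m R :: real
  assumes m: "0 < m" "m < DIM('a)"
    and \<phi>_smooth: "smooth_on UNIV \<phi>" and \<phi>_support: "compactly_supported \<phi>"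
    and R: "R > 0" and \<phi>_R: "\<And>x t y. ((x, t), y) \<in> closure {z. \<phi> z \<noteq> 0} \<Longrightarrow> norm x \<le> R \<and> norm y \<le> R"
    and K_smooth: "smooth_on (UNIV - {0}) K" and K_bounds: "kernel_bounds (m - DIM('a)) K"
begin

definition K' :: "'a \<times> real \<Rightarrow> complex" where "K' = iter_pderiv [(0, 1)] K"

lemma \<phi>_eq_0: "R < norm x \<or> R < norm y \<Longrightarrow> \<phi> ((x, t), y) = 0"
  using \<phi>_R[of x t y] closure_subset[of "{z. \<phi> z \<noteq> 0}"] by fastforce

lemma \<phi>_bounded: "\<exists>C\<ge>0. \<forall>z. \<bar>\<phi> z\<bar> \<le> C"
  using iter_pderiv_bounded_of_compact_support[OF \<phi>_smooth \<phi>_support, of "[]"] by simp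

lemma \<phi>_measurable: "\<phi> \<in> borel_measurable borel"
  using smooth_on_iter_pderiv_continuous[OF \<phi>_smooth, of "[]"] by (simp add: borel_measurable_continuous_onI)

lemma \<phi>_dsymbol:
  assumes "e \<ge> 0"
  shows "\<exists>C\<ge>0. \<forall>b\<in>Basis. \<forall>y t. offdiag_symbol b N y (\<lambda>x. C * norm (x - y) powr - e) (\<lambda>x. complex_of_real (\<phi> ((x, t), y)))"
proof (rule bump_dsymbol[OF \<phi>_smooth \<phi>_support R _ assms])
  show "norm x \<le> R \<and> norm y \<le> R" if "((x, t), y) \<in> closure {z. \<phi> z \<noteq> 0}" for x t y
    using \<phi>_R[OF that] .
qed

lemma Basis_01: "(0, 1) \<in> (Basis :: ('a \<times> real) set)" by (simp add: Basis_prod_def)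

lemma K_continuous: "continuous_on (UNIV - {0}) K" and K'_continuous: "continuous_on (UNIV - {0}) K'"
  using smooth_on_iter_pderiv_continuous[OF K_smooth, of "[]"]
    smooth_on_iter_pderiv_continuous[OF K_smooth, of "[(0, 1)]"] Basis_01 by (simp_all add: K'_def)

lemma K_measurable: "K \<in> borel_measurable borel" and K'_measurable: "K' \<in> borel_measurable borel"
  using K_continuous K'_continuous
  by (auto intro!: borel_measurable_continuous_countable_exceptions[of "{0}"] simp: Compl_eq_Diff_UNIV)

lemma K_size: "\<exists>C\<ge>0. \<forall>x \<tau>. x \<noteq> 0 \<longrightarrow> norm (K (x, \<tau>)) \<le> C * norm x powr (m - DIM('a))"
proof -
  obtain C where C: "C \<ge> 0" "\<forall>b\<in>Basis. \<forall>y \<tau>. offdiag_symbol b 0 y (\<lambda>x. C * norm (x - y) powr (m - DIM('a))) (\<lambda>x. K (x - y, \<tau>))"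
    using kernel_dsymbol[OF K_smooth K_bounds, of "[]" 0] m by auto
  obtain b where "b \<in> (Basis :: 'a set)" using nonempty_Basis by blast
  then have "norm (K (x, \<tau>)) \<le> C * norm x powr (m - DIM('a))" if "x \<noteq> 0" for x \<tau>
    using C(2)[rule_format, of b 0 \<tau>] that by simp
  then show ?thesis using C(1) by blast
qed

text \<open>Moving the graph vertically differentiates the kernel in the vertical direction.\<close>

lemma K_shift_derivative:
  assumes "(h has_real_derivative h') (at s)" "x \<noteq> 0"
  shows "((\<lambda>s. K (x, t - h s)) has_vector_derivative (- h') *\<^sub>R K' (x, t - h s)) (at s)"
proof -
  have "iter_pderiv [] K differentiable (at (x, t - h s))"
    using K_smooth assms(2) unfolding smooth_on_def by (auto simp: zero_prod_def simp del: iter_pderiv.simps)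
  from iter_pderiv_line_derivative[OF this, of "(0, 1)"]
  have "((\<lambda>u. K (x, t - h s + u)) has_vector_derivative K' (x, t - h s)) (at 0)" by (simp add: K'_def)
  moreover have "((\<lambda>s'. h s - h s') has_vector_derivative - h') (at s)"
    using assms(1) unfolding has_real_derivative_iff_has_vector_derivative
    by (auto intro!: derivative_eq_intros)
  ultimately have "((\<lambda>u. K (x, t - h s + u)) \<circ> (\<lambda>s'. h s - h s') has_vector_derivative (- h') *\<^sub>R K' (x, t - h s)) (at s)"
    by (intro vector_diff_chain_at) auto
  then show ?thesis by (simp add: o_def algebra_simps)
qed

text \<open>The amplitudes that occur below are combinations of the kernel and of its vertical derivative, with
  coefficients that do not depend on \<open>x\<close>. The exponent \<open>m - n - 1\<close> is that of the vertical derivative.\<close>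

lemma product_dsymbol:
  fixes \<eta>C :: real
  assumes \<eta>C: "\<eta>C \<ge> 0"
  shows "\<exists>C\<ge>0. \<forall>b\<in>Basis. \<forall>y t \<tau> \<tau>' c c' \<kappa>.
     offdiag_symbol b N y (\<lambda>_. \<eta>C) \<kappa> \<longrightarrow>
     offdiag_symbol b N y (\<lambda>x. C * (norm c + norm c') * norm (x - y) powr (m - DIM('a) - 1))
       (\<lambda>x. \<kappa> x * (complex_of_real (\<phi> ((x, t), y)) * (c * K (x - y, \<tau>) + c' * K' (x - y, \<tau>'))))"
proof -
  let ?e = "m - DIM('a)"
  obtain C1 where C1: "C1 \<ge> 0" "\<forall>b\<in>Basis. \<forall>y \<tau>. offdiag_symbol b N y (\<lambda>x. C1 * norm (x - y) powr ?e) (\<lambda>x. K (x - y, \<tau>))"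
    using kernel_dsymbol[OF K_smooth K_bounds, of "[]" N] m by auto
  obtain C2 where C2: "C2 \<ge> 0" "\<forall>b\<in>Basis. \<forall>y \<tau>. offdiag_symbol b N y (\<lambda>x. C2 * norm (x - y) powr (?e - 1)) (\<lambda>x. K' (x - y, \<tau>))"
    using kernel_dsymbol[OF K_smooth K_bounds, of "[(0, 1)]" N] m Basis_01 unfolding K'_def by auto
  obtain D1 where D1: "D1 \<ge> 0" "\<forall>b\<in>Basis. \<forall>y t. offdiag_symbol b N y (\<lambda>x. D1 * norm (x - y) powr - 1) (\<lambda>x. complex_of_real (\<phi> ((x, t), y)))"
    using \<phi>_dsymbol[of 1 N] by auto
  obtain D2 where D2: "D2 \<ge> 0" "\<forall>b\<in>Basis. \<forall>y t. offdiag_symbol b N y (\<lambda>x. D2 * norm (x - y) powr - 0) (\<lambda>x. complex_of_real (\<phi> ((x, t), y)))"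
    using \<phi>_dsymbol[of 0 N] by blast
  define C where "C = 2 ^ N * \<eta>C * (2 ^ N * (D1 * C1) + 2 ^ N * (D2 * C2))"
  have "offdiag_symbol b N y (\<lambda>x. C * (norm c + norm c') * norm (x - y) powr (?e - 1))
       (\<lambda>x. \<kappa> x * (complex_of_real (\<phi> ((x, t), y)) * (c * K (x - y, \<tau>) + c' * K' (x - y, \<tau>'))))"
    if b: "b \<in> Basis" and \<kappa>: "offdiag_symbol b N y (\<lambda>_. \<eta>C) \<kappa>" for b y t \<tau> \<tau>' c c' \<kappa>
  proof -
    let ?v = "\<lambda>x. 1 / norm (x - y)" and ?\<phi> = "\<lambda>x. complex_of_real (\<phi> ((x, t), y))" and ?U = "UNIV - {y}"
    have 1: "dsymbol b N ?v (\<lambda>x. 2 ^ N * ((D1 * norm (x - y) powr - 1) * (norm c * (C1 * norm (x - y) powr ?e)))) ?U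
        (\<lambda>x. ?\<phi> x * (c * K (x - y, \<tau>)))"
      using b D1(2) C1(2) by (intro dsymbol_mult dsymbol_const_mult) auto
    have 2: "dsymbol b N ?v (\<lambda>x. 2 ^ N * ((D2 * norm (x - y) powr - 0) * (norm c' * (C2 * norm (x - y) powr (?e - 1))))) ?U
        (\<lambda>x. ?\<phi> x * (c' * K' (x - y, \<tau>')))"
      using b D2(2) C2(2) by (intro dsymbol_mult dsymbol_const_mult) auto
    have "dsymbol b N ?v (\<lambda>x. 2 ^ N * (\<eta>C * (2 ^ N * ((D1 * norm (x - y) powr - 1) * (norm c * (C1 * norm (x - y) powr ?e)))
         + 2 ^ N * ((D2 * norm (x - y) powr - 0) * (norm c' * (C2 * norm (x - y) powr (?e - 1))))))) ?U
        (\<lambda>x. \<kappa> x * (?\<phi> x * (c * K (x - y, \<tau>)) + ?\<phi> x * (c' * K' (x - y, \<tau>'))))"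
      by (rule dsymbol_mult[OF \<kappa> dsymbol_add[OF 1 2]])
    then have 3: "dsymbol b N ?v (\<lambda>x. 2 ^ N * (\<eta>C * (2 ^ N * ((D1 * norm (x - y) powr - 1) * (norm c * (C1 * norm (x - y) powr ?e)))
         + 2 ^ N * ((D2 * norm (x - y) powr - 0) * (norm c' * (C2 * norm (x - y) powr (?e - 1))))))) ?U
        (\<lambda>x. \<kappa> x * (?\<phi> x * (c * K (x - y, \<tau>) + c' * K' (x - y, \<tau>'))))"
      by (simp only: distrib_left)
    show ?thesis
    proof (rule dsymbol_mono[OF 3])
      fix x assume "x \<in> ?U"
      then have p: "norm (x - y) > 0" by simp
      let ?w = "norm (x - y) powr (?e - 1)"
      have w: "norm (x - y) powr - 1 * norm (x - y) powr ?e = ?w" "norm (x - y) powr - 0 = 1"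
      proof -
        show "norm (x - y) powr - 1 * norm (x - y) powr ?e = ?w"
          unfolding powr_add[symmetric] by (rule arg_cong[where f = "\<lambda>e. norm (x - y) powr e"]) simp
      qed (use p in simp)
      have "2 ^ N * ((D1 * norm (x - y) powr - 1) * (norm c * (C1 * norm (x - y) powr ?e)))
          = (2 ^ N * (D1 * C1)) * norm c * ?w"
        unfolding w(1)[symmetric] by (simp only: mult_ac)
      also have "\<dots> \<le> (2 ^ N * (D1 * C1)) * (norm c + norm c') * ?w"
        using D1 C1 by (intro mult_right_mono mult_left_mono) auto
      finally have 4: "2 ^ N * ((D1 * norm (x - y) powr - 1) * (norm c * (C1 * norm (x - y) powr ?e)))
          \<le> (2 ^ N * (D1 * C1)) * (norm c + norm c') * ?w" .
      have "2 ^ N * ((D2 * norm (x - y) powr - 0) * (norm c' * (C2 * ?w))) = (2 ^ N * (D2 * C2)) * norm c' * ?w"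
        unfolding w(2) by (simp only: mult_ac mult_1_right mult_1_left)
      also have "\<dots> \<le> (2 ^ N * (D2 * C2)) * (norm c + norm c') * ?w"
        using D2 C2 by (intro mult_right_mono mult_left_mono) auto
      finally have 5: "2 ^ N * ((D2 * norm (x - y) powr - 0) * (norm c' * (C2 * ?w))) \<le> (2 ^ N * (D2 * C2)) * (norm c + norm c') * ?w" .
      have "0 \<le> 2 ^ N * \<eta>C" using \<eta>C by simp
      from mult_left_mono[OF add_mono[OF 4 5] this]
      show "2 ^ N * (\<eta>C * (2 ^ N * ((D1 * norm (x - y) powr - 1) * (norm c * (C1 * norm (x - y) powr ?e)))
         + 2 ^ N * ((D2 * norm (x - y) powr - 0) * (norm c' * (C2 * ?w))))) \<le> C * (norm c + norm c') * ?w"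
        unfolding C_def by (simp only: distrib_left distrib_right mult.assoc)
    qed auto
  qed
  moreover have "C \<ge> 0" using C1 C2 D1 D2 \<eta>C by (simp add: C_def)
  ultimately show ?thesis by blast
qed

end

section \<open>Families of amplitudes\<close>

lemma ennreal_sum3_power2_le:
  fixes a b c :: ennreal
  shows "(a + b + c)\<^sup>2 \<le> 3 * (a\<^sup>2 + b\<^sup>2 + c\<^sup>2)"
proof -
  have two: "2 * x * y = x * y + x * y" for x y :: ennreal by (simp add: mult_2 distrib_right)
  have "(a + b + c)\<^sup>2 = a\<^sup>2 + b\<^sup>2 + c\<^sup>2 + (2 * a * b + 2 * b * c + 2 * a * c)"
    unfolding two power2_eq_square distrib_left distrib_right by (simp only: ac_simps)
  also have "\<dots> \<le> a\<^sup>2 + b\<^sup>2 + c\<^sup>2 + ((a\<^sup>2 + b\<^sup>2) + (b\<^sup>2 + c\<^sup>2) + (a\<^sup>2 + c\<^sup>2))"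
    by (intro add_left_mono add_mono sum_of_squares_ge_ennreal)
  also have "\<dots> = 3 * (a\<^sup>2 + b\<^sup>2 + c\<^sup>2)"
  proof -
    have three: "3 * z = z + z + z" for z :: ennreal by (metis mult_2 distrib_right mult_1 numeral_3_eq_3 one_add_one numeral_Bit1 numeral_One)
    show ?thesis unfolding three by (simp only: ac_simps)
  qed
  finally show ?thesis .
qed

lemma cis_measurable: "cis \<in> borel_measurable borel"
  by (intro borel_measurable_continuous_onI continuous_intros)

text \<open>A family of graphs, of height \<open>h s y\<close> and with area element \<open>J s y\<close>, together with their derivatives
  \<open>hd\<close> and \<open>Jd\<close> in the parameter \<open>s\<close>. The only quantitative requirement is that these derivatives have
  an integrable singularity at \<open>s = 0\<close>.\<close>

locale profile_family = kernel_setting \<phi> K m R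
  for \<phi> :: "('a::euclidean_space \<times> real) \<times> 'a \<Rightarrow> real" and K :: "'a \<times> real \<Rightarrow> complex" and m R :: real +
  fixes h J hd Jd :: "real \<Rightarrow> 'a \<Rightarrow> real" and B \<beta> :: real
  assumes \<beta>: "0 \<le> \<beta>" "\<beta> < 1" and B: "B \<ge> 0"
    and h_deriv: "\<And>s y. 0 < s \<Longrightarrow> ((\<lambda>s. h s y) has_real_derivative hd s y) (at s)"
    and J_deriv: "\<And>s y. 0 < s \<Longrightarrow> ((\<lambda>s. J s y) has_real_derivative Jd s y) (at s)"
    and hd_cont: "\<And>y. continuous_on {0<..} (\<lambda>s. hd s y)"
    and Jd_cont: "\<And>y. continuous_on {0<..} (\<lambda>s. Jd s y)"
    and J_bound: "\<And>s y. 0 < s \<Longrightarrow> s \<le> 1 \<Longrightarrow> norm y \<le> R \<Longrightarrow> \<bar>J s y\<bar> \<le> B"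
    and hd_bound: "\<And>s y. 0 < s \<Longrightarrow> s \<le> 1 \<Longrightarrow> norm y \<le> R \<Longrightarrow> \<bar>hd s y\<bar> \<le> B * s powr - \<beta>"
    and Jd_bound: "\<And>s y. 0 < s \<Longrightarrow> s \<le> 1 \<Longrightarrow> norm y \<le> R \<Longrightarrow> \<bar>Jd s y\<bar> \<le> B * s powr - \<beta>"
    and meas: "(\<lambda>p. h (fst p) (snd p)) \<in> borel_measurable borel" "(\<lambda>p. J (fst p) (snd p)) \<in> borel_measurable borel"
      "(\<lambda>p. hd (fst p) (snd p)) \<in> borel_measurable borel" "(\<lambda>p. Jd (fst p) (snd p)) \<in> borel_measurable borel"
begin

definition amp :: "real \<Rightarrow> real \<Rightarrow> 'a \<times> 'a \<Rightarrow> complex" where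
  "amp t s p = complex_of_real (\<phi> ((fst p, t), snd p)) * (complex_of_real (J s (snd p)) * K (fst p - snd p, t - h s (snd p)))"

definition amp_deriv :: "real \<Rightarrow> real \<Rightarrow> 'a \<times> 'a \<Rightarrow> complex" where
  "amp_deriv t s p = complex_of_real (\<phi> ((fst p, t), snd p)) *
     (complex_of_real (Jd s (snd p)) * K (fst p - snd p, t - h s (snd p)) +
      complex_of_real (- hd s (snd p) * J s (snd p)) * K' (fst p - snd p, t - h s (snd p)))"

lemma amp_measurable: "(\<lambda>q. amp t (fst q) (snd q)) \<in> borel_measurable borel"
  and amp_deriv_measurable: "(\<lambda>q. amp_deriv t (fst q) (snd q)) \<in> borel_measurable borel"
proof -
  note cc = borel_measurable_compose_continuous
  have sy: "continuous_on UNIV (\<lambda>q::real \<times> 'a \<times> 'a. (fst q, snd (snd q)))" by (intro continuous_intros)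
  have [measurable]: "(\<lambda>q::real \<times> 'a \<times> 'a. h (fst q) (snd (snd q))) \<in> borel_measurable borel"
    "(\<lambda>q::real \<times> 'a \<times> 'a. J (fst q) (snd (snd q))) \<in> borel_measurable borel"
    "(\<lambda>q::real \<times> 'a \<times> 'a. hd (fst q) (snd (snd q))) \<in> borel_measurable borel"
    "(\<lambda>q::real \<times> 'a \<times> 'a. Jd (fst q) (snd (snd q))) \<in> borel_measurable borel"
    using cc[OF meas(1) sy] cc[OF meas(2) sy] cc[OF meas(3) sy] cc[OF meas(4) sy] by simp_all
  have \<phi>m [measurable]: "(\<lambda>q::real \<times> 'a \<times> 'a. \<phi> ((fst (snd q), t), snd (snd q))) \<in> borel_measurable borel"
    by (rule cc[OF \<phi>_measurable]) (intro continuous_intros)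
  have xy: "(\<lambda>q::real \<times> 'a \<times> 'a. fst (snd q) - snd (snd q)) \<in> borel_measurable borel"
    by (intro borel_measurable_continuous_onI continuous_intros)
  have th: "(\<lambda>q::real \<times> 'a \<times> 'a. t - h (fst q) (snd (snd q))) \<in> borel_measurable borel" by measurable
  have z: "(\<lambda>q::real \<times> 'a \<times> 'a. (fst (snd q) - snd (snd q), t - h (fst q) (snd (snd q)))) \<in> borel_measurable borel"
    by (rule borel_measurable_Pair[OF xy th])
  note [measurable] = measurable_compose[OF z K_measurable] measurable_compose[OF z K'_measurable]
  show "(\<lambda>q. amp t (fst q) (snd q)) \<in> borel_measurable borel" unfolding amp_def by measurable
  show "(\<lambda>q. amp_deriv t (fst q) (snd q)) \<in> borel_measurable borel" unfolding amp_deriv_def by measurable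
qed

lemma amp_measurable_fixed: "amp t s \<in> borel_measurable borel" "amp_deriv t s \<in> borel_measurable borel"
  using borel_measurable_compose_continuous[OF amp_measurable, of "\<lambda>p. (s, p)" t]
    borel_measurable_compose_continuous[OF amp_deriv_measurable, of "\<lambda>p. (s, p)" t]
  by (simp_all add: continuous_intros)

lemma amp_eq_0: "R < norm x \<or> R < norm y \<Longrightarrow> amp t s (x, y) = 0" "R < norm x \<or> R < norm y \<Longrightarrow> amp_deriv t s (x, y) = 0"
  using \<phi>_eq_0[of x y t] by (simp_all add: amp_def amp_deriv_def)

lemma amp_has_derivative:
  assumes "x \<noteq> y" "0 < s"
  shows "((\<lambda>s. amp t s (x, y)) has_vector_derivative amp_deriv t s (x, y)) (at s)"
proof -
  have 1: "((\<lambda>s. complex_of_real (J s y)) has_vector_derivative complex_of_real (Jd s y)) (at s)"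
    by (rule has_vector_derivative_of_real[OF J_deriv[OF assms(2)]])
  have 2: "((\<lambda>s. K (x - y, t - h s y)) has_vector_derivative (- hd s y) *\<^sub>R K' (x - y, t - h s y)) (at s)"
    by (rule K_shift_derivative[OF h_deriv[OF assms(2)]]) (use assms in simp)
  from has_vector_derivative_mult_right[OF has_vector_derivative_mult[OF 1 2], of "complex_of_real (\<phi> ((x, t), y))"]
  show ?thesis by (simp add: amp_def amp_deriv_def scaleR_conv_of_real algebra_simps)
qed

lemma amp_deriv_continuous:
  assumes "x \<noteq> y"
  shows "continuous_on {0<..} (\<lambda>s. amp_deriv t s (x, y))"
proof -
  have h: "continuous_on {0<..} (\<lambda>s. h s y)" and J: "continuous_on {0<..} (\<lambda>s. J s y)"
    using DERIV_isCont[OF h_deriv] DERIV_isCont[OF J_deriv]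
    by (auto intro!: continuous_at_imp_continuous_on)
  have z: "continuous_on {0<..} (\<lambda>s. (x - y, t - h s y))" by (intro continuous_intros h)
  have "continuous_on {0<..} (\<lambda>s. K (x - y, t - h s y))" "continuous_on {0<..} (\<lambda>s. K' (x - y, t - h s y))"
    using assms by (auto intro!: continuous_on_compose2[OF K_continuous z] continuous_on_compose2[OF K'_continuous z] simp: zero_prod_def)
  then show ?thesis unfolding amp_deriv_def fst_conv snd_conv
    by (intro continuous_intros hd_cont Jd_cont J)
qed

lemma amp_continuous:
  assumes "x \<noteq> y" shows "continuous_on {0<..} (\<lambda>s. amp t s (x, y))"
  using has_vector_derivative_continuous[OF amp_has_derivative[OF assms]]
  by (auto intro!: continuous_at_imp_continuous_on)

text \<open>The pointwise bound that dominates the operators for all values of the parameter at once.\<close>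

lemma amp_size: "\<exists>C\<ge>0. \<forall>t s x y. 0 < s \<longrightarrow> s \<le> 1 \<longrightarrow> x \<noteq> y \<longrightarrow>
    norm (amp t s (x, y)) \<le> C * norm (x - y) powr (m - DIM('a)) * indicator {z. norm z \<le> 2 * R} (x - y)"
proof -
  obtain C\<phi> where C\<phi>: "C\<phi> \<ge> 0" "\<And>z. \<bar>\<phi> z\<bar> \<le> C\<phi>" using \<phi>_bounded by blast
  obtain CK where CK: "CK \<ge> 0" "\<And>x \<tau>. x \<noteq> 0 \<Longrightarrow> norm (K (x, \<tau>)) \<le> CK * norm x powr (m - DIM('a))" using K_size by blast
  have "norm (amp t s (x, y)) \<le> (C\<phi> * B * CK) * norm (x - y) powr (m - DIM('a)) * indicator {z. norm z \<le> 2 * R} (x - y)"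
    if s: "0 < s" "s \<le> 1" and xy: "x \<noteq> y" for t s x y
  proof (cases "norm x \<le> R \<and> norm y \<le> R")
    case True
    then have "norm (x - y) \<le> 2 * R" using norm_triangle_ineq4[of x y] by linarith
    moreover have "norm (amp t s (x, y)) \<le> C\<phi> * (B * (CK * norm (x - y) powr (m - DIM('a))))"
      unfolding amp_def norm_mult norm_of_real fst_conv snd_conv using True xy s C\<phi>(1) B CK(1)
      by (intro mult_mono C\<phi>(2) J_bound CK(2)) auto
    ultimately show ?thesis by (simp add: mult.assoc)
  next
    case False
    then show ?thesis using amp_eq_0(1)[of x y t s] C\<phi>(1) B CK(1) by auto
  qed
  then show ?thesis using C\<phi>(1) B CK(1) by (intro exI[of _ "C\<phi> * B * CK"]) auto
qed

text \<open>The amplitude and its \<open>s\<close>-derivative, multiplied by any cutoff, obey the bounds that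
  \<open>oscillatory_operator_bound\<close> needs. Only the constant of the \<open>s\<close>-derivative depends on \<open>s\<close>.\<close>

lemma cut_amp_dsymbol:
  assumes "\<eta>C \<ge> 0"
  shows "\<exists>C\<ge>0. \<forall>b\<in>Basis. \<forall>t s y \<kappa>. 0 < s \<longrightarrow> s \<le> 1 \<longrightarrow>
     offdiag_symbol b N y (\<lambda>_. \<eta>C) \<kappa> \<longrightarrow>
     offdiag_symbol b N y (\<lambda>x. C * norm (x - y) powr (m - DIM('a) - 1)) (\<lambda>x. \<kappa> x * amp t s (x, y)) \<and>
     offdiag_symbol b N y (\<lambda>x. (C * s powr - \<beta>) * norm (x - y) powr (m - DIM('a) - 1)) (\<lambda>x. \<kappa> x * amp_deriv t s (x, y))"
proof -
  obtain C0 where C0: "C0 \<ge> 0" "\<forall>b\<in>Basis. \<forall>y t \<tau> \<tau>' c c' \<kappa>.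
     offdiag_symbol b N y (\<lambda>_. \<eta>C) \<kappa> \<longrightarrow>
     offdiag_symbol b N y (\<lambda>x. C0 * (norm c + norm c') * norm (x - y) powr (m - DIM('a) - 1))
       (\<lambda>x. \<kappa> x * (complex_of_real (\<phi> ((x, t), y)) * (c * K (x - y, \<tau>) + c' * K' (x - y, \<tau>'))))"
    using product_dsymbol[OF assms] by blast
  define C where "C = C0 * (B + B * B)"
  have C: "C \<ge> 0" using C0 B by (simp add: C_def)
  have "offdiag_symbol b N y (\<lambda>x. C * norm (x - y) powr (m - DIM('a) - 1)) (\<lambda>x. \<kappa> x * amp t s (x, y)) \<and>
     offdiag_symbol b N y (\<lambda>x. (C * s powr - \<beta>) * norm (x - y) powr (m - DIM('a) - 1)) (\<lambda>x. \<kappa> x * amp_deriv t s (x, y))"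
    if b: "b \<in> Basis" and s: "0 < s" "s \<le> 1" and \<kappa>: "offdiag_symbol b N y (\<lambda>_. \<eta>C) \<kappa>" for b t s y \<kappa>
  proof (cases "norm y \<le> R")
    case True
    have 1: "offdiag_symbol b N y (\<lambda>x. C0 * (norm (complex_of_real (J s y)) + norm (0::complex)) * norm (x - y) powr (m - DIM('a) - 1)) (\<lambda>x. \<kappa> x * amp t s (x, y))"
      using C0(2)[rule_format, OF b \<kappa>, where t = t and c = "complex_of_real (J s y)" and \<tau> = "t - h s y" and c' = 0 and \<tau>' = 0] by (simp add: amp_def)
    have 2: "offdiag_symbol b N y (\<lambda>x. C0 * (norm (complex_of_real (Jd s y)) + norm (complex_of_real (- hd s y * J s y))) * norm (x - y) powr (m - DIM('a) - 1)) (\<lambda>x. \<kappa> x * amp_deriv t s (x, y))"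
      using C0(2)[rule_format, OF b \<kappa>, where t = t and c = "complex_of_real (Jd s y)" and \<tau> = "t - h s y"
          and c' = "complex_of_real (- hd s y * J s y)" and \<tau>' = "t - h s y"] by (simp add: amp_deriv_def)
    have "C0 * (norm (complex_of_real (J s y)) + norm (0::complex)) \<le> C"
      unfolding C_def using J_bound[OF s True] C0 B by (intro mult_left_mono) (auto intro: add_increasing2)
    moreover have "C0 * (norm (complex_of_real (Jd s y)) + norm (complex_of_real (- hd s y * J s y))) \<le> C * s powr - \<beta>"
    proof -
      have "\<bar>hd s y\<bar> * \<bar>J s y\<bar> \<le> (B * s powr - \<beta>) * B"
        using J_bound[OF s True] hd_bound[OF s True] B by (intro mult_mono) auto
      then have "norm (complex_of_real (Jd s y)) + norm (complex_of_real (- hd s y * J s y)) \<le> (B + B * B) * s powr - \<beta>"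
        using Jd_bound[OF s True] by (simp only: norm_of_real abs_mult abs_minus_cancel) (simp add: algebra_simps)
      from mult_left_mono[OF this C0(1)] show ?thesis by (simp only: C_def mult.assoc)
    qed
    ultimately show ?thesis
      by (intro conjI dsymbol_mono[OF 1] dsymbol_mono[OF 2] mult_right_mono) auto
  next
    case False
    then have "(\<lambda>x. \<kappa> x * amp t s (x, y)) = (\<lambda>_. 0)" "(\<lambda>x. \<kappa> x * amp_deriv t s (x, y)) = (\<lambda>_. 0)"
      using amp_eq_0 by auto
    then show ?thesis using C by (auto intro!: dsymbol_line_invariant)
  qed
  then show ?thesis using C by blast
qed

end

section \<open>The operators in the graph coordinate\<close>

text \<open>The truncated Riesz potential has norm \<open>O(\<rho> powr m)\<close>, because its kernel has an integral of that
  size.\<close>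

lemma riesz_local_bound:
  fixes m :: real
  assumes m: "0 < m" "m < DIM('a::euclidean_space)"
  shows "\<exists>C\<ge>0. \<forall>\<rho>>0. \<forall>g::'a \<Rightarrow> ennreal. g \<in> borel_measurable borel \<longrightarrow>
    (\<integral>\<^sup>+x. (\<integral>\<^sup>+y. (ennreal (norm (x - y) powr (m - DIM('a))) * indicator {z. norm z \<le> \<rho>} (x - y)) * g y \<partial>lborel)\<^sup>2 \<partial>lborel)
      \<le> ennreal (C * \<rho> powr (2 * m)) * (\<integral>\<^sup>+y. (g y)\<^sup>2 \<partial>lborel)"
proof -
  obtain C where C: "C > 0" "\<And>\<rho>. \<rho> > 0 \<Longrightarrow> (\<integral>\<^sup>+(z::'a). ennreal (norm z powr - (DIM('a) - m)) * indicator {z. norm z \<le> \<rho>} z \<partial>lborel)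
            \<le> ennreal (C * \<rho> powr (DIM('a) - (DIM('a) - m)))"
    using nn_integral_norm_powr_ball[where 'a='a, of "DIM('a) - m"] m by auto
  show ?thesis
  proof (intro exI[of _ "C\<^sup>2"] conjI allI impI)
    fix \<rho> :: real and g :: "'a \<Rightarrow> ennreal" assume \<rho>: "\<rho> > 0" and g: "g \<in> borel_measurable borel"
    let ?\<kappa> = "\<lambda>z::'a. ennreal (norm z powr (m - DIM('a))) * indicator {z. norm z \<le> \<rho>} z"
    have "(\<integral>\<^sup>+x. (\<integral>\<^sup>+y. ?\<kappa> (x - y) * g y \<partial>lborel)\<^sup>2 \<partial>lborel) \<le> (\<integral>\<^sup>+z. ?\<kappa> z \<partial>lborel)\<^sup>2 * (\<integral>\<^sup>+y. (g y)\<^sup>2 \<partial>lborel)"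
      by (rule schur_convolution) (use g in auto)
    also have "\<dots> \<le> (ennreal (C * \<rho> powr m))\<^sup>2 * (\<integral>\<^sup>+y. (g y)\<^sup>2 \<partial>lborel)"
      using C(2)[OF \<rho>] by (intro mult_right_mono power_mono_ennreal) auto
    also have "(ennreal (C * \<rho> powr m))\<^sup>2 = ennreal (C\<^sup>2 * \<rho> powr (2 * m))"
    proof -
      have "(\<rho> powr m)\<^sup>2 = \<rho> powr (2 * m)" by (simp add: power2_eq_square flip: powr_add)
      then show ?thesis using C(1) ennreal_power[of "C * \<rho> powr m" 2] by (simp add: power_mult_distrib)
    qed
    finally show "(\<integral>\<^sup>+x. (\<integral>\<^sup>+y. ?\<kappa> (x - y) * g y \<partial>lborel)\<^sup>2 \<partial>lborel) \<le> ennreal (C\<^sup>2 * \<rho> powr (2 * m)) * (\<integral>\<^sup>+y. (g y)\<^sup>2 \<partial>lborel)" .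
  qed simp
qed

text \<open>The Bochner integral is \<open>0\<close> where it does not converge, so the inequality holds in all cases.\<close>

lemma norm_integral_le_nn_integral:
  fixes f :: "'a \<Rightarrow> 'b::{banach, second_countable_topology}"
  shows "ennreal (norm (integral\<^sup>L M f)) \<le> (\<integral>\<^sup>+x. ennreal (norm (f x)) \<partial>M)"
  by (cases "integrable M f") (simp_all add: integral_norm_bound_ennreal not_integrable_integral_eq)

context profile_family
begin

definition graph_op :: "real \<Rightarrow> real \<Rightarrow> ('a \<Rightarrow> complex) \<Rightarrow> 'a \<Rightarrow> real \<Rightarrow> complex" where
  "graph_op lam t f x s = (\<integral>y. cis (lam * (x \<bullet> y)) * amp t s (x, y) * f y \<partial>lborel)"

definition potential :: "('a \<Rightarrow> complex) \<Rightarrow> 'a \<Rightarrow> ennreal" where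
  "potential f x = (\<integral>\<^sup>+y. (ennreal (norm (x - y) powr (m - DIM('a))) * indicator {z. norm z \<le> 2 * R} (x - y)) * ennreal (norm (f y)) \<partial>lborel)"

lemma section_measurable:
  fixes A :: "'a \<times> 'a \<Rightarrow> complex"
  assumes "A \<in> borel_measurable borel" shows "(\<lambda>y. A (x, y)) \<in> borel_measurable borel"
  by (rule borel_measurable_compose_continuous[OF assms]) (intro continuous_intros)

lemma phase_measurable: "(\<lambda>y. cis (lam * (x \<bullet> y))) \<in> borel_measurable borel" for x :: 'a
  by (rule borel_measurable_compose_continuous[OF cis_measurable]) (intro continuous_intros)

lemma integrand_measurable:
  assumes "f \<in> borel_measurable borel"
  shows "(\<lambda>y. cis (lam * (x \<bullet> y)) * amp t s (x, y) * f y) \<in> borel_measurable borel"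
  by (intro borel_measurable_times phase_measurable section_measurable amp_measurable_fixed assms)

lemma graph_op_measurable:
  assumes [measurable]: "f \<in> borel_measurable borel"
  shows "(\<lambda>x. graph_op lam t f x s) \<in> borel_measurable borel"
proof -
  have [measurable]: "amp t s \<in> borel_measurable borel" "cis \<in> borel_measurable borel"
    by (simp_all add: amp_measurable_fixed cis_measurable)
  show ?thesis unfolding graph_op_def by measurable
qed

text \<open>At every point where the potential is finite, the integrals converge absolutely with a majorant
  that does not depend on the parameter; hence they depend continuously on it.\<close>

lemma graph_op_le_potential: "\<exists>C\<ge>0. \<forall>lam t f x. f \<in> borel_measurable borel \<longrightarrow>
    (\<forall>s. 0 < s \<longrightarrow> s \<le> 1 \<longrightarrow> ennreal (norm (graph_op lam t f x s)) \<le> ennreal C * potential f x) \<and>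
    (potential f x < \<infinity> \<longrightarrow> continuous_on {0<..1} (graph_op lam t f x) \<and>
      (\<forall>s. 0 < s \<longrightarrow> s \<le> 1 \<longrightarrow> integrable lborel (\<lambda>y. cis (lam * (x \<bullet> y)) * amp t s (x, y) * f y)))"
proof -
  obtain C where C: "C \<ge> 0" "\<And>t s x y. 0 < s \<Longrightarrow> s \<le> 1 \<Longrightarrow> x \<noteq> y \<Longrightarrow>
    norm (amp t s (x, y)) \<le> C * norm (x - y) powr (m - DIM('a)) * indicator {z. norm z \<le> 2 * R} (x - y)"
    using amp_size by blast
  define D where "D f x y = C * norm (x - y) powr (m - DIM('a)) * indicator {z. norm z \<le> 2 * R} (x - y) * norm (f y)" for f :: "'a \<Rightarrow> complex" and x y
  have le: "norm (cis (lam * (x \<bullet> y)) * amp t s (x, y) * f y) \<le> D f x y" if "0 < s" "s \<le> 1" "x \<noteq> y" for lam t s x y f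
    unfolding D_def norm_mult norm_cis mult_1 by (intro mult_right_mono C(2) that) simp
  have D0: "D f x y \<ge> 0" for f x y using C(1) by (simp add: D_def)
  have DW: "(\<integral>\<^sup>+y. ennreal (D f x y) \<partial>lborel) = ennreal C * potential f x" if [measurable]: "f \<in> borel_measurable borel" for f x
  proof -
    have "ennreal (D f x y) = ennreal C * ((ennreal (norm (x - y) powr (m - DIM('a))) * indicator {z. norm z \<le> 2 * R} (x - y)) * ennreal (norm (f y)))" for y
      using C(1) by (simp add: D_def ennreal_mult mult.assoc flip: ennreal_indicator)
    then show ?thesis unfolding potential_def by (simp add: nn_integral_cmult)
  qed
  have ne: "AE y in lborel. x \<noteq> y" for x :: 'a
    using AE_lborel_singleton[of x] by (auto elim: eventually_mono)
  have Dint: "integrable lborel (D f x)" if [measurable]: "f \<in> borel_measurable borel" and "potential f x < \<infinity>" for f x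
  proof (rule integrableI_bounded)
    show "D f x \<in> borel_measurable lborel" unfolding D_def by measurable
    show "(\<integral>\<^sup>+y. ennreal (norm (D f x y)) \<partial>lborel) < \<infinity>"
      using that D0 DW[OF that(1)] by (simp add: ennreal_mult_less_top)
  qed
  have int: "integrable lborel (\<lambda>y. cis (lam * (x \<bullet> y)) * amp t s (x, y) * f y)"
    if s: "0 < s" "s \<le> 1" and f: "f \<in> borel_measurable borel" and "potential f x < \<infinity>" for lam t f x s
  proof (rule Bochner_Integration.integrable_bound[OF Dint[OF f that(4)]])
    show "AE y in lborel. norm (cis (lam * (x \<bullet> y)) * amp t s (x, y) * f y) \<le> norm (D f x y)"
      using ne[of x] by eventually_elim (use le[OF s] D0 in \<open>simp add: abs_of_nonneg\<close>)
  qed (use integrand_measurable[OF f] in simp)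
  have cont: "continuous_on {0<..1} (graph_op lam t f x)" if f: "f \<in> borel_measurable borel" and "potential f x < \<infinity>" for lam t f x
    unfolding continuous_on_sequentially
  proof (intro allI ballI impI)
    fix u :: "nat \<Rightarrow> real" and a assume a: "a \<in> {0<..1}" and u: "(\<forall>n. u n \<in> {0<..1}) \<and> u \<longlonglongrightarrow> a"
    have "(\<lambda>i. \<integral>y. cis (lam * (x \<bullet> y)) * amp t (u i) (x, y) * f y \<partial>lborel) \<longlonglongrightarrow> (\<integral>y. cis (lam * (x \<bullet> y)) * amp t a (x, y) * f y \<partial>lborel)"
    proof (rule integral_dominated_convergence[OF _ _ Dint[OF f that(2)]])
      show "AE y in lborel. (\<lambda>i. cis (lam * (x \<bullet> y)) * amp t (u i) (x, y) * f y) \<longlonglongrightarrow> cis (lam * (x \<bullet> y)) * amp t a (x, y) * f y"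
        using ne[of x]
      proof eventually_elim
        fix y assume "x \<noteq> y"
        then have "(\<lambda>i. amp t (u i) (x, y)) \<longlonglongrightarrow> amp t a (x, y)"
          using continuous_on_tendsto_compose[OF amp_continuous, of x y u a sequentially t] a u by auto
        then show "(\<lambda>i. cis (lam * (x \<bullet> y)) * amp t (u i) (x, y) * f y) \<longlonglongrightarrow> cis (lam * (x \<bullet> y)) * amp t a (x, y) * f y"
          by (intro tendsto_intros)
      qed
      show "AE y in lborel. norm (cis (lam * (x \<bullet> y)) * amp t (u i) (x, y) * f y) \<le> D f x y" for i
        using ne[of x] by eventually_elim (use le[of "u i"] u in auto)
    qed (use integrand_measurable[OF f] in simp_all)
    then show "(graph_op lam t f x \<circ> u) \<longlonglongrightarrow> graph_op lam t f x a" by (simp add: graph_op_def o_def)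
  qed
  have "ennreal (norm (graph_op lam t f x s)) \<le> ennreal C * potential f x"
    if s: "0 < s" "s \<le> 1" and f: "f \<in> borel_measurable borel" for lam t f x s
  proof -
    have "ennreal (norm (graph_op lam t f x s)) \<le> (\<integral>\<^sup>+y. ennreal (norm (cis (lam * (x \<bullet> y)) * amp t s (x, y) * f y)) \<partial>lborel)"
      unfolding graph_op_def by (rule norm_integral_le_nn_integral)
    also have "\<dots> \<le> (\<integral>\<^sup>+y. ennreal (D f x y) \<partial>lborel)"
      by (intro nn_integral_mono_AE eventually_mono[OF ne[of x]] ennreal_leI le[OF s])
    finally show ?thesis unfolding DW[OF f] .
  qed
  then show ?thesis using C(1) int cont by blast
qed

lemma potential_finite_AE:
  assumes f: "f \<in> borel_measurable borel" and fin: "energy f < \<infinity>"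
  shows "AE x in lborel. potential f x < \<infinity>"
proof -
  obtain C where C: "C \<ge> 0" "\<And>\<rho> g. \<rho> > 0 \<Longrightarrow> g \<in> borel_measurable borel \<Longrightarrow>
    (\<integral>\<^sup>+(x::'a). (\<integral>\<^sup>+y. (ennreal (norm (x - y) powr (m - DIM('a))) * indicator {z. norm z \<le> \<rho>} (x - y)) * g y \<partial>lborel)\<^sup>2 \<partial>lborel)
      \<le> ennreal (C * \<rho> powr (2 * m)) * (\<integral>\<^sup>+y. (g y)\<^sup>2 \<partial>lborel)"
    using riesz_local_bound[OF m] by blast
  note [measurable] = f
  have W_meas: "potential f \<in> borel_measurable borel" unfolding potential_def by measurable
  have "(\<integral>\<^sup>+x. (potential f x)\<^sup>2 \<partial>lborel) \<le> ennreal (C * (2 * R) powr (2 * m)) * energy f"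
    unfolding potential_def using R by (intro C(2)) auto
  also have "\<dots> < \<infinity>" using fin by (simp add: ennreal_mult_less_top)
  finally have "(\<integral>\<^sup>+x. (potential f x)\<^sup>2 \<partial>lborel) \<noteq> \<infinity>" by simp
  then have "AE x in lborel. (potential f x)\<^sup>2 \<noteq> \<infinity>" using W_meas by (intro nn_integral_PInf_AE) auto
  then show ?thesis by eventually_elim (auto simp: power2_eq_square ennreal_mult_eq_top_iff less_top)
qed

end

section \<open>Control of the supremum by an integral over the parameter\<close>

context profile_family
begin

text \<open>The operator with the amplitude differentiated in \<open>s\<close>, cut off from the diagonal by \<open>\<kappa>\<close>.\<close>

definition far_ds :: "real \<Rightarrow> real \<Rightarrow> ('a \<Rightarrow> real) \<Rightarrow> ('a \<Rightarrow> complex) \<Rightarrow> real \<Rightarrow> 'a \<Rightarrow> complex" where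
  "far_ds lam t \<kappa> f s x = (\<integral>y. cis (lam * (x \<bullet> y)) * (complex_of_real (\<kappa> (x - y)) * amp_deriv t s (x, y)) * f y \<partial>lborel)"

definition far :: "real \<Rightarrow> real \<Rightarrow> ('a \<Rightarrow> real) \<Rightarrow> ('a \<Rightarrow> complex) \<Rightarrow> real \<Rightarrow> 'a \<Rightarrow> complex" where
  "far lam t \<kappa> f s x = (\<integral>y. cis (lam * (x \<bullet> y)) * (complex_of_real (\<kappa> (x - y)) * amp t s (x, y)) * f y \<partial>lborel)"

lemma far_ds_integrand_measurable:
  assumes [measurable]: "f \<in> borel_measurable borel" "\<kappa> \<in> borel_measurable borel"
  shows "(\<lambda>p. cis (lam * (x \<bullet> snd p)) * (complex_of_real (\<kappa> (x - snd p)) * amp_deriv t (fst p) (x, snd p)) * f (snd p)) \<in> borel_measurable borel"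
    and "(\<lambda>q. cis (lam * (snd (fst q) \<bullet> snd q)) * (complex_of_real (\<kappa> (snd (fst q) - snd q)) * amp_deriv t (fst (fst q)) (snd (fst q), snd q)) * f (snd q)) \<in> borel_measurable borel"
proof -
  note cc = borel_measurable_compose_continuous
  have "(\<lambda>p. amp_deriv t (fst p) (x, snd p)) \<in> borel_measurable borel"
    using cc[OF amp_deriv_measurable, of "\<lambda>p. (fst p, (x, snd p))" t] by (simp add: continuous_intros)
  moreover have "(\<lambda>p::real \<times> 'a. cis (lam * (x \<bullet> snd p))) \<in> borel_measurable borel"
    by (rule cc[OF cis_measurable]) (intro continuous_intros)
  moreover have "(\<lambda>p::real \<times> 'a. complex_of_real (\<kappa> (x - snd p))) \<in> borel_measurable borel"
    by (intro measurable_compose[OF _ borel_measurable_of_real] cc[OF assms(2)] continuous_intros)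
  moreover have "(\<lambda>p::real \<times> 'a. f (snd p)) \<in> borel_measurable borel"
    by (intro cc[OF assms(1)] continuous_intros)
  ultimately show "(\<lambda>p. cis (lam * (x \<bullet> snd p)) * (complex_of_real (\<kappa> (x - snd p)) * amp_deriv t (fst p) (x, snd p)) * f (snd p)) \<in> borel_measurable borel"
    by (intro borel_measurable_times)
  have "(\<lambda>q. amp_deriv t (fst (fst q)) (snd (fst q), snd q)) \<in> borel_measurable borel"
    using cc[OF amp_deriv_measurable, of "\<lambda>q::(real \<times> 'a) \<times> 'a. (fst (fst q), (snd (fst q), snd q))" t] by (simp add: continuous_intros)
  moreover have "(\<lambda>q::(real \<times> 'a) \<times> 'a. cis (lam * (snd (fst q) \<bullet> snd q))) \<in> borel_measurable borel"
    by (rule cc[OF cis_measurable]) (intro continuous_intros)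
  moreover have "(\<lambda>q::(real \<times> 'a) \<times> 'a. complex_of_real (\<kappa> (snd (fst q) - snd q))) \<in> borel_measurable borel"
    by (intro measurable_compose[OF _ borel_measurable_of_real] cc[OF assms(2)] continuous_intros)
  moreover have "(\<lambda>q::(real \<times> 'a) \<times> 'a. f (snd q)) \<in> borel_measurable borel"
    by (intro cc[OF assms(1)] continuous_intros)
  ultimately show "(\<lambda>q. cis (lam * (snd (fst q) \<bullet> snd q)) * (complex_of_real (\<kappa> (snd (fst q) - snd q)) * amp_deriv t (fst (fst q)) (snd (fst q), snd q)) * f (snd q)) \<in> borel_measurable borel"
    by (intro borel_measurable_times)
qed

lemma far_ds_measurable:
  assumes "f \<in> borel_measurable borel" "\<kappa> \<in> borel_measurable borel"
  shows "(\<lambda>p. far_ds lam t \<kappa> f (fst p) (snd p)) \<in> borel_measurable borel"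
  unfolding far_ds_def
proof (rule lborel.borel_measurable_lebesgue_integral)
  have "sets (borel \<Otimes>\<^sub>M (lborel :: 'a measure)) = sets (borel :: ((real \<times> 'a) \<times> 'a) measure)"
    by (simp add: borel_prod[symmetric] cong: sets_pair_measure_cong)
  then have "borel_measurable (borel \<Otimes>\<^sub>M (lborel :: 'a measure)) = (borel_measurable (borel :: ((real \<times> 'a) \<times> 'a) measure) :: (_ \<Rightarrow> complex) set)"
    by (rule measurable_cong_sets) simp
  then show "(\<lambda>(p, y). cis (lam * (snd p \<bullet> y)) * (complex_of_real (\<kappa> (snd p - y)) * amp_deriv t (fst p) (snd p, y)) * f y) \<in> borel_measurable (borel \<Otimes>\<^sub>M lborel)"
    using far_ds_integrand_measurable(2)[OF assms] by (simp add: case_prod_beta')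
qed

text \<open>The fundamental theorem of calculus for the amplitude at each \<open>y\<close>, followed by an exchange of the
  integrals in \<open>s\<close> and \<open>y\<close>. The absolute value is taken only after the integration in \<open>y\<close>, which keeps
  the oscillation in \<open>y\<close>. The bound \<open>Q\<close> justifies the exchange.\<close>

lemma far_pointwise:
  assumes f: "f \<in> borel_measurable borel" and fin: "energy f < \<infinity>"
    and Wx: "potential f x < \<infinity>" and \<kappa>: "\<kappa> \<in> borel_measurable borel" "\<And>z. 0 \<le> \<kappa> z \<and> \<kappa> z \<le> 1" "\<kappa> 0 = 0"
    and Q: "Q \<ge> 0" "\<And>s y. 0 < s \<Longrightarrow> s \<le> 1 \<Longrightarrow> norm (complex_of_real (\<kappa> (x - y)) * amp_deriv t s (x, y)) \<le> Q * s powr - \<beta>"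
    and \<epsilon>: "0 < \<epsilon>" "\<epsilon> \<le> 1"
  shows "ennreal (norm (far lam t \<kappa> f \<epsilon> x)) \<le> ennreal (norm (far lam t \<kappa> f 1 x)) +
           (\<integral>\<^sup>+s. indicator {0<..1} s * ennreal (norm (far_ds lam t \<kappa> f s x)) \<partial>lborel)"
proof -
  define u where "u y = norm (f y) * indicator {y. norm y \<le> R} y" for y
  have u_int: "integrable lborel u" unfolding u_def by (rule integrable_L2_bounded_support[OF f fin])
  have u0: "u y \<ge> 0" for y by (simp add: u_def)
  define I where "I s y = cis (lam * (x \<bullet> y)) * (complex_of_real (\<kappa> (x - y)) * amp_deriv t s (x, y)) * f y" for s y
  define \<Phi> where "\<Phi> s y = indicator {\<epsilon>..1} s *\<^sub>R I s y" for s y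
  have I_meas: "(\<lambda>p. I (fst p) (snd p)) \<in> borel_measurable borel"
    unfolding I_def by (rule far_ds_integrand_measurable(1)[OF f \<kappa>(1)])
  have \<Phi>_meas: "case_prod \<Phi> \<in> borel_measurable (lborel \<Otimes>\<^sub>M lborel)"
  proof -
    have "(\<lambda>p::real \<times> 'a. indicator {\<epsilon>..1} (fst p) :: real) \<in> borel_measurable borel"
      by (rule borel_measurable_compose_continuous) (auto intro!: continuous_intros)
    from borel_measurable_scaleR[OF this I_meas] show ?thesis
      by (simp add: \<Phi>_def case_prod_beta' lborel_prod)
  qed
  have \<Phi>_bd: "norm (\<Phi> s y) \<le> indicator {\<epsilon>..1} s * ((Q * \<epsilon> powr - \<beta>) * u y)" for s y
  proof (cases "s \<in> {\<epsilon>..1} \<and> norm y \<le> R")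
    case True
    then have s: "0 < s" "s \<le> 1" "\<epsilon> \<le> s" using \<epsilon> by auto
    have "norm (complex_of_real (\<kappa> (x - y)) * amp_deriv t s (x, y)) \<le> Q * \<epsilon> powr - \<beta>"
      using Q(2)[OF s(1,2), of y] mult_left_mono[OF powr_mono2'[of "-\<beta>" \<epsilon> s] Q(1)] \<beta> \<epsilon> s by simp
    from mult_right_mono[OF this norm_ge_zero[of "f y"]] show ?thesis
      using True by (simp add: \<Phi>_def I_def u_def norm_mult)
  next
    case False
    then show ?thesis using amp_eq_0(2)[of x y t s] Q(1) u0[of y] by (auto simp: \<Phi>_def I_def)
  qed
  have \<Phi>_int: "integrable (lborel \<Otimes>\<^sub>M lborel) (case_prod \<Phi>)"
  proof (rule Bochner_Integration.integrable_bound)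
    show "integrable (lborel \<Otimes>\<^sub>M lborel) (\<lambda>p. indicator {\<epsilon>..1} (fst p) * ((Q * \<epsilon> powr - \<beta>) * u (snd p)))"
    proof (rule lborel_pair.Fubini_integrable)
      show "(\<lambda>p. indicator {\<epsilon>..1} (fst p) * ((Q * \<epsilon> powr - \<beta>) * u (snd p))) \<in> borel_measurable (lborel \<Otimes>\<^sub>M lborel)"
        using u_int by measurable
      show "AE s in lborel. integrable lborel (\<lambda>y. indicator {\<epsilon>..1} (fst (s, y)) * ((Q * \<epsilon> powr - \<beta>) * u (snd (s, y))))"
        using u_int by simp
      have "(\<lambda>s. \<integral>y. norm (indicator {\<epsilon>..1} (fst (s, y)) * ((Q * \<epsilon> powr - \<beta>) * u (snd (s, y)))) \<partial>lborel)
         = (\<lambda>s. indicator {\<epsilon>..1} s * ((Q * \<epsilon> powr - \<beta>) * (\<integral>y. u y \<partial>lborel)))"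
        using Q(1) u0 by (simp add: abs_mult)
      then show "integrable lborel (\<lambda>s. \<integral>y. norm (indicator {\<epsilon>..1} (fst (s, y)) * ((Q * \<epsilon> powr - \<beta>) * u (snd (s, y)))) \<partial>lborel)"
        using integrable_real_indicator[of "{\<epsilon>..1}" lborel] \<epsilon> by simp
    qed
    show "AE p in lborel \<Otimes>\<^sub>M lborel. norm (case_prod \<Phi> p) \<le> norm (indicator {\<epsilon>..1} (fst p) * ((Q * \<epsilon> powr - \<beta>) * u (snd p)))"
      using \<Phi>_bd Q(1) u0 by (auto simp: case_prod_beta abs_mult)
  qed (rule \<Phi>_meas)
  have int_s: "(\<integral>s. \<Phi> s y \<partial>lborel) = cis (lam * (x \<bullet> y)) * (complex_of_real (\<kappa> (x - y)) * amp t 1 (x, y)) * f y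
      - cis (lam * (x \<bullet> y)) * (complex_of_real (\<kappa> (x - y)) * amp t \<epsilon> (x, y)) * f y" for y
  proof (cases "x = y")
    case True
    (* On the diagonal the amplitude need not be differentiable in s, but the cutoff vanishes there. *)
    then have z: "complex_of_real (\<kappa> (x - y)) = 0" using \<kappa>(3) by simp
    show ?thesis
      unfolding \<Phi>_def I_def z
      by (simp only: mult_zero_left mult_zero_right scaleR_zero_right Bochner_Integration.integral_zero diff_self)
  next
    case False
    let ?c = "cis (lam * (x \<bullet> y)) * complex_of_real (\<kappa> (x - y)) * f y"
    have ftc: "(\<integral>s. indicator {\<epsilon>..1} s *\<^sub>R amp_deriv t s (x, y) \<partial>lborel) = amp t 1 (x, y) - amp t \<epsilon> (x, y)"
    proof (rule integral_FTC_Icc[OF \<epsilon>(2), where F = "\<lambda>s. amp t s (x, y)" and f = "\<lambda>s. amp_deriv t s (x, y)"])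
      show "((\<lambda>s. amp t s (x, y)) has_vector_derivative amp_deriv t s (x, y)) (at s within {\<epsilon>..1})" if "\<epsilon> \<le> s" "s \<le> 1" for s
      proof -
        have "0 < s" using that \<epsilon> by simp
        from amp_has_derivative[OF False this, of t] show ?thesis by (rule has_vector_derivative_at_within)
      qed
      show "continuous_on {\<epsilon>..1} (\<lambda>s. amp_deriv t s (x, y))"
        by (rule continuous_on_subset[OF amp_deriv_continuous[OF False]]) (use \<epsilon> in auto)
    qed
    have \<Phi>_eq: "\<Phi> s y = ?c * (indicator {\<epsilon>..1} s *\<^sub>R amp_deriv t s (x, y))" for s
      by (simp add: \<Phi>_def I_def)
    have "(\<integral>s. \<Phi> s y \<partial>lborel) = (\<integral>s. ?c * (indicator {\<epsilon>..1} s *\<^sub>R amp_deriv t s (x, y)) \<partial>lborel)"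
      by (simp only: \<Phi>_eq)
    also have "\<dots> = ?c * (\<integral>s. indicator {\<epsilon>..1} s *\<^sub>R amp_deriv t s (x, y) \<partial>lborel)"
      by (rule integral_mult_right_zero)
    also have "\<dots> = ?c * (amp t 1 (x, y) - amp t \<epsilon> (x, y))" by (simp only: ftc)
    finally show ?thesis by (simp add: algebra_simps)
  qed
  have far_int: "integrable lborel (\<lambda>y. cis (lam * (x \<bullet> y)) * (complex_of_real (\<kappa> (x - y)) * amp t s (x, y)) * f y)"
    if "0 < s" "s \<le> 1" for s
  proof (rule Bochner_Integration.integrable_bound)
    show "integrable lborel (\<lambda>y. cis (lam * (x \<bullet> y)) * amp t s (x, y) * f y)"
      using graph_op_le_potential that f Wx by blast
    have "(\<lambda>y. complex_of_real (\<kappa> (x - y))) \<in> borel_measurable borel"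
      by (intro measurable_compose[OF _ borel_measurable_of_real] borel_measurable_compose_continuous[OF \<kappa>(1)] continuous_intros)
    then show "(\<lambda>y. cis (lam * (x \<bullet> y)) * (complex_of_real (\<kappa> (x - y)) * amp t s (x, y)) * f y) \<in> borel_measurable lborel"
      using phase_measurable section_measurable[OF amp_measurable_fixed(1)] f by simp
    have "\<kappa> (x - y) * norm (amp t s (x, y)) * norm (f y) \<le> 1 * norm (amp t s (x, y)) * norm (f y)" for y
      using \<kappa>(2) by (intro mult_right_mono) auto
    then show "AE y in lborel. norm (cis (lam * (x \<bullet> y)) * (complex_of_real (\<kappa> (x - y)) * amp t s (x, y)) * f y) \<le> norm (cis (lam * (x \<bullet> y)) * amp t s (x, y) * f y)"
      using \<kappa>(2) by (simp add: norm_mult)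
  qed
  have "far lam t \<kappa> f 1 x - far lam t \<kappa> f \<epsilon> x = (\<integral>y. (\<integral>s. \<Phi> s y \<partial>lborel) \<partial>lborel)"
    unfolding far_def int_s using \<epsilon> by (intro Bochner_Integration.integral_diff[symmetric] far_int) auto
  also have "\<dots> = (\<integral>s. (\<integral>y. \<Phi> s y \<partial>lborel) \<partial>lborel)"
    by (rule lborel_pair.Fubini_integral[OF \<Phi>_int])
  also have "\<dots> = (\<integral>s. indicator {\<epsilon>..1} s *\<^sub>R far_ds lam t \<kappa> f s x \<partial>lborel)"
    unfolding \<Phi>_def I_def far_ds_def by simp
  finally have "far lam t \<kappa> f \<epsilon> x = far lam t \<kappa> f 1 x - (\<integral>s. indicator {\<epsilon>..1} s *\<^sub>R far_ds lam t \<kappa> f s x \<partial>lborel)"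
    by (simp only: diff_eq_eq eq_diff_eq add.commute)
  then have "norm (far lam t \<kappa> f \<epsilon> x) \<le> norm (far lam t \<kappa> f 1 x) + norm (\<integral>s. indicator {\<epsilon>..1} s *\<^sub>R far_ds lam t \<kappa> f s x \<partial>lborel)"
    by (simp add: norm_triangle_ineq4)
  then have "ennreal (norm (far lam t \<kappa> f \<epsilon> x)) \<le> ennreal (norm (far lam t \<kappa> f 1 x)) + ennreal (norm (\<integral>s. indicator {\<epsilon>..1} s *\<^sub>R far_ds lam t \<kappa> f s x \<partial>lborel))"
    by (simp add: ennreal_leI flip: ennreal_plus)
  also have "\<dots> \<le> ennreal (norm (far lam t \<kappa> f 1 x)) + (\<integral>\<^sup>+s. ennreal (norm (indicator {\<epsilon>..1} s *\<^sub>R far_ds lam t \<kappa> f s x)) \<partial>lborel)"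
    by (intro add_left_mono norm_integral_le_nn_integral)
  also have "\<dots> \<le> ennreal (norm (far lam t \<kappa> f 1 x)) + (\<integral>\<^sup>+s. indicator {0<..1} s * ennreal (norm (far_ds lam t \<kappa> f s x)) \<partial>lborel)"
    using \<epsilon> by (intro add_left_mono nn_integral_mono) (auto simp: indicator_def)
  finally show ?thesis .
qed

end

section \<open>The maximal estimate\<close>

context profile_family
begin

text \<open>The norm of an integral over \<open>s\<close>, by the Cauchy--Schwarz inequality with the weights
  \<open>s powr (\<plusminus> \<beta> / 2)\<close>. Both factors are controlled by the integral of \<open>s powr -\<beta>\<close>.\<close>

lemma integral_in_s_bound:
  fixes g :: "real \<Rightarrow> 'a \<Rightarrow> ennreal"
  assumes g [measurable]: "(\<lambda>p. g (fst p) (snd p)) \<in> borel_measurable borel"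
    and le: "\<And>s. 0 < s \<Longrightarrow> s \<le> 1 \<Longrightarrow> (\<integral>\<^sup>+x. (g s x)\<^sup>2 \<partial>lborel) \<le> ennreal ((s powr - \<beta>)\<^sup>2) * D"
  shows "(\<integral>\<^sup>+x. (\<integral>\<^sup>+s. indicator {0<..1} s * g s x \<partial>lborel)\<^sup>2 \<partial>lborel) \<le> ennreal ((2 / (1 - \<beta>))\<^sup>2) * D"
proof -
  let ?i = "indicator {0<..1} :: real \<Rightarrow> ennreal"
  have [measurable]: "(\<lambda>s. g s x) \<in> borel_measurable borel" for x
    using borel_measurable_compose_continuous[OF g, of "\<lambda>s. (s, x)"] by (simp add: continuous_intros)
  have [measurable]: "(\<lambda>x. g s x) \<in> borel_measurable borel" for s
    using borel_measurable_compose_continuous[OF g, of "\<lambda>x. (s, x)"] by (simp add: continuous_intros)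
  have [measurable]: "(\<lambda>p::'a \<times> real. g (snd p) (fst p)) \<in> borel_measurable (lborel \<Otimes>\<^sub>M lborel)"
    using borel_measurable_compose_continuous[OF g, of "\<lambda>p. (snd p, fst p)"] by (simp add: lborel_prod continuous_intros)
  define I where "I = (\<integral>\<^sup>+s. ?i s * ennreal (s powr - \<beta>) \<partial>lborel)"
  have I: "I \<le> ennreal (2 / (1 - \<beta>))"
  proof -
    have "I \<le> (\<integral>\<^sup>+s. ennreal (\<bar>s\<bar> powr - \<beta>) * indicator {-1..1} s \<partial>lborel)"
      unfolding I_def by (intro nn_integral_mono) (auto simp: indicator_def)
    also have "\<dots> \<le> ennreal (2 / (1 - \<beta>) * 1 powr (1 - \<beta>))" by (rule nn_integral_powr_near_0) (use \<beta> in auto)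
    finally show ?thesis by simp
  qed
  have split: "?i s * g s x = (?i s * ennreal (s powr (- \<beta> / 2))) * (?i s * ennreal (s powr (\<beta> / 2)) * g s x)" for s x
  proof (cases "s \<in> {0<..1}")
    case True
    then have "ennreal (s powr (- \<beta> / 2)) * ennreal (s powr (\<beta> / 2)) = 1"
      by (simp flip: ennreal_mult powr_add)
    then show ?thesis using True by (simp flip: mult.assoc)
  qed simp
  have sq: "(?i s * ennreal (s powr (- \<beta> / 2)))\<^sup>2 = ?i s * ennreal (s powr - \<beta>)"
    "(?i s * ennreal (s powr (\<beta> / 2)) * g s x)\<^sup>2 = ?i s * ennreal (s powr \<beta>) * (g s x)\<^sup>2" for s x
  proof -
    have p: "(s powr a)\<^sup>2 = s powr (2 * a)" for a by (simp add: power2_eq_square flip: powr_add)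
    show "(?i s * ennreal (s powr (- \<beta> / 2)))\<^sup>2 = ?i s * ennreal (s powr - \<beta>)"
      "(?i s * ennreal (s powr (\<beta> / 2)) * g s x)\<^sup>2 = ?i s * ennreal (s powr \<beta>) * (g s x)\<^sup>2"
      by (cases "s \<in> {0<..1}"; simp add: power_mult_distrib ennreal_power p)+
  qed
  have "(\<integral>\<^sup>+s. ?i s * g s x \<partial>lborel)\<^sup>2 \<le> I * (\<integral>\<^sup>+s. ?i s * ennreal (s powr \<beta>) * (g s x)\<^sup>2 \<partial>lborel)" for x
    unfolding split[of _ x] I_def sq[symmetric] by (rule Cauchy_Schwarz_nn_integral) measurable
  then have "(\<integral>\<^sup>+x. (\<integral>\<^sup>+s. ?i s * g s x \<partial>lborel)\<^sup>2 \<partial>lborel)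
      \<le> (\<integral>\<^sup>+x. I * (\<integral>\<^sup>+s. ?i s * ennreal (s powr \<beta>) * (g s x)\<^sup>2 \<partial>lborel) \<partial>lborel)"
    by (intro nn_integral_mono)
  also have "\<dots> = I * (\<integral>\<^sup>+x. \<integral>\<^sup>+s. ?i s * ennreal (s powr \<beta>) * (g s x)\<^sup>2 \<partial>lborel \<partial>lborel)"
  proof (rule nn_integral_cmult, rule lborel.borel_measurable_nn_integral)
    show "(\<lambda>(x, s). ?i s * ennreal (s powr \<beta>) * (g s x)\<^sup>2) \<in> borel_measurable (lborel \<Otimes>\<^sub>M lborel)"
      unfolding case_prod_beta' by measurable
  qed
  also have "(\<integral>\<^sup>+x. \<integral>\<^sup>+s. ?i s * ennreal (s powr \<beta>) * (g s x)\<^sup>2 \<partial>lborel \<partial>lborel)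
      = (\<integral>\<^sup>+s. \<integral>\<^sup>+x. ?i s * ennreal (s powr \<beta>) * (g s x)\<^sup>2 \<partial>lborel \<partial>lborel)"
  proof (rule lborel_pair.Fubini'[symmetric])
    show "(\<lambda>(x, s). ?i s * ennreal (s powr \<beta>) * (g s x)\<^sup>2) \<in> borel_measurable (lborel \<Otimes>\<^sub>M lborel)"
      unfolding case_prod_beta' by measurable
  qed
  also have "\<dots> = (\<integral>\<^sup>+s. ?i s * ennreal (s powr \<beta>) * (\<integral>\<^sup>+x. (g s x)\<^sup>2 \<partial>lborel) \<partial>lborel)"
    by (simp add: nn_integral_cmult)
  also have "\<dots> \<le> (\<integral>\<^sup>+s. (?i s * ennreal (s powr - \<beta>)) * D \<partial>lborel)"
  proof (rule nn_integral_mono)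
    fix s :: real
    show "?i s * ennreal (s powr \<beta>) * (\<integral>\<^sup>+x. (g s x)\<^sup>2 \<partial>lborel) \<le> (?i s * ennreal (s powr - \<beta>)) * D"
    proof (cases "s \<in> {0<..1}")
      case True
      have "ennreal (s powr \<beta>) * (\<integral>\<^sup>+x. (g s x)\<^sup>2 \<partial>lborel) \<le> ennreal (s powr \<beta>) * (ennreal ((s powr - \<beta>)\<^sup>2) * D)"
        using le[of s] True by (intro mult_left_mono) auto
      also have "\<dots> = ennreal (s powr - \<beta>) * D"
      proof -
        have "s powr \<beta> * (s powr - \<beta>)\<^sup>2 = s powr - \<beta>" by (simp add: power2_eq_square flip: powr_add)
        then have "ennreal (s powr \<beta>) * ennreal ((s powr - \<beta>)\<^sup>2) = ennreal (s powr - \<beta>)"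
          by (simp flip: ennreal_mult)
        then show ?thesis by (simp flip: mult.assoc)
      qed
      finally show ?thesis using True by simp
    qed simp
  qed
  also have "\<dots> = I * D" unfolding I_def by (rule nn_integral_multc) measurable
  also have "I * (I * D) \<le> ennreal (2 / (1 - \<beta>)) * (ennreal (2 / (1 - \<beta>)) * D)"
    by (intro mult_mono I) auto
  also have "\<dots> = ennreal ((2 / (1 - \<beta>))\<^sup>2) * D"
  proof -
    have "0 \<le> 2 / (1 - \<beta>)" using \<beta> by simp
    from ennreal_mult[OF this this] show ?thesis by (simp only: power2_eq_square mult.assoc)
  qed
  finally show ?thesis by (simp add: mult_left_mono)
qed

text \<open>The three terms are the part near the diagonal, the part away from it at \<open>s = 1\<close>, and the integral of
  its \<open>s\<close>-derivative.\<close>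

lemma maximal_bound_large:
  "\<exists>C\<ge>0. \<forall>lam\<ge>1. \<forall>t. \<forall>f r. r = lam powr (- (real DIM('a) / (2 * (real DIM('a) + 2)))) \<longrightarrow> f \<in> borel_measurable borel \<longrightarrow>
     energy f < \<infinity> \<longrightarrow>
     (\<integral>\<^sup>+x. (SUP s\<in>{0<..1}. ennreal (norm (graph_op lam t f x s)))\<^sup>2 \<partial>lborel)
       \<le> ennreal (C * r powr (2 * m)) * energy f"
proof -
  let ?n = "real DIM('a)" and ?N = "DIM('a) + 1"
  obtain C\<eta> where C\<eta>: "C\<eta> \<ge> 1" "\<And>r. r > 0 \<Longrightarrow> \<exists>\<eta>::'a \<Rightarrow> real. \<eta> \<in> borel_measurable borel \<and> (\<forall>z. 0 \<le> \<eta> z \<and> \<eta> z \<le> 1) \<and>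
     (\<forall>z. norm z \<le> r \<longrightarrow> \<eta> z = 1) \<and> (\<forall>z. norm z > C\<eta> * r \<longrightarrow> \<eta> z = 0) \<and>
     (\<forall>b\<in>Basis. \<forall>y. offdiag_symbol b ?N y (\<lambda>_. C\<eta>) (\<lambda>x. complex_of_real (1 - \<eta> (x - y))))"
    using cutoff_exists[where 'a='a, of ?N] by blast
  have C\<eta>0: "C\<eta> \<ge> 0" using C\<eta>(1) by simp
  obtain Cc where Cc: "Cc \<ge> 0" "\<forall>b\<in>Basis. \<forall>t s y \<kappa>. 0 < s \<longrightarrow> s \<le> 1 \<longrightarrow>
     offdiag_symbol b ?N y (\<lambda>_. C\<eta>) \<kappa> \<longrightarrow>
     offdiag_symbol b ?N y (\<lambda>x. Cc * norm (x - y) powr (m - DIM('a) - 1)) (\<lambda>x. \<kappa> x * amp t s (x, y)) \<and>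
     offdiag_symbol b ?N y (\<lambda>x. (Cc * s powr - \<beta>) * norm (x - y) powr (m - DIM('a) - 1)) (\<lambda>x. \<kappa> x * amp_deriv t s (x, y))"
    using cut_amp_dsymbol[OF C\<eta>0, of ?N] by blast
  obtain Co where Co: "Co \<ge> 0" "\<forall>lam\<ge>1. \<forall>M\<ge>0. \<forall>(A::'a \<times> 'a \<Rightarrow> complex) (f::'a \<Rightarrow> complex) r.
     r = lam powr (- (real DIM('a) / (2 * (real DIM('a) + 2)))) \<longrightarrow>
     A \<in> borel_measurable borel \<longrightarrow> f \<in> borel_measurable borel \<longrightarrow>
     energy f < \<infinity> \<longrightarrow>
     (\<forall>x y. R < norm x \<or> R < norm y \<or> norm (x - y) < 1 * r \<longrightarrow> A (x, y) = 0) \<longrightarrow>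
     (\<forall>b\<in>Basis. \<forall>y. offdiag_symbol b (DIM('a) + 1) y (\<lambda>x. M * norm (x - y) powr (m - DIM('a) - 1)) (\<lambda>x. A (x, y))) \<longrightarrow>
     energy (\<lambda>x. \<integral>y. cis (lam * (x \<bullet> y)) * A (x, y) * f y \<partial>lborel)
       \<le> ennreal (Co * M\<^sup>2 * r powr (2 * m)) * energy f"
    using oscillatory_operator_bound[OF m R zero_less_one] by blast
  obtain C0 where C0: "C0 \<ge> 0" "\<And>t s x y. 0 < s \<Longrightarrow> s \<le> 1 \<Longrightarrow> x \<noteq> y \<Longrightarrow>
    norm (amp t s (x, y)) \<le> C0 * norm (x - y) powr (m - DIM('a)) * indicator {z. norm z \<le> 2 * R} (x - y)"
    using amp_size by blast
  obtain Cr where Cr: "Cr \<ge> 0" "\<And>\<rho> g. \<rho> > 0 \<Longrightarrow> g \<in> borel_measurable borel \<Longrightarrow>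
    (\<integral>\<^sup>+(x::'a). (\<integral>\<^sup>+y. (ennreal (norm (x - y) powr (m - DIM('a))) * indicator {z. norm z \<le> \<rho>} (x - y)) * g y \<partial>lborel)\<^sup>2 \<partial>lborel)
      \<le> ennreal (Cr * \<rho> powr (2 * m)) * (\<integral>\<^sup>+y. (g y)\<^sup>2 \<partial>lborel)"
    using riesz_local_bound[OF m] by blast
  define C1 where "C1 = C0\<^sup>2 * Cr * C\<eta> powr (2 * m)"
  define C2 where "C2 = Co * Cc\<^sup>2"
  define C3 where "C3 = (2 / (1 - \<beta>))\<^sup>2 * (Co * Cc\<^sup>2)"
  define C where "C = 3 * (C1 + C2 + C3)"
  have nn: "C1 \<ge> 0" "C2 \<ge> 0" "C3 \<ge> 0" using C0 Cr Co by (simp_all add: C1_def C2_def C3_def)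
  have "(\<integral>\<^sup>+x. (SUP s\<in>{0<..1}. ennreal (norm (graph_op lam t f x s)))\<^sup>2 \<partial>lborel)
       \<le> ennreal (C * r powr (2 * m)) * energy f"
    if lam: "lam \<ge> 1" and r_def: "r = lam powr (- (real DIM('a) / (2 * (real DIM('a) + 2))))"
      and f: "f \<in> borel_measurable borel" and fin: "energy f < \<infinity>" for lam t f r
  proof -
    let ?E = "\<integral>\<^sup>+y. (ennreal (norm (f y)))\<^sup>2 \<partial>lborel"
    have r: "r > 0" using lam by (simp add: r_def)
    note [measurable] = f
    obtain \<eta> :: "'a \<Rightarrow> real" where \<eta>: "\<eta> \<in> borel_measurable borel" "\<And>z. 0 \<le> \<eta> z \<and> \<eta> z \<le> 1"
      "\<And>z. norm z \<le> r \<Longrightarrow> \<eta> z = 1" "\<And>z. norm z > C\<eta> * r \<Longrightarrow> \<eta> z = 0"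
      "\<And>b y. b \<in> Basis \<Longrightarrow> offdiag_symbol b ?N y (\<lambda>_. C\<eta>) (\<lambda>x. complex_of_real (1 - \<eta> (x - y)))"
      using C\<eta>(2)[OF r] by blast
    define \<kappa> where "\<kappa> z = 1 - \<eta> z" for z
    have \<kappa>_meas: "\<kappa> \<in> borel_measurable borel" unfolding \<kappa>_def using \<eta>(1) by measurable
    have \<kappa>01: "0 \<le> \<kappa> z \<and> \<kappa> z \<le> 1" for z using \<eta>(2)[of z] by (simp add: \<kappa>_def)
    have \<kappa>0: "\<kappa> z = 0" if "norm z \<le> r" for z using \<eta>(3)[OF that] by (simp add: \<kappa>_def)
    have sym: "offdiag_symbol b ?N y (\<lambda>x. Cc * norm (x - y) powr (m - DIM('a) - 1)) (\<lambda>x. complex_of_real (\<kappa> (x - y)) * amp t s (x, y))"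
      "offdiag_symbol b ?N y (\<lambda>x. (Cc * s powr - \<beta>) * norm (x - y) powr (m - DIM('a) - 1)) (\<lambda>x. complex_of_real (\<kappa> (x - y)) * amp_deriv t s (x, y))"
      if "b \<in> Basis" "0 < s" "s \<le> 1" for b s y
      using Cc(2)[rule_format, OF that(1,2,3) \<eta>(5)[OF that(1)], where t = t] by (simp_all add: \<kappa>_def)
    have \<kappa>_pair: "(\<lambda>p::'a \<times> 'a. complex_of_real (\<kappa> (fst p - snd p))) \<in> borel_measurable borel"
      by (intro measurable_compose[OF _ borel_measurable_of_real] borel_measurable_compose_continuous[OF \<kappa>_meas] continuous_intros)
    have far1: "energy (far lam t \<kappa> f 1) \<le> ennreal (C2 * r powr (2 * m)) * ?E"
    proof -
      define A where "A p = complex_of_real (\<kappa> (fst p - snd p)) * amp t 1 p" for p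
      have "energy (\<lambda>x. \<integral>y. cis (lam * (x \<bullet> y)) * A (x, y) * f y \<partial>lborel)
          \<le> ennreal (Co * Cc\<^sup>2 * r powr (2 * m)) * ?E"
      proof (rule Co(2)[rule_format, OF lam Cc(1) r_def _ f fin])
        show "A \<in> borel_measurable borel" unfolding A_def
          by (intro borel_measurable_times \<kappa>_pair amp_measurable_fixed)
        show "A (x, y) = 0" if "R < norm x \<or> R < norm y \<or> norm (x - y) < 1 * r" for x y
          using that amp_eq_0(1)[of x y t 1] \<kappa>0[of "x - y"] by (auto simp: A_def)
        show "offdiag_symbol b ?N y (\<lambda>x. Cc * norm (x - y) powr (m - DIM('a) - 1)) (\<lambda>x. A (x, y))" if "b \<in> Basis" for b y
          using sym(1)[OF that, of 1 y] by (simp add: A_def)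
      qed
      then show ?thesis by (simp add: A_def far_def C2_def)
    qed
    have G: "energy (far_ds lam t \<kappa> f s) \<le> ennreal ((s powr - \<beta>)\<^sup>2) * (ennreal (Co * Cc\<^sup>2 * r powr (2 * m)) * ?E)"
      if s: "0 < s" "s \<le> 1" for s
    proof -
      define A where "A p = complex_of_real (\<kappa> (fst p - snd p)) * amp_deriv t s p" for p
      have M0: "0 \<le> Cc * s powr - \<beta>" using Cc(1) by simp
      have "energy (\<lambda>x. \<integral>y. cis (lam * (x \<bullet> y)) * A (x, y) * f y \<partial>lborel)
          \<le> ennreal (Co * (Cc * s powr - \<beta>)\<^sup>2 * r powr (2 * m)) * ?E"
      proof (rule Co(2)[rule_format, OF lam M0 r_def _ f fin])
        show "A \<in> borel_measurable borel" unfolding A_def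
          by (intro borel_measurable_times \<kappa>_pair amp_measurable_fixed)
        show "A (x, y) = 0" if "R < norm x \<or> R < norm y \<or> norm (x - y) < 1 * r" for x y
          using that amp_eq_0(2)[of x y t s] \<kappa>0[of "x - y"] by (auto simp: A_def)
        show "offdiag_symbol b ?N y (\<lambda>x. (Cc * s powr - \<beta>) * norm (x - y) powr (m - DIM('a) - 1)) (\<lambda>x. A (x, y))" if "b \<in> Basis" for b y
          using sym(2)[OF that s, of y] by (simp add: A_def)
      qed
      also have "ennreal (Co * (Cc * s powr - \<beta>)\<^sup>2 * r powr (2 * m)) = ennreal ((s powr - \<beta>)\<^sup>2) * ennreal (Co * Cc\<^sup>2 * r powr (2 * m))"
        using Co(1) by (simp add: power_mult_distrib mult_ac flip: ennreal_mult)
      finally show ?thesis by (simp add: A_def far_ds_def mult.assoc)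
    qed
    define T where "T x = (\<integral>\<^sup>+s. indicator {0<..1} s * ennreal (norm (far_ds lam t \<kappa> f s x)) \<partial>lborel)" for x
    have G_meas: "(\<lambda>p. ennreal (norm (far_ds lam t \<kappa> f (fst p) (snd p)))) \<in> borel_measurable borel"
      using far_ds_measurable[OF f \<kappa>_meas, of lam t] by measurable
    have T_meas: "T \<in> borel_measurable borel"
      unfolding T_def
    proof (rule lborel.borel_measurable_nn_integral[of _ lborel, simplified])
      have [measurable]: "(\<lambda>p::'a \<times> real. ennreal (norm (far_ds lam t \<kappa> f (snd p) (fst p)))) \<in> borel_measurable (lborel \<Otimes>\<^sub>M lborel)"
        using borel_measurable_compose_continuous[OF G_meas, of "\<lambda>p. (snd p, fst p)"] by (simp add: lborel_prod continuous_intros)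
      show "(\<lambda>(x, s). indicator {0<..1} s * ennreal (norm (far_ds lam t \<kappa> f s x))) \<in> borel_measurable (lborel \<Otimes>\<^sub>M lborel)"
        unfolding case_prod_beta' by measurable
    qed
    have T2: "(\<integral>\<^sup>+x. (T x)\<^sup>2 \<partial>lborel) \<le> ennreal (C3 * r powr (2 * m)) * ?E"
    proof -
      have "(\<integral>\<^sup>+x. (T x)\<^sup>2 \<partial>lborel) \<le> ennreal ((2 / (1 - \<beta>))\<^sup>2) * (ennreal (Co * Cc\<^sup>2 * r powr (2 * m)) * ?E)"
        unfolding T_def by (rule integral_in_s_bound[OF G_meas G])
      also have "\<dots> = ennreal (C3 * r powr (2 * m)) * ?E"
      proof -
        have X: "0 \<le> Co * Cc\<^sup>2 * r powr (2 * m)" using Co(1) by simp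
        have "C3 * r powr (2 * m) = (2 / (1 - \<beta>))\<^sup>2 * (Co * Cc\<^sup>2 * r powr (2 * m))"
          by (simp add: C3_def)
        then have "ennreal (C3 * r powr (2 * m)) = ennreal ((2 / (1 - \<beta>))\<^sup>2) * ennreal (Co * Cc\<^sup>2 * r powr (2 * m))"
          using ennreal_mult[OF zero_le_power2 X] by (simp only:)
        then show ?thesis by (simp only: mult.assoc)
      qed
      finally show ?thesis .
    qed
    define P where "P x = ennreal C0 * (\<integral>\<^sup>+y. (ennreal (norm (x - y) powr (m - DIM('a))) * indicator {z. norm z \<le> C\<eta> * r} (x - y)) * ennreal (norm (f y)) \<partial>lborel)" for x
    have P_meas: "P \<in> borel_measurable borel" unfolding P_def using f by measurable
    have P2: "(\<integral>\<^sup>+x. (P x)\<^sup>2 \<partial>lborel) \<le> ennreal (C1 * r powr (2 * m)) * ?E"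
    proof -
      let ?w = "\<lambda>x. \<integral>\<^sup>+y. (ennreal (norm (x - y) powr (m - DIM('a))) * indicator {z. norm z \<le> C\<eta> * r} (x - y)) * ennreal (norm (f y)) \<partial>lborel"
      have "(\<integral>\<^sup>+x. (P x)\<^sup>2 \<partial>lborel) = (ennreal C0)\<^sup>2 * (\<integral>\<^sup>+x. (?w x)\<^sup>2 \<partial>lborel)"
        unfolding P_def power_mult_distrib using f by (intro nn_integral_cmult) measurable
      also have "\<dots> \<le> (ennreal C0)\<^sup>2 * (ennreal (Cr * (C\<eta> * r) powr (2 * m)) * ?E)"
        using f r C\<eta>(1) by (intro mult_left_mono Cr(2)) auto
      also have "\<dots> = ennreal (C1 * r powr (2 * m)) * ?E"
      proof -
        have X: "0 \<le> Cr * (C\<eta> * r) powr (2 * m)" using Cr(1) by simp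
        have "C1 * r powr (2 * m) = C0\<^sup>2 * (Cr * (C\<eta> * r) powr (2 * m))"
          using r C\<eta>0 by (simp add: C1_def powr_mult)
        then have "ennreal (C1 * r powr (2 * m)) = (ennreal C0)\<^sup>2 * ennreal (Cr * (C\<eta> * r) powr (2 * m))"
          using ennreal_mult[OF zero_le_power2[of C0] X] ennreal_power[OF C0(1), of 2] by (simp only:)
        then show ?thesis by (simp only: mult.assoc)
      qed
      finally show ?thesis .
    qed
    have far_meas: "(\<lambda>x. far lam t \<kappa> f 1 x) \<in> borel_measurable borel"
    proof -
      have "(\<lambda>p. cis (lam * (fst p \<bullet> snd p)) * (complex_of_real (\<kappa> (fst p - snd p)) * amp t 1 p) * f (snd p)) \<in> borel_measurable borel"
        by (intro borel_measurable_times \<kappa>_pair amp_measurable_fixed borel_measurable_compose_continuous[OF f]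
              borel_measurable_compose_continuous[OF cis_measurable] continuous_intros)
      then show ?thesis unfolding far_def
        by (intro lborel.borel_measurable_lebesgue_integral[of _ lborel, simplified]) (simp add: lborel_prod case_prod_beta')
    qed
    have pointwise: "AE x in lborel. (SUP s\<in>{0<..1}. ennreal (norm (graph_op lam t f x s))) \<le> P x + ennreal (norm (far lam t \<kappa> f 1 x)) + T x"
      using potential_finite_AE[OF f fin]
    proof eventually_elim
      fix x assume Wx: "potential f x < \<infinity>"
      show "(SUP s\<in>{0<..1}. ennreal (norm (graph_op lam t f x s))) \<le> P x + ennreal (norm (far lam t \<kappa> f 1 x)) + T x"
      proof (rule SUP_least)
        fix s :: real assume "s \<in> {0<..1}"
        then have s: "0 < s" "s \<le> 1" by auto
        let ?I = "\<lambda>y. cis (lam * (x \<bullet> y)) * amp t s (x, y) * f y"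
        have int: "integrable lborel ?I" using graph_op_le_potential s f Wx by blast
        have near_int: "integrable lborel (\<lambda>y. complex_of_real (\<eta> (x - y)) * ?I y)"
        proof (rule Bochner_Integration.integrable_bound[OF int])
          show "(\<lambda>y. complex_of_real (\<eta> (x - y)) * ?I y) \<in> borel_measurable lborel"
          proof -
            have "(\<lambda>y. complex_of_real (\<eta> (x - y))) \<in> borel_measurable borel"
              by (intro measurable_compose[OF _ borel_measurable_of_real] borel_measurable_compose_continuous[OF \<eta>(1)] continuous_intros)
            then show ?thesis using integrand_measurable[OF f, of lam x t s] by simp
          qed
          show "AE y in lborel. norm (complex_of_real (\<eta> (x - y)) * ?I y) \<le> norm (?I y)"
            using \<eta>(2) by (auto simp: norm_mult intro!: mult_left_le_one_le)
        qed
        have eq: "cis (lam * (x \<bullet> y)) * (complex_of_real (\<kappa> (x - y)) * amp t s (x, y)) * f y = ?I y - complex_of_real (\<eta> (x - y)) * ?I y" for y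
          by (simp add: \<kappa>_def algebra_simps)
        have "far lam t \<kappa> f s x = graph_op lam t f x s - (\<integral>y. complex_of_real (\<eta> (x - y)) * ?I y \<partial>lborel)"
          unfolding far_def graph_op_def eq by (rule Bochner_Integration.integral_diff[OF int near_int])
        then have "graph_op lam t f x s = (\<integral>y. complex_of_real (\<eta> (x - y)) * ?I y \<partial>lborel) + far lam t \<kappa> f s x" by simp
        then have "ennreal (norm (graph_op lam t f x s)) \<le> ennreal (norm (\<integral>y. complex_of_real (\<eta> (x - y)) * ?I y \<partial>lborel)) + ennreal (norm (far lam t \<kappa> f s x))"
          by (simp add: ennreal_leI norm_triangle_ineq flip: ennreal_plus)
        also have "\<dots> \<le> P x + (ennreal (norm (far lam t \<kappa> f 1 x)) + T x)"
        proof (rule add_mono)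
          have "ennreal (norm (\<integral>y. complex_of_real (\<eta> (x - y)) * ?I y \<partial>lborel)) \<le> (\<integral>\<^sup>+y. ennreal (norm (complex_of_real (\<eta> (x - y)) * ?I y)) \<partial>lborel)"
            by (rule norm_integral_le_nn_integral)
          also have "\<dots> \<le> (\<integral>\<^sup>+y. ennreal C0 * ((ennreal (norm (x - y) powr (m - DIM('a))) * indicator {z. norm z \<le> C\<eta> * r} (x - y)) * ennreal (norm (f y))) \<partial>lborel)"
          proof (rule nn_integral_mono_AE[OF eventually_mono[OF AE_lborel_singleton[of x]]])
            fix y assume "y \<noteq> x"
            show "ennreal (norm (complex_of_real (\<eta> (x - y)) * ?I y)) \<le> ennreal C0 * ((ennreal (norm (x - y) powr (m - DIM('a))) * indicator {z. norm z \<le> C\<eta> * r} (x - y)) * ennreal (norm (f y)))"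
            proof (cases "norm (x - y) \<le> C\<eta> * r")
              case True
              have "norm (amp t s (x, y)) \<le> C0 * norm (x - y) powr (m - DIM('a)) * indicator {z. norm z \<le> 2 * R} (x - y)"
                using C0(2)[OF s, of x y t] \<open>y \<noteq> x\<close> by auto
              also have "\<dots> \<le> C0 * norm (x - y) powr (m - DIM('a))" using C0(1) by (simp add: indicator_def)
              finally have "\<eta> (x - y) * (norm (amp t s (x, y)) * norm (f y)) \<le> 1 * ((C0 * norm (x - y) powr (m - DIM('a))) * norm (f y))"
                using \<eta>(2)[of "x - y"] by (intro mult_mono mult_right_mono) auto
              then have "norm (complex_of_real (\<eta> (x - y)) * ?I y) \<le> C0 * (norm (x - y) powr (m - DIM('a)) * norm (f y))"
                using \<eta>(2)[of "x - y"] by (simp add: norm_mult mult.assoc)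
              then show ?thesis using True C0(1) by (simp add: ennreal_leI flip: ennreal_mult)
            next
              case False
              then show ?thesis using \<eta>(4)[of "x - y"] by simp
            qed
          qed
          also have "\<dots> = P x" unfolding P_def using f by (intro nn_integral_cmult) measurable
          finally show "ennreal (norm (\<integral>y. complex_of_real (\<eta> (x - y)) * ?I y \<partial>lborel)) \<le> P x" .
          show "ennreal (norm (far lam t \<kappa> f s x)) \<le> ennreal (norm (far lam t \<kappa> f 1 x)) + T x"
            unfolding T_def
          proof (rule far_pointwise[OF f fin Wx \<kappa>_meas \<kappa>01 _ _ _ s, where Q = "Cc * r powr (m - DIM('a) - 1)"])
            show "\<kappa> 0 = 0" using \<kappa>0[of 0] r by simp
            show "0 \<le> Cc * r powr (m - DIM('a) - 1)" using Cc(1) by simp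
            fix s' :: real and y assume s': "0 < s'" "s' \<le> 1"
            show "norm (complex_of_real (\<kappa> (x - y)) * amp_deriv t s' (x, y)) \<le> Cc * r powr (m - DIM('a) - 1) * s' powr - \<beta>"
            proof (cases "norm (x - y) \<le> r")
              case True then show ?thesis using \<kappa>0[OF True] Cc(1) by simp
            next
              case False
              obtain b where b: "b \<in> (Basis :: 'a set)" using nonempty_Basis by blast
              have "norm (complex_of_real (\<kappa> (x - y)) * amp_deriv t s' (x, y)) \<le> (Cc * s' powr - \<beta>) * norm (x - y) powr (m - DIM('a) - 1)"
              proof (rule dsymbol_bound[OF sym(2)[OF b s', of y]])
                show "x \<in> UNIV - {y}" using False r by auto
              qed
              also have "\<dots> \<le> (Cc * s' powr - \<beta>) * r powr (m - DIM('a) - 1)"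
                using False r m Cc(1) by (intro mult_left_mono powr_mono2') auto
              finally show ?thesis by (simp add: mult_ac)
            qed
          qed
        qed
        finally show "ennreal (norm (graph_op lam t f x s)) \<le> P x + ennreal (norm (far lam t \<kappa> f 1 x)) + T x" by (simp add: add.assoc)
      qed
    qed
    have "(\<integral>\<^sup>+x. (SUP s\<in>{0<..1}. ennreal (norm (graph_op lam t f x s)))\<^sup>2 \<partial>lborel)
        \<le> (\<integral>\<^sup>+x. 3 * ((P x)\<^sup>2 + (ennreal (norm (far lam t \<kappa> f 1 x)))\<^sup>2 + (T x)\<^sup>2) \<partial>lborel)"
      by (rule nn_integral_mono_AE[OF eventually_mono[OF pointwise]])
         (rule order_trans[OF power_mono_ennreal ennreal_sum3_power2_le])
    also have "\<dots> = 3 * ((\<integral>\<^sup>+x. (P x)\<^sup>2 \<partial>lborel) + energy (far lam t \<kappa> f 1) + (\<integral>\<^sup>+x. (T x)\<^sup>2 \<partial>lborel))"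
      using P_meas T_meas far_meas by (simp add: nn_integral_cmult nn_integral_add)
    also have "\<dots> \<le> 3 * (ennreal (C1 * r powr (2 * m)) * ?E + ennreal (C2 * r powr (2 * m)) * ?E + ennreal (C3 * r powr (2 * m)) * ?E)"
      by (intro mult_left_mono add_mono P2 far1 T2) auto
    also have "\<dots> = ennreal (C * r powr (2 * m)) * ?E"
    proof -
      have "ennreal (C * r powr (2 * m)) = 3 * (ennreal (C1 * r powr (2 * m)) + ennreal (C2 * r powr (2 * m)) + ennreal (C3 * r powr (2 * m)))"
      proof -
        have "0 \<le> C1 * r powr (2 * m)" "0 \<le> C2 * r powr (2 * m)" "0 \<le> C3 * r powr (2 * m)" using nn by simp_all
        then have "3 * (ennreal (C1 * r powr (2 * m)) + ennreal (C2 * r powr (2 * m)) + ennreal (C3 * r powr (2 * m)))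
            = ennreal 3 * ennreal (C1 * r powr (2 * m) + C2 * r powr (2 * m) + C3 * r powr (2 * m))"
          by simp
        also have "\<dots> = ennreal (3 * (C1 * r powr (2 * m) + C2 * r powr (2 * m) + C3 * r powr (2 * m)))"
          using nn by (intro ennreal_mult[symmetric]) auto
        finally show ?thesis by (simp only: C_def distrib_right distrib_left mult.assoc)
      qed
      then show ?thesis by (simp only: distrib_right mult.assoc)
    qed
    finally show ?thesis .
  qed
  then show ?thesis using nn by (intro exI[of _ C]) (auto simp: C_def)
qed

end

text \<open>Completeness of the Lebesgue measure, for functions with values in \<open>[0, \<infinity>]\<close>.\<close>

lemma lebesgue_measurable_AE_eq:
  fixes f g :: "'a::euclidean_space \<Rightarrow> ennreal"
  assumes "f \<in> borel_measurable lebesgue" "AE x in lebesgue. f x = g x"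
  shows "g \<in> borel_measurable lebesgue"
proof (rule measurableI)
  fix A :: "ennreal set" assume A: "A \<in> sets borel"
  show "g -` A \<inter> space lebesgue \<in> sets lebesgue"
  proof (rule completion.in_sets_AE)
    show "f -` A \<inter> space lebesgue \<in> sets lebesgue" using assms(1) A by (rule measurable_sets)
    show "AE x in lebesgue. (x \<in> f -` A \<inter> space lebesgue) = (x \<in> g -` A \<inter> space lebesgue)"
      using assms(2) by eventually_elim auto
  qed auto
qed simp

lemma lebesgue_complex_ex_borel:
  fixes f :: "'a::euclidean_space \<Rightarrow> complex"
  assumes "f \<in> borel_measurable lebesgue"
  shows "\<exists>f'\<in>borel_measurable borel. AE x in lebesgue. f x = f' x"
proof -
  have "(\<lambda>x. Re (f x)) \<in> borel_measurable (completion lborel)" "(\<lambda>x. Im (f x)) \<in> borel_measurable (completion lborel)"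
    using assms by (auto intro: measurable_compose[OF _ borel_measurable_continuous_onI] continuous_intros)
  from this[THEN completion_ex_borel_measurable_real] obtain u v
    where uv: "u \<in> borel_measurable lborel" "v \<in> borel_measurable lborel"
      and eq: "AE x in lborel. Re (f x) = u x" "AE x in lborel. Im (f x) = v x" by blast
  have "AE x in lborel. f x = Complex (u x) (v x)"
    using eq by eventually_elim (simp add: complex_eq_iff)
  moreover have "(\<lambda>x. Complex (u x) (v x)) \<in> borel_measurable borel"
    using uv unfolding Complex_eq by simp
  ultimately show ?thesis by (intro bexI[of _ "\<lambda>x. Complex (u x) (v x)"]) (simp_all add: AE_completion_iff)
qed

lemma graph_surface_integral:
  fixes h :: "'a::euclidean_space \<Rightarrow> real" and g :: "'a \<times> real \<Rightarrow> complex"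
  assumes J: "(\<lambda>y. sqrt (1 + (\<Sum>b\<in>Basis. (frechet_derivative h (at y) b)\<^sup>2))) \<in> borel_measurable lebesgue"
    and g: "(\<lambda>y. g (y, h y)) \<in> borel_measurable lebesgue"
  shows "(\<integral>Y. g Y \<partial>graph_surface_measure h)
     = (\<integral>y. sqrt (1 + (\<Sum>b\<in>Basis. (frechet_derivative h (at y) b)\<^sup>2)) *\<^sub>R g (y, h y) \<partial>lebesgue)"
proof -
  let ?J = "\<lambda>y. sqrt (1 + (\<Sum>b\<in>Basis. (frechet_derivative h (at y) b)\<^sup>2))"
  let ?M = "density lebesgue (\<lambda>y. ennreal (?J y))" and ?e = "\<lambda>y. (y, h y)"
  have inj: "inj ?e" by (auto intro: injI)
  have gM: "(\<lambda>y. g (?e y)) \<in> borel_measurable ?M" using g by simp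
  have "(\<integral>Y. g Y \<partial>embed_measure ?M ?e) = (\<integral>Y. g Y \<partial>distr ?M (embed_measure ?M ?e) ?e)"
    by (subst embed_measure_eq_distr[OF inj]) simp
  also have "\<dots> = (\<integral>y. g (?e y) \<partial>?M)"
    by (rule integral_distr[OF measurable_embed_measure2[OF inj] measurable_embed_measure1[where g = g and f = ?e, OF gM]])
  also have "\<dots> = (\<integral>y. ?J y *\<^sub>R g (?e y) \<partial>lebesgue)"
    by (rule integral_density[OF g J]) (auto intro!: sum_nonneg add_nonneg_nonneg)
  finally show ?thesis by (simp add: graph_surface_measure_def)
qed

context profile_family
begin

text \<open>For almost every \<open>x\<close> the operators depend continuously on the parameter, so the supremum is almost
  everywhere a supremum over rational parameters.\<close>

lemma graph_op_sup_measurable: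
  assumes f: "f \<in> borel_measurable borel" and fin: "energy f < \<infinity>"
  shows "(\<lambda>x. SUP s\<in>{0<..1}. ennreal (norm (graph_op lam t f x s))) \<in> borel_measurable lebesgue"
proof (rule lebesgue_measurable_AE_eq)
  let ?Q = "{0<..1} \<inter> \<rat> :: real set"
  show "(\<lambda>x. SUP s\<in>?Q. ennreal (norm (graph_op lam t f x s))) \<in> borel_measurable lebesgue"
  proof (rule measurable_completion, rule borel_measurable_SUP)
    show "countable ?Q" by (intro countable_Int2 countable_rat)
    show "(\<lambda>x. ennreal (norm (graph_op lam t f x s))) \<in> borel_measurable lborel" for s
      using graph_op_measurable[OF f, of lam t s] by measurable
  qed
  have "AE x in lborel. (SUP s\<in>?Q. ennreal (norm (graph_op lam t f x s))) = (SUP s\<in>{0<..1}. ennreal (norm (graph_op lam t f x s)))"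
    using potential_finite_AE[OF f fin]
  proof eventually_elim
    fix x assume Wx: "potential f x < \<infinity>"
    have cont: "continuous_on {0<..1} (graph_op lam t f x)" using graph_op_le_potential f Wx by blast
    show "(SUP s\<in>?Q. ennreal (norm (graph_op lam t f x s))) = (SUP s\<in>{0<..1}. ennreal (norm (graph_op lam t f x s)))"
    proof (rule antisym)
      show "(SUP s\<in>?Q. ennreal (norm (graph_op lam t f x s))) \<le> (SUP s\<in>{0<..1}. ennreal (norm (graph_op lam t f x s)))"
        by (rule SUP_subset_mono) auto
      show "(SUP s\<in>{0<..1}. ennreal (norm (graph_op lam t f x s))) \<le> (SUP s\<in>?Q. ennreal (norm (graph_op lam t f x s)))"
      proof (rule SUP_least)
        fix s :: real assume s: "s \<in> {0<..1}"
        have "\<exists>q. q \<in> \<rat> \<and> max (s / 2) (s - 1 / real (Suc k)) < q \<and> q < s" for k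
          using Rats_dense_in_real[of "max (s / 2) (s - 1 / real (Suc k))" s] s by auto
        then obtain q where q: "\<And>k. q k \<in> \<rat> \<and> max (s / 2) (s - 1 / real (Suc k)) < q k \<and> q k < s" by metis
        have qQ: "q k \<in> ?Q" for k
        proof -
          have "s / 2 < q k" "q k < s" using q[of k] by auto
          then have "0 < q k" "q k \<le> 1" using s by auto
          then show ?thesis using q[of k] by simp
        qed
        have "q \<longlonglongrightarrow> s"
        proof (rule tendsto_sandwich[of "\<lambda>k. s - 1 / real (Suc k)" _ _ "\<lambda>_. s"])
          show "(\<lambda>k. s - 1 / real (Suc k)) \<longlonglongrightarrow> s"
            using tendsto_diff[OF tendsto_const[of s] LIMSEQ_inverse_real_of_nat] by (simp add: inverse_eq_divide)
        qed (use q in \<open>auto intro!: always_eventually simp: less_imp_le\<close>)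
        then have "(\<lambda>k. graph_op lam t f x (q k)) \<longlonglongrightarrow> graph_op lam t f x s"
          using continuous_on_tendsto_compose[OF cont, of q s sequentially] s qQ by auto
        then have lim: "(\<lambda>k. ennreal (norm (graph_op lam t f x (q k)))) \<longlonglongrightarrow> ennreal (norm (graph_op lam t f x s))"
          by (intro tendsto_ennrealI tendsto_norm)
        show "ennreal (norm (graph_op lam t f x s)) \<le> (SUP s\<in>?Q. ennreal (norm (graph_op lam t f x s)))"
          by (rule LIMSEQ_le_const2[OF lim]) (use qQ in \<open>auto intro!: exI[of _ 0] SUP_upper\<close>)
      qed
    qed
  qed
  then show "AE x in lebesgue. (SUP s\<in>?Q. ennreal (norm (graph_op lam t f x s))) = (SUP s\<in>{0<..1}. ennreal (norm (graph_op lam t f x s)))"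
    by (simp add: AE_completion_iff)
qed

text \<open>The two regimes are united here: for \<open>lam < 1\<close> the power of \<open>lam\<close> is at least \<open>1\<close>, and the potential
  alone bounds the supremum.\<close>

lemma maximal_bound:
  "\<exists>C\<ge>0. \<forall>lam>0. \<forall>t. \<forall>f. f \<in> borel_measurable borel \<longrightarrow>
     energy f < \<infinity> \<longrightarrow>
     (\<integral>\<^sup>+x. (SUP s\<in>{0<..1}. ennreal (norm (graph_op lam t f x s)))\<^sup>2 \<partial>lborel)
       \<le> ennreal ((C * lam powr (- (m / 2) * (real DIM('a) / (real DIM('a) + 2))))\<^sup>2) * energy f"
proof -
  let ?n = "real DIM('a)"
  define e where "e = - (m / 2) * (?n / (?n + 2))"
  have n2: "?n + 2 > 0" by (intro add_nonneg_pos) auto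
  have e: "e \<le> 0" using m n2 by (simp add: e_def)
  obtain C1 where C1: "C1 \<ge> 0" "\<And>lam t f r. lam \<ge> 1 \<Longrightarrow> r = lam powr (- (?n / (2 * (?n + 2)))) \<Longrightarrow> f \<in> borel_measurable borel \<Longrightarrow>
     energy f < \<infinity> \<Longrightarrow>
     (\<integral>\<^sup>+x. (SUP s\<in>{0<..1}. ennreal (norm (graph_op lam t f x s)))\<^sup>2 \<partial>lborel)
       \<le> ennreal (C1 * r powr (2 * m)) * energy f"
    using maximal_bound_large by blast
  obtain CW where CW: "CW \<ge> 0" "\<And>lam t f x s. 0 < s \<Longrightarrow> s \<le> 1 \<Longrightarrow> f \<in> borel_measurable borel \<Longrightarrow> ennreal (norm (graph_op lam t f x s)) \<le> ennreal CW * potential f x"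
    using graph_op_le_potential by blast
  obtain Cr where Cr: "Cr \<ge> 0" "\<And>\<rho> g. \<rho> > 0 \<Longrightarrow> g \<in> borel_measurable borel \<Longrightarrow>
    (\<integral>\<^sup>+(x::'a). (\<integral>\<^sup>+y. (ennreal (norm (x - y) powr (m - DIM('a))) * indicator {z. norm z \<le> \<rho>} (x - y)) * g y \<partial>lborel)\<^sup>2 \<partial>lborel)
      \<le> ennreal (Cr * \<rho> powr (2 * m)) * (\<integral>\<^sup>+y. (g y)\<^sup>2 \<partial>lborel)"
    using riesz_local_bound[OF m] by blast
  define C2 where "C2 = CW\<^sup>2 * (Cr * (2 * R) powr (2 * m))"
  have C2: "C2 \<ge> 0" using Cr by (simp add: C2_def)
  define C where "C = sqrt (C1 + C2)"
  have Csq: "C\<^sup>2 = C1 + C2" using C1(1) C2 by (simp add: C_def)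
  have "(\<integral>\<^sup>+x. (SUP s\<in>{0<..1}. ennreal (norm (graph_op lam t f x s)))\<^sup>2 \<partial>lborel)
       \<le> ennreal ((C * lam powr e)\<^sup>2) * energy f"
    if lam: "lam > 0" and f: "f \<in> borel_measurable borel" and fin: "energy f < \<infinity>" for lam t f
  proof (cases "lam \<ge> 1")
    case True
    have "(lam powr (- (?n / (2 * (?n + 2))))) powr (2 * m) = (lam powr e)\<^sup>2"
    proof -
      have gen: "- (a / 2) * (2 * m) = - (m / 2) * a + - (m / 2) * a" for a :: real by (simp add: field_simps)
      have "?n / (2 * (?n + 2)) = (?n / (?n + 2)) / 2" by simp
      then have "- (?n / (2 * (?n + 2))) * (2 * m) = e + e" by (simp only: e_def gen)
      then show ?thesis by (simp add: powr_powr power2_eq_square flip: powr_add)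
    qed
    then have "C1 * (lam powr (- (?n / (2 * (?n + 2))))) powr (2 * m) \<le> (C * lam powr e)\<^sup>2"
      using C2 by (simp add: power_mult_distrib Csq mult_right_mono)
    then show ?thesis
      using C1(2)[OF True refl f fin, of t] by (meson ennreal_leI mult_right_mono order_trans zero_le)
  next
    case False
    note [measurable] = f
    have "(\<integral>\<^sup>+x. (SUP s\<in>{0<..1}. ennreal (norm (graph_op lam t f x s)))\<^sup>2 \<partial>lborel) \<le> (\<integral>\<^sup>+x. (ennreal CW)\<^sup>2 * (potential f x)\<^sup>2 \<partial>lborel)"
      unfolding power_mult_distrib[symmetric]
      by (intro nn_integral_mono power_mono_ennreal SUP_least CW(2) f) auto
    also have "\<dots> = (ennreal CW)\<^sup>2 * (\<integral>\<^sup>+x. (potential f x)\<^sup>2 \<partial>lborel)"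
      unfolding potential_def by (rule nn_integral_cmult) measurable
    also have "\<dots> \<le> (ennreal CW)\<^sup>2 * (ennreal (Cr * (2 * R) powr (2 * m)) * energy f)"
      unfolding potential_def using R by (intro mult_left_mono Cr(2)) auto
    also have "\<dots> = ennreal C2 * energy f"
    proof -
      have X: "0 \<le> Cr * (2 * R) powr (2 * m)" using Cr(1) by simp
      have "ennreal C2 = (ennreal CW)\<^sup>2 * ennreal (Cr * (2 * R) powr (2 * m))"
        unfolding C2_def using ennreal_mult[OF zero_le_power2[of CW] X] ennreal_power[OF CW(1), of 2] by (simp only:)
      then show ?thesis by (simp only: mult.assoc)
    qed
    also have "\<dots> \<le> ennreal ((C * lam powr e)\<^sup>2) * energy f"
    proof (intro mult_right_mono ennreal_leI)
      have "1 \<le> lam powr e" using powr_mono'[of e 0 lam] lam False e by simp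
      then have "1 \<le> (lam powr e)\<^sup>2" by (rule one_le_power)
      then have "C2 * 1 \<le> (C1 + C2) * (lam powr e)\<^sup>2" using C1(1) C2 by (intro mult_mono) auto
      then show "C2 \<le> (C * lam powr e)\<^sup>2" by (simp add: power_mult_distrib Csq)
    qed simp
    finally show ?thesis .
  qed
  then show ?thesis unfolding e_def using C1(1) C2 by (intro exI[of _ C]) (auto simp: C_def)
qed

end

section \<open>Oscillating graphs\<close>

text \<open>The graphs of the theorem as a family in the parameter \<open>s\<close>; the suffix \<open>ds\<close> marks derivatives in \<open>s\<close>.\<close>

locale smooth_profile =
  fixes \<psi> :: "'a::euclidean_space \<Rightarrow> real" and \<gamma> :: real
  assumes \<gamma>: "\<gamma> > 3 / 2" and \<psi>_smooth: "smooth_on UNIV \<psi>" and \<psi>_bounded: "bounded_derivs \<psi>"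
begin

definition grad :: "'a \<Rightarrow> real \<Rightarrow> 'a \<Rightarrow> real" where
  "grad b s y = s powr (\<gamma> - 1) * iter_pderiv [b] \<psi> (y /\<^sub>R s)"

definition area :: "real \<Rightarrow> 'a \<Rightarrow> real" where
  "area s y = sqrt (1 + (\<Sum>b\<in>Basis. (grad b s y)\<^sup>2))"

text \<open>The derivative of a function of \<open>y / s\<close> along \<open>y\<close>: differentiating in \<open>s\<close> gives \<open>- radial / s\<^sup>2\<close>.\<close>

definition radial :: "'a list \<Rightarrow> real \<Rightarrow> 'a \<Rightarrow> real" where
  "radial bs s y = (\<Sum>c\<in>Basis. (y \<bullet> c) * iter_pderiv (c # bs) \<psi> (y /\<^sub>R s))"

definition height_ds :: "real \<Rightarrow> 'a \<Rightarrow> real" where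
  "height_ds s y = \<gamma> * s powr (\<gamma> - 1) * \<psi> (y /\<^sub>R s) - s powr \<gamma> * (radial [] s y / s\<^sup>2)"

definition grad_ds :: "'a \<Rightarrow> real \<Rightarrow> 'a \<Rightarrow> real" where
  "grad_ds b s y = (\<gamma> - 1) * s powr (\<gamma> - 2) * iter_pderiv [b] \<psi> (y /\<^sub>R s) - s powr (\<gamma> - 1) * (radial [b] s y / s\<^sup>2)"

definition area_ds :: "real \<Rightarrow> 'a \<Rightarrow> real" where
  "area_ds s y = (\<Sum>b\<in>Basis. grad b s y * grad_ds b s y) / area s y"

lemma iter_pderiv_differentiable: "bs \<in> lists Basis \<Longrightarrow> iter_pderiv bs \<psi> differentiable (at x)"
  using \<psi>_smooth by (auto simp: smooth_on_def)

lemma iter_pderiv_continuous: "bs \<in> lists Basis \<Longrightarrow> continuous_on UNIV (iter_pderiv bs \<psi>)"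
  by (rule smooth_on_iter_pderiv_continuous[OF \<psi>_smooth])

lemma area_ge_1: "area s y \<ge> 1"
  unfolding area_def by (simp add: sum_nonneg)

lemma scaled_iter_pderiv_derivative:
  assumes "bs \<in> lists Basis" "s > 0"
  shows "((\<lambda>s. iter_pderiv bs \<psi> (y /\<^sub>R s)) has_real_derivative - (radial bs s y / s\<^sup>2)) (at s)"
proof -
  let ?L = "frechet_derivative (iter_pderiv bs \<psi>) (at (y /\<^sub>R s))"
  have diff: "iter_pderiv bs \<psi> differentiable (at (y /\<^sub>R s))" by (rule iter_pderiv_differentiable[OF assms(1)])
  have lin: "linear ?L" by (rule linear_frechet_derivative[OF diff])
  have 1: "(iter_pderiv bs \<psi> has_derivative ?L) (at (y /\<^sub>R s))"
    using diff by (simp add: frechet_derivative_works)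
  have 2: "((\<lambda>s. y /\<^sub>R s) has_derivative (\<lambda>h. (- h / s\<^sup>2) *\<^sub>R y)) (at s)"
    using assms(2) by (auto intro!: derivative_eq_intros simp: fun_eq_iff power2_eq_square divide_inverse)
  have chain: "((iter_pderiv bs \<psi> \<circ> (\<lambda>s. y /\<^sub>R s)) has_derivative ?L \<circ> (\<lambda>h. (- h / s\<^sup>2) *\<^sub>R y)) (at s)"
    by (rule diff_chain_at[OF 2 1])
  have L_eq: "?L ((- h / s\<^sup>2) *\<^sub>R y) = h * - (radial bs s y / s\<^sup>2)" for h
  proof -
    have "?L y = ?L (\<Sum>c\<in>Basis. (y \<bullet> c) *\<^sub>R c)" by (simp add: euclidean_representation)
    also have "\<dots> = (\<Sum>c\<in>Basis. (y \<bullet> c) * ?L c)" using lin by (simp add: linear_sum linear_cmul)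
    also have "\<dots> = radial bs s y" by (simp add: radial_def)
    finally have Ly: "?L y = radial bs s y" .
    have "?L ((- h / s\<^sup>2) *\<^sub>R y) = (- h / s\<^sup>2) *\<^sub>R ?L y" by (rule linear_cmul[OF lin])
    then show ?thesis unfolding Ly by simp
  qed
  have eq: "?L \<circ> (\<lambda>h. (- h / s\<^sup>2) *\<^sub>R y) = (*) (- (radial bs s y / s\<^sup>2))"
    by (rule ext) (simp only: o_def L_eq mult.commute)
  show ?thesis
    unfolding has_field_derivative_def using chain[unfolded eq] by (simp only: o_def)
qed

lemma height_has_derivative:
  assumes "s > 0"
  shows "((\<lambda>s. osc_profile \<psi> \<gamma> s y) has_real_derivative height_ds s y) (at s)"
proof -
  have "((\<lambda>s. s powr \<gamma>) has_real_derivative \<gamma> * s powr (\<gamma> - 1)) (at s)"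
    by (rule has_real_derivative_powr[OF assms])
  from DERIV_mult[OF this scaled_iter_pderiv_derivative[of "[]" s y]] assms
  show ?thesis by (simp add: osc_profile_def height_ds_def algebra_simps)
qed

lemma grad_has_derivative:
  assumes "s > 0" "b \<in> Basis"
  shows "((\<lambda>s. grad b s y) has_real_derivative grad_ds b s y) (at s)"
proof -
  have "((\<lambda>s. s powr (\<gamma> - 1)) has_real_derivative (\<gamma> - 1) * s powr (\<gamma> - 1 - 1)) (at s)"
    by (rule has_real_derivative_powr[OF assms(1)])
  from DERIV_mult[OF this scaled_iter_pderiv_derivative[of "[b]" s y]] assms
  show ?thesis by (simp add: grad_def grad_ds_def algebra_simps)
qed

lemma area_has_derivative:
  assumes "s > 0"
  shows "((\<lambda>s. area s y) has_real_derivative area_ds s y) (at s)"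
proof -
  let ?S = "\<lambda>s. 1 + (\<Sum>b\<in>Basis. (grad b s y)\<^sup>2)"
  have pos: "?S s > 0" by (intro add_pos_nonneg sum_nonneg) auto
  have "(?S has_real_derivative (\<Sum>b\<in>Basis. 2 * grad b s y * grad_ds b s y)) (at s)"
    using grad_has_derivative[OF assms]
    by (auto intro!: derivative_eq_intros sum.cong simp: mult_ac)
  from DERIV_chain2[OF DERIV_real_sqrt[OF pos] this]
  have D: "((\<lambda>s. sqrt (?S s)) has_real_derivative inverse (sqrt (?S s)) / 2 * (\<Sum>b\<in>Basis. 2 * grad b s y * grad_ds b s y)) (at s)" .
  have two: "(\<Sum>b\<in>Basis. 2 * grad b s y * grad_ds b s y) = 2 * (\<Sum>b\<in>Basis. grad b s y * grad_ds b s y)"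
    by (simp add: sum_distrib_left mult.assoc)
  have "inverse (sqrt (?S s)) / 2 * (\<Sum>b\<in>Basis. 2 * grad b s y * grad_ds b s y) = area_ds s y"
  proof -
    have "inverse q / 2 * (2 * X) = X / q" for q X :: real by (simp add: inverse_eq_divide)
    then show ?thesis unfolding two area_ds_def area_def .
  qed
  with D show ?thesis by (simp only: area_def)
qed

lemma continuous_in_s:
  shows "bs \<in> lists Basis \<Longrightarrow> continuous_on {0<..} (\<lambda>s. iter_pderiv bs \<psi> (y /\<^sub>R s))"
    and "continuous_on {0<..} (\<lambda>s. height_ds s y)" and "continuous_on {0<..} (\<lambda>s. area_ds s y)"
proof -
  have d: "continuous_on {0<..} (\<lambda>s. iter_pderiv bs \<psi> (y /\<^sub>R s))" if "bs \<in> lists Basis" for bs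
    by (rule continuous_on_compose2[OF iter_pderiv_continuous[OF that]]) (auto intro!: continuous_intros)
  then show "bs \<in> lists Basis \<Longrightarrow> continuous_on {0<..} (\<lambda>s. iter_pderiv bs \<psi> (y /\<^sub>R s))" .
  have p: "continuous_on {0<..} (\<lambda>s::real. s powr a)" for a by (auto intro!: continuous_intros)
  have r: "continuous_on {0<..} (\<lambda>s. radial bs s y)" if "bs \<in> lists Basis" for bs
    unfolding radial_def using that by (intro continuous_intros d) auto
  have sq: "continuous_on {0<..} (\<lambda>s. f s / s\<^sup>2)" if "continuous_on {0<..} f" for f :: "real \<Rightarrow> real"
    using that by (auto intro!: continuous_intros)
  show "continuous_on {0<..} (\<lambda>s. height_ds s y)"
    unfolding height_ds_def using d[of "[]"] by (intro continuous_intros p sq r) auto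
  have g: "continuous_on {0<..} (\<lambda>s. grad b s y)" if "b \<in> Basis" for b
    unfolding grad_def using that by (intro continuous_intros p d) auto
  have gd: "continuous_on {0<..} (\<lambda>s. grad_ds b s y)" if "b \<in> Basis" for b
    unfolding grad_ds_def using that by (intro continuous_intros p sq r d) auto
  have a: "continuous_on {0<..} (\<lambda>s. area s y)"
    unfolding area_def by (intro continuous_intros g)
  show "continuous_on {0<..} (\<lambda>s. area_ds s y)"
    unfolding area_ds_def using area_ge_1[of _ y] by (intro continuous_intros g gd a) (auto, metis not_one_le_zero)
qed

lemma profile_measurable:
  "(\<lambda>p. osc_profile \<psi> \<gamma> (fst p) (snd p)) \<in> borel_measurable borel"
  "(\<lambda>p. area (fst p) (snd p)) \<in> borel_measurable borel"
  "(\<lambda>p. height_ds (fst p) (snd p)) \<in> borel_measurable borel"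
  "(\<lambda>p. area_ds (fst p) (snd p)) \<in> borel_measurable borel"
proof -
  have s: "(\<lambda>p::real \<times> 'a. fst p) \<in> borel_measurable borel" and y: "(\<lambda>p::real \<times> 'a. snd p) \<in> borel_measurable borel"
    by (intro borel_measurable_continuous_onI continuous_intros)+
  have d: "(\<lambda>p. iter_pderiv bs \<psi> (snd p /\<^sub>R fst p)) \<in> borel_measurable borel" if "bs \<in> lists Basis" for bs
    by (rule measurable_compose[OF _ borel_measurable_continuous_onI[OF iter_pderiv_continuous[OF that]]])
       (intro borel_measurable_scaleR borel_measurable_inverse s y)
  have p: "(\<lambda>p::real \<times> 'a. fst p powr a) \<in> borel_measurable borel" for a
    by (intro powr_real_measurable s borel_measurable_const)
  have c: "(\<lambda>p::real \<times> 'a. snd p \<bullet> c) \<in> borel_measurable borel" for c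
    by (intro borel_measurable_inner y borel_measurable_const)
  have r: "(\<lambda>p. radial bs (fst p) (snd p)) \<in> borel_measurable borel" if "bs \<in> lists Basis" for bs
    unfolding radial_def using that by (intro borel_measurable_sum borel_measurable_times c d) auto
  have g: "(\<lambda>p. grad b (fst p) (snd p)) \<in> borel_measurable borel" if "b \<in> Basis" for b
    unfolding grad_def using that by (intro borel_measurable_times p d) auto
  have gd: "(\<lambda>p. grad_ds b (fst p) (snd p)) \<in> borel_measurable borel" if "b \<in> Basis" for b
    unfolding grad_ds_def using that
    by (intro borel_measurable_times borel_measurable_diff borel_measurable_divide borel_measurable_power borel_measurable_const p d r s) auto
  show "(\<lambda>p. osc_profile \<psi> \<gamma> (fst p) (snd p)) \<in> borel_measurable borel"
    unfolding osc_profile_def using d[of "[]"] by (intro borel_measurable_times p) auto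
  show "(\<lambda>p. height_ds (fst p) (snd p)) \<in> borel_measurable borel"
    unfolding height_ds_def using d[of "[]"]
    by (intro borel_measurable_times borel_measurable_diff borel_measurable_divide borel_measurable_power borel_measurable_const p r s) auto
  show a: "(\<lambda>p. area (fst p) (snd p)) \<in> borel_measurable borel"
    unfolding area_def
    by (intro measurable_compose[OF _ borel_measurable_sqrt] borel_measurable_add borel_measurable_sum borel_measurable_power borel_measurable_const g)
  show "(\<lambda>p. area_ds (fst p) (snd p)) \<in> borel_measurable borel"
    unfolding area_ds_def by (intro borel_measurable_divide borel_measurable_sum borel_measurable_times g gd a)
qed

text \<open>The singularity at \<open>s = 0\<close> of the derivatives in the parameter: \<open>s powr (\<gamma> - 2)\<close> for the height and
  \<open>s powr (2 \<gamma> - 4)\<close> for the area element.\<close>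

definition decay :: real where "decay = max 0 (4 - 2 * \<gamma>)"

lemma decay: "0 \<le> decay" "decay < 1" "- decay \<le> 2 * \<gamma> - 4" "- decay \<le> \<gamma> - 2"
  using \<gamma> by (auto simp: decay_def)

text \<open>A derivative of \<open>\<psi>(y / s)\<close> in \<open>s\<close> costs \<open>|y| / s\<^sup>2\<close>, with \<open>|y| \<le> R\<close>. The area element depends on
  the square of the gradient, which is \<open>O(s powr (\<gamma> - 1))\<close>, so its derivative is the product of
  \<open>s powr (\<gamma> - 1)\<close> and \<open>s powr (\<gamma> - 3)\<close>.\<close>

lemma profile_bounds:
  assumes R: "R > 0"
  shows "\<exists>B\<ge>0. \<forall>s y. 0 < s \<longrightarrow> s \<le> 1 \<longrightarrow> norm y \<le> R \<longrightarrow>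
    \<bar>area s y\<bar> \<le> B \<and> \<bar>height_ds s y\<bar> \<le> B * s powr - decay \<and> \<bar>area_ds s y\<bar> \<le> B * s powr - decay"
proof -
  let ?n = "real DIM('a)"
  let ?Ls = "insert [] ((\<lambda>b. [b]) ` Basis \<union> (\<lambda>(c, b). [c, b]) ` (Basis \<times> Basis)) :: 'a list set"
  have "bounded (\<Union>bs\<in>?Ls. range (iter_pderiv bs \<psi>))"
  proof (rule bounded_UN)
    have "?Ls \<subseteq> lists Basis" by auto
    then show "\<forall>bs\<in>?Ls. bounded (range (iter_pderiv bs \<psi>))"
      using \<psi>_bounded unfolding bounded_derivs_def by blast
  qed simp
  then obtain C where C: "C > 0" "\<And>bs z. bs \<in> ?Ls \<Longrightarrow> \<bar>iter_pderiv bs \<psi> z\<bar> \<le> C"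
    unfolding bounded_pos real_norm_def by blast
  define D where "D = ?n * (R * C)"
  have D: "D \<ge> 0" using R C(1) by (simp add: D_def)
  define E where "E = ?n * (C * ((\<gamma> - 1) * C + D))"
  define B where "B = (1 + ?n * C\<^sup>2) + (\<gamma> * C + D) + E"
  have E: "E \<ge> 0" and F: "\<gamma> * C + D \<ge> 0" and G: "1 + ?n * C\<^sup>2 \<ge> 0"
    using \<gamma> C(1) D by (simp_all add: E_def)
  have main: "\<bar>area s y\<bar> \<le> B \<and> \<bar>height_ds s y\<bar> \<le> B * s powr - decay \<and> \<bar>area_ds s y\<bar> \<le> B * s powr - decay"
    if s: "0 < s" "s \<le> 1" and y: "norm y \<le> R" for s y
  proof -
    have pw: "s powr a \<le> s powr b" if "b \<le> a" for a b using s that by (intro powr_mono') auto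
    have rad: "\<bar>radial bs s y\<bar> \<le> D" if "bs \<in> insert [] ((\<lambda>b. [b]) ` Basis)" for bs
    proof -
      have "\<bar>radial bs s y\<bar> \<le> (\<Sum>c\<in>Basis. \<bar>(y \<bullet> c) * iter_pderiv (c # bs) \<psi> (y /\<^sub>R s)\<bar>)"
        unfolding radial_def by (rule sum_abs)
      also have "\<dots> \<le> ?n * (R * C)"
      proof (rule sum_bounded_above)
        fix c :: 'a assume c: "c \<in> Basis"
        have "\<bar>y \<bullet> c\<bar> \<le> R" using Basis_le_norm[OF c, of y] y by linarith
        moreover have "\<bar>iter_pderiv (c # bs) \<psi> (y /\<^sub>R s)\<bar> \<le> C" using that c by (intro C(2)) auto
        ultimately show "\<bar>(y \<bullet> c) * iter_pderiv (c # bs) \<psi> (y /\<^sub>R s)\<bar> \<le> R * C"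
          unfolding abs_mult using R by (intro mult_mono) auto
      qed
      finally show ?thesis by (simp add: D_def)
    qed
    have div: "s powr a * (D / s\<^sup>2) = D * s powr (a - 2)" for a
      using s by (simp add: powr_diff powr_numeral)
    have "\<bar>height_ds s y\<bar> \<le> \<gamma> * s powr (\<gamma> - 1) * C + s powr \<gamma> * (D / s\<^sup>2)"
      unfolding height_ds_def
    proof (rule order_trans[OF abs_triangle_ineq4], rule add_mono)
      show "\<bar>\<gamma> * s powr (\<gamma> - 1) * \<psi> (y /\<^sub>R s)\<bar> \<le> \<gamma> * s powr (\<gamma> - 1) * C"
        using C(2)[of "[]" "y /\<^sub>R s"] \<gamma> by (simp add: abs_mult mult_left_mono)
      show "\<bar>s powr \<gamma> * (radial [] s y / s\<^sup>2)\<bar> \<le> s powr \<gamma> * (D / s\<^sup>2)"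
        using rad[of "[]"] by (simp add: abs_mult mult_left_mono divide_right_mono)
    qed
    also have "\<dots> \<le> \<gamma> * s powr - decay * C + D * s powr - decay"
      unfolding div using decay \<gamma> C(1) D by (intro add_mono mult_right_mono mult_left_mono pw) auto
    also have "\<dots> = (\<gamma> * C + D) * s powr - decay" by (simp add: algebra_simps)
    also have "\<dots> \<le> B * s powr - decay" using E G by (intro mult_right_mono) (auto simp: B_def)
    finally have h: "\<bar>height_ds s y\<bar> \<le> B * s powr - decay" .
    have gr: "\<bar>grad b s y\<bar> \<le> s powr (\<gamma> - 1) * C" if "b \<in> Basis" for b
      unfolding grad_def abs_mult using C(2)[of "[b]"] that by (simp add: mult_left_mono)
    have gd: "\<bar>grad_ds b s y\<bar> \<le> ((\<gamma> - 1) * C + D) * s powr (\<gamma> - 3)" if "b \<in> Basis" for b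
    proof -
      have "\<bar>grad_ds b s y\<bar> \<le> (\<gamma> - 1) * s powr (\<gamma> - 2) * C + s powr (\<gamma> - 1) * (D / s\<^sup>2)"
        unfolding grad_ds_def
      proof (rule order_trans[OF abs_triangle_ineq4], rule add_mono)
        show "\<bar>(\<gamma> - 1) * s powr (\<gamma> - 2) * iter_pderiv [b] \<psi> (y /\<^sub>R s)\<bar> \<le> (\<gamma> - 1) * s powr (\<gamma> - 2) * C"
          using C(2)[of "[b]" "y /\<^sub>R s"] that \<gamma> unfolding abs_mult by (intro mult_mono) auto
        show "\<bar>s powr (\<gamma> - 1) * (radial [b] s y / s\<^sup>2)\<bar> \<le> s powr (\<gamma> - 1) * (D / s\<^sup>2)"
          using rad[of "[b]"] that by (simp add: abs_mult mult_left_mono divide_right_mono)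
      qed
      also have "\<dots> \<le> (\<gamma> - 1) * s powr (\<gamma> - 3) * C + D * s powr (\<gamma> - 3)"
        unfolding div using \<gamma> C(1) D by (intro add_mono mult_right_mono mult_left_mono pw) auto
      finally show ?thesis by (simp add: algebra_simps)
    qed
    have "\<bar>\<Sum>b\<in>Basis. grad b s y * grad_ds b s y\<bar> \<le> (\<Sum>b\<in>Basis. \<bar>grad b s y * grad_ds b s y\<bar>)"
      by (rule sum_abs)
    also have "\<dots> \<le> ?n * ((s powr (\<gamma> - 1) * C) * (((\<gamma> - 1) * C + D) * s powr (\<gamma> - 3)))"
    proof (rule sum_bounded_above)
      fix b :: 'a assume b: "b \<in> Basis"
      show "\<bar>grad b s y * grad_ds b s y\<bar> \<le> (s powr (\<gamma> - 1) * C) * (((\<gamma> - 1) * C + D) * s powr (\<gamma> - 3))"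
        unfolding abs_mult using gr[OF b] gd[OF b] C(1) by (intro mult_mono) auto
    qed
    also have "\<dots> = E * (s powr (\<gamma> - 1) * s powr (\<gamma> - 3))" by (simp add: E_def)
    also have "\<dots> = E * s powr (2 * \<gamma> - 4)" by (simp flip: powr_add)
    also have "\<dots> \<le> E * s powr - decay" using E decay by (intro mult_left_mono pw) auto
    also have "\<dots> \<le> B * s powr - decay" using F G by (intro mult_right_mono) (auto simp: B_def)
    finally have num: "\<bar>\<Sum>b\<in>Basis. grad b s y * grad_ds b s y\<bar> \<le> B * s powr - decay" .
    have "\<bar>area_ds s y\<bar> = \<bar>\<Sum>b\<in>Basis. grad b s y * grad_ds b s y\<bar> / area s y"
      unfolding area_ds_def abs_divide using area_ge_1[of s y] by simp
    also have "\<dots> \<le> \<bar>\<Sum>b\<in>Basis. grad b s y * grad_ds b s y\<bar> / 1"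
      using area_ge_1[of s y] by (intro divide_left_mono) auto
    finally have a: "\<bar>area_ds s y\<bar> \<le> B * s powr - decay" using num by simp
    have "(\<Sum>b\<in>Basis. (grad b s y)\<^sup>2) \<le> ?n * C\<^sup>2"
    proof (rule sum_bounded_above)
      fix b :: 'a assume b: "b \<in> Basis"
      have "s powr (\<gamma> - 1) \<le> 1" using pw[of 0 "\<gamma> - 1"] \<gamma> s by simp
      then have "s powr (\<gamma> - 1) * C \<le> 1 * C" using C(1) by (intro mult_right_mono) auto
      then have "\<bar>grad b s y\<bar> \<le> \<bar>C\<bar>" using gr[OF b] C(1) by linarith
      then show "(grad b s y)\<^sup>2 \<le> C\<^sup>2" by (rule abs_le_square_iff[THEN iffD1])
    qed
    then have "area s y \<le> sqrt (1 + ?n * C\<^sup>2)" unfolding area_def by simp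
    also have "\<dots> \<le> 1 + ?n * C\<^sup>2"
    proof (rule real_le_lsqrt)
      have "0 \<le> ?n * C\<^sup>2" by simp
      then show "1 + ?n * C\<^sup>2 \<le> (1 + ?n * C\<^sup>2)\<^sup>2" by (intro self_le_power) auto
    qed (use G in auto)
    also have "\<dots> \<le> B" using E F by (simp add: B_def)
    finally have "\<bar>area s y\<bar> \<le> B" using area_ge_1[of s y] by simp
    then show ?thesis using h a by simp
  qed
  show ?thesis
  proof (intro exI[of _ B] conjI allI impI)
    show "B \<ge> 0" using E F G by (simp add: B_def)
  qed (use main in auto)
qed

lemma frechet_osc_profile:
  assumes "s > 0" "b \<in> Basis"
  shows "frechet_derivative (osc_profile \<psi> \<gamma> s) (at y) b = grad b s y"
proof -
  let ?L = "frechet_derivative \<psi> (at (y /\<^sub>R s))"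
  have diff: "\<psi> differentiable (at (y /\<^sub>R s))" using iter_pderiv_differentiable[of "[]"] by simp
  have 1: "(\<psi> has_derivative ?L) (at (y /\<^sub>R s))" using diff by (simp add: frechet_derivative_works)
  have 2: "((\<lambda>y. y /\<^sub>R s) has_derivative (\<lambda>h. h /\<^sub>R s)) (at y)" by (auto intro!: derivative_eq_intros)
  have "((\<lambda>y. s powr \<gamma> * (\<psi> \<circ> (\<lambda>y. y /\<^sub>R s)) y) has_derivative (\<lambda>h. s powr \<gamma> * (?L \<circ> (\<lambda>h. h /\<^sub>R s)) h)) (at y)"
    by (rule has_derivative_mult_right[OF diff_chain_at[OF 2 1]])
  then have "(osc_profile \<psi> \<gamma> s has_derivative (\<lambda>h. s powr \<gamma> * ?L (h /\<^sub>R s))) (at y)"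
    by (simp add: osc_profile_def[abs_def] o_def)
  then have "frechet_derivative (osc_profile \<psi> \<gamma> s) (at y) = (\<lambda>h. s powr \<gamma> * ?L (h /\<^sub>R s))"
    by (rule frechet_derivative_at[symmetric])
  then show ?thesis
    using assms linear_cmul[OF linear_frechet_derivative[OF diff], of "inverse s" b]
    by (simp add: grad_def powr_diff divide_inverse mult_ac)
qed

end

lemma L2_norm_le:
  fixes g f :: "'a::euclidean_space \<Rightarrow> ennreal"
  assumes "c \<ge> 0" "(\<integral>\<^sup>+x. (g x)\<^sup>2 \<partial>lebesgue) \<le> ennreal (c\<^sup>2) * (\<integral>\<^sup>+x. (f x)\<^sup>2 \<partial>lebesgue)" "(\<integral>\<^sup>+x. (f x)\<^sup>2 \<partial>lebesgue) < \<infinity>"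
  shows "L2_norm g \<le> ennreal c * L2_norm f"
proof -
  obtain i where i: "i \<ge> 0" "(\<integral>\<^sup>+x. (f x)\<^sup>2 \<partial>lebesgue) = ennreal i"
    using assms(3) by (cases "\<integral>\<^sup>+x. (f x)\<^sup>2 \<partial>lebesgue") auto
  have "(\<integral>\<^sup>+x. (g x)\<^sup>2 \<partial>lebesgue) \<le> ennreal (c\<^sup>2 * i)" using assms(2) i by (simp add: ennreal_mult)
  moreover from this obtain j where j: "j \<ge> 0" "(\<integral>\<^sup>+x. (g x)\<^sup>2 \<partial>lebesgue) = ennreal j"
    by (cases "\<integral>\<^sup>+x. (g x)\<^sup>2 \<partial>lebesgue") (auto simp: top_unique)
  ultimately have "j \<le> c\<^sup>2 * i" using i by (simp add: ennreal_le_iff)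
  then have "sqrt j \<le> c * sqrt i" using assms(1) by (simp add: real_sqrt_le_iff real_sqrt_mult flip: real_sqrt_le_iff[of j])
  then show ?thesis using i j assms(1) by (simp add: L2_norm_def ennreal_leI flip: ennreal_mult)
qed

text \<open>The estimate in an arbitrary Euclidean space. What is left is to identify the surface integral
  with the integral in the graph coordinate, and to replace \<open>f\<close> by a Borel measurable representative.\<close>

lemma maximal_operator_bound:
  fixes \<psi> :: "'a::euclidean_space \<Rightarrow> real" and \<phi> :: "('a \<times> real) \<times> 'a \<Rightarrow> real" and K :: "'a \<times> real \<Rightarrow> complex"
    and \<gamma> m :: real
  assumes \<gamma>: "\<gamma> > 3 / 2" and m: "0 < m" "m < DIM('a)"
    and \<psi>: "smooth_on UNIV \<psi>" "bounded_derivs \<psi>"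
    and \<phi>: "smooth_on UNIV \<phi>" "compactly_supported \<phi>"
    and K: "smooth_on (UNIV - {0}) K" "kernel_bounds (m - DIM('a)) K"
  shows "\<exists>C::real. \<forall>lam>0. \<forall>t::real.
           L2_opnorm (\<lambda>f x. T_max \<psi> \<gamma> \<phi> K lam f (x, t))
             \<le> ennreal (C * lam powr (- (m / 2) * (real DIM('a) / (real DIM('a) + 2))))"
proof -
  interpret smooth_profile \<psi> \<gamma> by standard (use \<gamma> \<psi> in auto)
  have "bounded (closure {z. \<phi> z \<noteq> 0})" using \<phi>(2) by (simp add: compactly_supported_def compact_imp_bounded)
  then obtain R where R: "R > 0" "\<forall>z\<in>closure {z. \<phi> z \<noteq> 0}. norm z \<le> R" by (auto simp: bounded_pos)
  have \<phi>R: "norm x \<le> R \<and> norm y \<le> R" if "((x, t), y) \<in> closure {z. \<phi> z \<noteq> 0}" for x t y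
    using R(2)[rule_format, OF that] norm_fst_le[of "(x, t)" y] norm_snd_le[of y "(x, t)"] norm_fst_le[of x t] by linarith
  interpret kernel_setting \<phi> K m R
  proof
    show "norm x \<le> R \<and> norm y \<le> R" if "((x, t), y) \<in> closure {z. \<phi> z \<noteq> 0}" for x t y by (rule \<phi>R[OF that])
  qed (use m \<phi> R K in auto)
  obtain B where B: "B \<ge> 0" "\<And>s y. 0 < s \<Longrightarrow> s \<le> 1 \<Longrightarrow> norm y \<le> R \<Longrightarrow>
    \<bar>area s y\<bar> \<le> B \<and> \<bar>height_ds s y\<bar> \<le> B * s powr - decay \<and> \<bar>area_ds s y\<bar> \<le> B * s powr - decay"
    using profile_bounds[OF R(1)] by blast
  interpret profile_family \<phi> K m R "osc_profile \<psi> \<gamma>" area height_ds area_ds B decay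
    by standard (use decay B height_has_derivative area_has_derivative continuous_in_s(2,3) profile_measurable in auto)
  obtain C where C: "C \<ge> 0" "\<And>lam t f. lam > 0 \<Longrightarrow> f \<in> borel_measurable borel \<Longrightarrow>
     energy f < \<infinity> \<Longrightarrow>
     (\<integral>\<^sup>+x. (SUP s\<in>{0<..1}. ennreal (norm (graph_op lam t f x s)))\<^sup>2 \<partial>lborel)
       \<le> ennreal ((C * lam powr (- (m / 2) * (real DIM('a) / (real DIM('a) + 2))))\<^sup>2) * energy f"
    using maximal_bound by blast
  have T_op_eq: "T_op \<psi> \<gamma> \<phi> K lam s f (x, t) = graph_op lam t f' x s"
    if s: "s > 0" and f: "f \<in> borel_measurable lebesgue" and f': "f' \<in> borel_measurable borel" and eq: "AE y in lebesgue. f y = f' y"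
    for lam s f f' x t
  proof -
    have area: "sqrt (1 + (\<Sum>b\<in>Basis. (frechet_derivative (osc_profile \<psi> \<gamma> s) (at y) b)\<^sup>2)) = area s y" for y
      using s by (simp add: frechet_osc_profile area_def)
    have area_meas: "(\<lambda>y. area s y) \<in> borel_measurable borel"
      using borel_measurable_compose_continuous[OF profile_measurable(2), of "\<lambda>y. (s, y)"] by (simp add: continuous_intros)
    have h_meas: "(\<lambda>y. osc_profile \<psi> \<gamma> s y) \<in> borel_measurable borel"
      using borel_measurable_compose_continuous[OF profile_measurable(1), of "\<lambda>y. (s, y)"] by (simp add: continuous_intros)
    define G where "G y = cis (lam * (x \<bullet> y)) * complex_of_real (\<phi> ((x, t), y)) * K (x - y, t - osc_profile \<psi> \<gamma> s y)" for y
    have G_meas: "G \<in> borel_measurable borel"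
      unfolding G_def
    proof (intro borel_measurable_times phase_measurable)
      show "(\<lambda>y. complex_of_real (\<phi> ((x, t), y))) \<in> borel_measurable borel"
        by (intro measurable_compose[OF _ borel_measurable_of_real] borel_measurable_compose_continuous[OF \<phi>_measurable] continuous_intros)
      have "(\<lambda>y. x - y) \<in> borel_measurable borel" by (intro borel_measurable_continuous_onI continuous_intros)
      moreover have "(\<lambda>y. t - osc_profile \<psi> \<gamma> s y) \<in> borel_measurable borel" by (intro borel_measurable_diff borel_measurable_const h_meas)
      ultimately show "(\<lambda>y. K (x - y, t - osc_profile \<psi> \<gamma> s y)) \<in> borel_measurable borel"
        by (intro measurable_compose[OF borel_measurable_Pair K_measurable])
    qed
    have "T_op \<psi> \<gamma> \<phi> K lam s f (x, t) = (\<integral>y. area s y *\<^sub>R (G y * f y) \<partial>lebesgue)"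
      unfolding T_op_def
    proof (subst graph_surface_integral)
      show "(\<lambda>y. sqrt (1 + (\<Sum>b\<in>Basis. (frechet_derivative (osc_profile \<psi> \<gamma> s) (at y) b)\<^sup>2))) \<in> borel_measurable lebesgue"
        unfolding area using area_meas by (simp add: measurable_completion)
      have "G \<in> borel_measurable lebesgue" using G_meas by (simp add: measurable_completion)
      then have "(\<lambda>y. G y * f y) \<in> borel_measurable lebesgue" using f by (rule borel_measurable_times)
      then show "(\<lambda>y. cis (lam * (fst (x, t) \<bullet> fst (y, osc_profile \<psi> \<gamma> s y))) * complex_of_real (\<phi> ((x, t), fst (y, osc_profile \<psi> \<gamma> s y)))
          * K ((x, t) - (y, osc_profile \<psi> \<gamma> s y)) * f (fst (y, osc_profile \<psi> \<gamma> s y))) \<in> borel_measurable lebesgue"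
        by (simp add: G_def)
    qed (simp add: area G_def)
    also have "\<dots> = (\<integral>y. area s y *\<^sub>R (G y * f' y) \<partial>lebesgue)"
    proof (rule integral_cong_AE)
      have "f' \<in> borel_measurable lebesgue" "G \<in> borel_measurable lebesgue" "(\<lambda>y. area s y) \<in> borel_measurable lebesgue"
        using f' G_meas area_meas by (auto intro: measurable_completion)
      note m = this
      show "(\<lambda>y. area s y *\<^sub>R (G y * f y)) \<in> borel_measurable lebesgue"
        by (intro borel_measurable_scaleR borel_measurable_times m f)
      show "(\<lambda>y. area s y *\<^sub>R (G y * f' y)) \<in> borel_measurable lebesgue"
        by (intro borel_measurable_scaleR borel_measurable_times m)
      show "AE y in lebesgue. area s y *\<^sub>R (G y * f y) = area s y *\<^sub>R (G y * f' y)" using eq by eventually_elim simp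
    qed
    also have "\<dots> = (\<integral>y. area s y *\<^sub>R (G y * f' y) \<partial>lborel)"
      by (rule integral_completion) (use area_meas G_meas f' in auto)
    also have "\<dots> = graph_op lam t f' x s"
      unfolding graph_op_def amp_def G_def by (simp add: scaleR_conv_of_real mult_ac)
    finally show ?thesis .
  qed
  have "L2_opnorm (\<lambda>f x. T_max \<psi> \<gamma> \<phi> K lam f (x, t))
      \<le> ennreal (C * lam powr (- (m / 2) * (real DIM('a) / (real DIM('a) + 2))))" if lam: "lam > 0" for lam t
    unfolding L2_opnorm_def
  proof (rule Inf_lower, rule CollectI, rule ballI)
    fix f :: "'a \<Rightarrow> complex" assume f: "f \<in> L2"
    let ?c = "C * lam powr (- (m / 2) * (real DIM('a) / (real DIM('a) + 2)))"
    have f_meas: "f \<in> borel_measurable lebesgue" using f by (simp add: L2_def)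
    have fin: "(\<integral>\<^sup>+y. (ennreal (norm (f y)))\<^sup>2 \<partial>lebesgue) < \<infinity>"
      using f by (auto simp: L2_def L2_norm_def Let_def less_top split: if_splits)
    obtain f' where f': "f' \<in> borel_measurable borel" "AE y in lebesgue. f y = f' y"
      using lebesgue_complex_ex_borel[OF f_meas] by blast
    have eqE: "(\<integral>\<^sup>+y. (ennreal (norm (f y)))\<^sup>2 \<partial>lebesgue) = energy f'"
    proof -
      have "(\<integral>\<^sup>+y. (ennreal (norm (f y)))\<^sup>2 \<partial>lebesgue) = (\<integral>\<^sup>+y. (ennreal (norm (f' y)))\<^sup>2 \<partial>lebesgue)"
        by (rule nn_integral_cong_AE) (use f'(2) in \<open>eventually_elim, simp\<close>)
      then show ?thesis by (simp add: nn_integral_completion)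
    qed
    have Tm: "(\<lambda>x. T_max \<psi> \<gamma> \<phi> K lam f (x, t)) = (\<lambda>x. SUP s\<in>{0<..1}. ennreal (norm (graph_op lam t f' x s)))"
      unfolding T_max_def using T_op_eq[OF _ f_meas f'] by (intro ext SUP_cong) auto
    have fin': "energy f' < \<infinity>" using fin eqE by simp
    show "(\<lambda>x. T_max \<psi> \<gamma> \<phi> K lam f (x, t)) \<in> borel_measurable lebesgue \<and>
        L2_norm (\<lambda>x. T_max \<psi> \<gamma> \<phi> K lam f (x, t)) \<le> ennreal ?c * L2_norm (\<lambda>x. ennreal (norm (f x)))"
    proof
      show "(\<lambda>x. T_max \<psi> \<gamma> \<phi> K lam f (x, t)) \<in> borel_measurable lebesgue"
        unfolding Tm by (rule graph_op_sup_measurable[OF f'(1) fin'])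
      show "L2_norm (\<lambda>x. T_max \<psi> \<gamma> \<phi> K lam f (x, t)) \<le> ennreal ?c * L2_norm (\<lambda>x. ennreal (norm (f x)))"
        unfolding Tm
      proof (rule L2_norm_le[OF _ _ fin])
        show "0 \<le> ?c" using C(1) by simp
        show "(\<integral>\<^sup>+x. (SUP s\<in>{0<..1}. ennreal (norm (graph_op lam t f' x s)))\<^sup>2 \<partial>lebesgue) \<le> ennreal (?c\<^sup>2) * (\<integral>\<^sup>+x. (ennreal (norm (f x)))\<^sup>2 \<partial>lebesgue)"
          unfolding eqE using C(2)[OF lam f'(1) fin', of t] by (simp only: nn_integral_completion)
      qed
    qed
  qed
  then show ?thesis by blast
qed

theorem theorem3p1:
  fixes \<psi> :: "real ^ 'n \<Rightarrow> real"
    and \<phi>\<^sub>0 :: "((real ^ 'n) \<times> real) \<times> (real ^ 'n) \<Rightarrow> real"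
    and K :: "(real ^ 'n) \<times> real \<Rightarrow> complex"
    and \<gamma> m :: real
  assumes "\<gamma> > 3 / 2"
    and "1 \<le> m" and "m < real CARD('n)"
    and "smooth_on UNIV \<psi>" and "bounded_derivs \<psi>"
    and "smooth_on UNIV \<phi>\<^sub>0" and "compactly_supported \<phi>\<^sub>0"
    and "smooth_on (UNIV - {0}) K" and "kernel_bounds (m - real CARD('n)) K"
  shows "\<exists>C::real. \<forall>lam>0. \<forall>t::real.
           L2_opnorm (\<lambda>f x. T_max \<psi> \<gamma> \<phi>\<^sub>0 K lam f (x, t))
             \<le> ennreal (C * lam powr (- (m / 2) * (real CARD('n) / (real CARD('n) + 2))))"
  using maximal_operator_bound[of \<gamma> m \<psi> \<phi>\<^sub>0 K] assms by simp

end
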